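(* For every real number $H$ with $0<H<1$, the processes $c_H X_{H,N}$ (regarded as càdlàg processes on $[0,\infty)$) converge weakly in $D([0,\infty))$, as $N\to\infty$, to fractional Brownian motion with Hurst index $H$.
   Context: For each natural number $N\ge 1$ let $\Delta t_N=\frac1N$, $T_N=\{k\Delta t_N : k\in\mathbb{Z}\}$, and let $T_N^+$ be the nonnegative part of $T_N$. Sums over elements of $T_N$ include the lower limit but not the upper limit: $\sum_{r=s}^t f(r)=f(s)+f(s+\Delta t_N)+\cdots+f(t-\Delta t_N)$; likewise $\sum_{r=-\infty}^s f(r)$ is the sum over all $r\in T_N$ with $r<s$. The forward increment of $f$ at $t\in T_N$ is $\Delta f(t)=f(t+\Delta t_N)-f(t)$. For each $N$, let $\omega_N(t)$, $t\in T_N$, be independent random variables taking the values $\pm1$ with probability $\frac12$ each, and let $\Delta B_N(t)=\sqrt{\Delta t_N}\,\omega_N(t)$. For $0<H<1$ define $$K_H=\begin{cases}-(H-\frac12)\,\zeta(\frac32-H) & \text{if } H<\frac12,\\ 1 & \text{if } H\ge\frac12,\end{cases}$$ where $\zeta(s)=\sum_{n=1}^\infty n^{-s}$ for $s>1$. The process $X_{H,N}$ on $T_N^+$ is defined by $X_{H,N}(0)=0$ and, for $s\in T_N^+$, $$\Delta X_{H,N}(s)=K_H\,\Delta t_N^{H-\frac12}\,\Delta B_N(s)+\sum_{r=-\infty}^{s}(H-\tfrac12)(s-r)^{H-\frac32}\,\Delta t_N\,\Delta B_N(r),$$ where the infinite sum (over $r\in T_N$, $r<s$) converges almost surely. $X_{H,N}$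 is extended to a càdlàg process on $[0,\infty)$ by making it constant between points of $T_N$, i.e. constant on each interval $[k\Delta t_N,(k+1)\Delta t_N)$, $k\geq 0$. The scaling constant is $$c_H=\left(\int_0^\infty\left((1+u)^{H-\frac12}-u^{H-\frac12}\right)^2du+\frac1{2H}\right)^{-\frac12}=\frac{\sqrt{\Gamma(2H+1)\sin(\pi H)}}{\Gamma(H+\frac12)}.$$ $D([0,\infty))$ is the space of real càdlàg functions on $[0,\infty)$ with the Skorokhod topology. Fractional Brownian motion with Hurst index $H$ is the continuous centered Gaussian process $(x_t)_{t\ge0}$ with covariance $E(x_sx_t)=\frac12\left(s^{2H}+t^{2H}-|t-s|^{2H}\right)$; it has the Mandelbrot–Van Ness representation $x_t=c_H\int_{-\infty}^t\left((t-r)^{H-\frac12}-(-r)_+^{H-\frac12}\right)db_r$, where $b$ is a two-sided standard Brownian motion and $(-r)_+^{H-\frac12}$ equals $(-r)^{H-\frac12}$ for $r<0$ and $0$ for $r\ge0$. *)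

theory Defs
  imports "HOL-Probability.Probability"
begin

text \<open>Elements are functions on $[0,\infty)$, i.e. functions on the reals that are
  \<^const>\<open>undefined\<close> outside \<open>{0..}\<close>.\<close>

definition cadlag :: "(real \<Rightarrow> real) set" where
  "cadlag = {x \<in> extensional {0..}.
     (\<forall>t\<ge>0. (x \<longlongrightarrow> x t) (at_right t)) \<and> (\<forall>t>0. \<exists>l. (x \<longlongrightarrow> l) (at_left t))}"

text \<open>Increasing bijections of $[0,\infty)$; these are automatically continuous and fix 0.\<close>

definition time_changes :: "(real \<Rightarrow> real) set" where
  "time_changes = {l. strict_mono_on {0..} l \<and> l ` {0..} = {0..}}"

definition skorokhod_nbhd :: "(real \<Rightarrow> real) \<Rightarrow> real \<Rightarrow> real \<Rightarrow> (real \<Rightarrow> real) set" where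
  "skorokhod_nbhd x T \<epsilon> = {y \<in> cadlag. \<exists>l\<in>time_changes.
     (\<forall>s\<ge>0. \<bar>l s - s\<bar> < \<epsilon>) \<and> (\<forall>s\<in>{0..T}. \<bar>y (l s) - x s\<bar> < \<epsilon>)}"

text \<open>The sets \<open>skorokhod_nbhd x T \<epsilon>\<close> with \<open>\<epsilon> > 0\<close> form a neighbourhood base at \<open>x\<close> of the
  Skorokhod (J1) topology. They are neighbourhoods, not necessarily open sets.
  The topology below is first countable and, by \<open>limitin_skorokhod\<close>, its convergent sequences
  are those of the metrizable Skorokhod topology, as characterised in Jacod--Shiryaev,
  Limit Theorems for Stochastic Processes, Theorem VI.1.14; hence the two topologies agree.\<close>

definition skorokhod :: "(real \<Rightarrow> real) topology" where
  "skorokhod = topology (\<lambda>U. U \<subseteq> cadlag \<and> (\<forall>x\<in>U. \<exists>T. \<exists>\<epsilon>>0. skorokhod_nbhd x T \<epsilon> \<subseteq> U))"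

lemma skorokhod_nbhd_mono:
  assumes "T \<le> T'" "\<epsilon>' \<le> \<epsilon>"
  shows "skorokhod_nbhd x T' \<epsilon>' \<subseteq> skorokhod_nbhd x T \<epsilon>"
proof
  fix y assume "y \<in> skorokhod_nbhd x T' \<epsilon>'"
  then obtain l where "y \<in> cadlag" "l \<in> time_changes" "\<And>s. s \<ge> 0 \<Longrightarrow> \<bar>l s - s\<bar> < \<epsilon>'"
    "\<And>s. s \<in> {0..T'} \<Longrightarrow> \<bar>y (l s) - x s\<bar> < \<epsilon>'"
    unfolding skorokhod_nbhd_def by auto
  moreover from this have "\<bar>l s - s\<bar> < \<epsilon>" if "s \<ge> 0" for s
    using that assms by (meson less_le_trans)
  moreover have "\<bar>y (l s) - x s\<bar> < \<epsilon>" if "s \<in> {0..T}" for s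
  proof -
    have "s \<in> {0..T'}" using that assms by simp
    with calculation(4) assms show ?thesis by (meson less_le_trans)
  qed
  ultimately show "y \<in> skorokhod_nbhd x T \<epsilon>" unfolding skorokhod_nbhd_def by blast
qed

lemma skorokhod_nbhd_refl:
  assumes "x \<in> cadlag" "\<epsilon> > 0"
  shows "x \<in> skorokhod_nbhd x T \<epsilon>"
proof -
  have "(\<lambda>s. s) \<in> time_changes"
    by (auto simp: time_changes_def strict_mono_on_def)
  thus ?thesis
    unfolding skorokhod_nbhd_def using assms by force
qed

lemma time_changes_comp:
  assumes "l \<in> time_changes" "m \<in> time_changes"
  shows "(\<lambda>s. m (l s)) \<in> time_changes"
proof -
  have "(\<lambda>s. m (l s)) ` {0..} = m ` l ` {0..}" by (simp add: image_image)
  moreover have "l s \<ge> 0" if "s \<ge> 0" for s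
    using assms that unfolding time_changes_def by fastforce
  ultimately show ?thesis
    using assms unfolding time_changes_def strict_mono_on_def by auto
qed

lemma skorokhod_nbhd_trans:
  assumes y: "y \<in> skorokhod_nbhd x T (\<epsilon> / 2)" and z: "z \<in> skorokhod_nbhd y (T + \<epsilon>) (\<epsilon> / 2)"
    and "\<epsilon> > 0"
  shows "z \<in> skorokhod_nbhd x T \<epsilon>"
proof -
  obtain l where l: "l \<in> time_changes" "\<And>s. s \<ge> 0 \<Longrightarrow> \<bar>l s - s\<bar> < \<epsilon> / 2"
    "\<And>s. s \<in> {0..T} \<Longrightarrow> \<bar>y (l s) - x s\<bar> < \<epsilon> / 2"
    using y unfolding skorokhod_nbhd_def by auto
  obtain m where m: "m \<in> time_changes" "\<And>s. s \<ge> 0 \<Longrightarrow> \<bar>m s - s\<bar> < \<epsilon> / 2"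
    "\<And>s. s \<in> {0..T + \<epsilon>} \<Longrightarrow> \<bar>z (m s) - y s\<bar> < \<epsilon> / 2"
    using z unfolding skorokhod_nbhd_def by auto
  have l0: "l s \<ge> 0" if "s \<ge> 0" for s
    using l(1) that unfolding time_changes_def by fastforce
  have "\<bar>m (l s) - s\<bar> < \<epsilon>" if "s \<ge> 0" for s
    using l(2)[OF that] m(2)[OF l0[OF that]] by linarith
  moreover have "\<bar>z (m (l s)) - x s\<bar> < \<epsilon>" if s: "s \<in> {0..T}" for s
  proof -
    have "l s \<in> {0..T + \<epsilon>}" using l0[of s] l(2)[of s] s by (simp add: abs_if split: if_splits)
    from m(3)[OF this] l(3)[OF s] show ?thesis by linarith
  qed
  ultimately show ?thesis
    using z time_changes_comp[OF l(1) m(1)] unfolding skorokhod_nbhd_def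
    by (intro CollectI conjI bexI[of _ "\<lambda>s. m (l s)"]) auto
qed

lemma openin_skorokhod:
  "openin skorokhod U \<longleftrightarrow> U \<subseteq> cadlag \<and> (\<forall>x\<in>U. \<exists>T. \<exists>\<epsilon>>0. skorokhod_nbhd x T \<epsilon> \<subseteq> U)"
proof -
  let ?P = "\<lambda>U. U \<subseteq> cadlag \<and> (\<forall>x\<in>U. \<exists>T. \<exists>\<epsilon>>0. skorokhod_nbhd x T \<epsilon> \<subseteq> U)"
  have "?P (S \<inter> S')" if S: "?P S" and S': "?P S'" for S S'
  proof (intro conjI ballI)
    show "S \<inter> S' \<subseteq> cadlag" using S by blast
    fix x assume x: "x \<in> S \<inter> S'"
    obtain T \<epsilon> where 1: "\<epsilon> > 0" "skorokhod_nbhd x T \<epsilon> \<subseteq> S" using S x by blast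
    obtain T' \<epsilon>' where 2: "\<epsilon>' > 0" "skorokhod_nbhd x T' \<epsilon>' \<subseteq> S'" using S' x by blast
    have "skorokhod_nbhd x (max T T') (min \<epsilon> \<epsilon>') \<subseteq> S \<inter> S'"
      using 1 2 skorokhod_nbhd_mono[of T "max T T'" "min \<epsilon> \<epsilon>'" \<epsilon> x]
        skorokhod_nbhd_mono[of T' "max T T'" "min \<epsilon> \<epsilon>'" \<epsilon>' x] by auto
    thus "\<exists>T. \<exists>\<epsilon>>0. skorokhod_nbhd x T \<epsilon> \<subseteq> S \<inter> S'"
      using 1(1) 2(1) by (metis min_less_iff_conj)
  qed
  moreover have "?P (\<Union>K)" if "\<forall>S\<in>K. ?P S" for K
    using that by (meson Sup_least UnionE Union_upper order_trans)
  ultimately have "istopology ?P" unfolding istopology_def by blast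
  thus ?thesis unfolding skorokhod_def by (simp add: topology_inverse')
qed

lemma topspace_skorokhod: "topspace skorokhod = cadlag"
proof -
  have "openin skorokhod cadlag"
    unfolding openin_skorokhod skorokhod_nbhd_def by (auto intro!: exI[of _ "1::real"])
  thus ?thesis
    by (metis openin_skorokhod openin_subset openin_topspace subset_antisym)
qed

lemma skorokhod_nbhd_interior:
  assumes "x \<in> cadlag" "\<epsilon> > 0"
  shows "\<exists>U. openin skorokhod U \<and> x \<in> U \<and> U \<subseteq> skorokhod_nbhd x T \<epsilon>"
proof (intro exI conjI)
  let ?U = "{y \<in> cadlag. \<exists>T'. \<exists>\<epsilon>'>0. skorokhod_nbhd y T' \<epsilon>' \<subseteq> skorokhod_nbhd x T \<epsilon>}"
  show "x \<in> ?U" using assms by blast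
  show "?U \<subseteq> skorokhod_nbhd x T \<epsilon>" using skorokhod_nbhd_refl by blast
  show "openin skorokhod ?U"
    unfolding openin_skorokhod
  proof (intro conjI ballI)
    fix y assume "y \<in> ?U"
    then obtain T' \<epsilon>' where *: "\<epsilon>' > 0" "skorokhod_nbhd y T' \<epsilon>' \<subseteq> skorokhod_nbhd x T \<epsilon>" by blast
    have "z \<in> ?U" if z: "z \<in> skorokhod_nbhd y T' (\<epsilon>' / 2)" for z
    proof -
      have "skorokhod_nbhd z (T' + \<epsilon>') (\<epsilon>' / 2) \<subseteq> skorokhod_nbhd y T' \<epsilon>'"
        using skorokhod_nbhd_trans[OF z _ *(1)] by blast
      moreover have "z \<in> cadlag" using z unfolding skorokhod_nbhd_def by blast
      moreover have "\<epsilon>' / 2 > 0" using *(1) by simp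
      ultimately show ?thesis using *(2) by blast
    qed
    thus "\<exists>T'. \<exists>\<epsilon>'>0. skorokhod_nbhd y T' \<epsilon>' \<subseteq> ?U"
      using *(1) by (meson half_gt_zero subsetI)
  qed blast
qed

lemma limitin_skorokhod_nbhd:
  assumes "x \<in> cadlag"
  shows "limitin skorokhod y x F \<longleftrightarrow>
    (\<forall>T. \<forall>\<epsilon>>0. \<forall>\<^sub>F n in F. y n \<in> skorokhod_nbhd x T \<epsilon>)" (is "?L \<longleftrightarrow> ?R")
proof
  assume L: ?L
  show ?R
  proof (intro allI impI)
    fix T \<epsilon> :: real assume "\<epsilon> > 0"
    then obtain U where U: "openin skorokhod U" "x \<in> U" "U \<subseteq> skorokhod_nbhd x T \<epsilon>"
      using skorokhod_nbhd_interior assms by blast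
    hence "\<forall>\<^sub>F n in F. y n \<in> U" using L unfolding limitin_def by blast
    thus "\<forall>\<^sub>F n in F. y n \<in> skorokhod_nbhd x T \<epsilon>"
      by (rule eventually_mono) (use U(3) in blast)
  qed
next
  assume R: ?R
  show ?L unfolding limitin_def topspace_skorokhod
  proof (intro conjI allI impI)
    fix U assume "openin skorokhod U \<and> x \<in> U"
    then obtain T \<epsilon> where *: "\<epsilon> > 0" "skorokhod_nbhd x T \<epsilon> \<subseteq> U"
      unfolding openin_skorokhod by blast
    show "\<forall>\<^sub>F n in F. y n \<in> U"
      by (rule eventually_mono[OF R[rule_format, OF *(1), of T]]) (use *(2) in blast)
  qed (use assms in auto)
qed

lemma limitin_skorokhod:
  assumes "x \<in> cadlag" "\<And>n. y n \<in> cadlag"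
  shows "limitin skorokhod y x sequentially \<longleftrightarrow>
    (\<exists>l. (\<forall>n. l n \<in> time_changes) \<and> uniform_limit {0..} l (\<lambda>s. s) sequentially \<and>
      (\<forall>T. uniform_limit {0..T} (\<lambda>n s. y n (l n s)) x sequentially))" (is "?L \<longleftrightarrow> ?R")
proof
  assume ?R
  then obtain l where l: "\<And>n. l n \<in> time_changes"
    "uniform_limit {0..} l (\<lambda>s. s) sequentially"
    "\<And>T. uniform_limit {0..T} (\<lambda>n s. y n (l n s)) x sequentially" by blast
  show ?L unfolding limitin_skorokhod_nbhd[OF assms(1)]
  proof (intro allI impI)
    fix T \<epsilon> :: real assume \<epsilon>: "\<epsilon> > 0"
    have "\<forall>\<^sub>F n in sequentially. (\<forall>s\<in>{0..}. dist (l n s) s < \<epsilon>) \<and>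
        (\<forall>s\<in>{0..T}. dist (y n (l n s)) (x s) < \<epsilon>)"
      using uniform_limitD[OF l(2) \<epsilon>] uniform_limitD[OF l(3) \<epsilon>] by (rule eventually_conj)
    thus "\<forall>\<^sub>F n in sequentially. y n \<in> skorokhod_nbhd x T \<epsilon>"
    proof (rule eventually_mono)
      fix n assume "(\<forall>s\<in>{0..}. dist (l n s) s < \<epsilon>) \<and> (\<forall>s\<in>{0..T}. dist (y n (l n s)) (x s) < \<epsilon>)"
      thus "y n \<in> skorokhod_nbhd x T \<epsilon>"
        unfolding skorokhod_nbhd_def using assms(2) l(1) by (auto simp: dist_real_def)
    qed
  qed
next
  assume L: ?L
  define P where "P n k l \<longleftrightarrow> l \<in> time_changes \<and> (\<forall>s\<ge>0. \<bar>l s - s\<bar> < 1 / real (Suc k)) \<and>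
     (\<forall>s\<in>{0..real k}. \<bar>y n (l s) - x s\<bar> < 1 / real (Suc k))" for n k l
  define l where "l n = (let S = {k. k \<le> n \<and> (\<exists>l. P n k l)} in
    if S = {} then (\<lambda>s. s) else (SOME l. P n (Max S) l))" for n
  have id: "(\<lambda>s. s) \<in> time_changes"
    by (auto simp: time_changes_def strict_mono_on_def)
  have key: "l n \<in> time_changes \<and> (\<forall>k\<le>n. (\<exists>l'. P n k l') \<longrightarrow> P n k (l n))" for n
  proof (cases "{k. k \<le> n \<and> (\<exists>l. P n k l)} = {}")
    case True
    thus ?thesis using id unfolding l_def by auto
  next
    case False
    define S where "S = {k. k \<le> n \<and> (\<exists>l. P n k l)}"
    have S: "finite S" "S \<noteq> {}" using False unfolding S_def by auto
    have "Max S \<in> S" using S by (rule Max_in)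
    hence "\<exists>l. P n (Max S) l" unfolding S_def by blast
    hence "P n (Max S) (SOME l. P n (Max S) l)" by (rule someI_ex)
    hence 1: "P n (Max S) (l n)" using S(2) unfolding l_def S_def[symmetric] by simp
    have "P n k (l n)" if "k \<le> n" "\<exists>l'. P n k l'" for k
    proof -
      have "k \<le> Max S" using that S(1) unfolding S_def by (intro Max_ge) auto
      moreover from this have "1 / real (Suc (Max S)) \<le> 1 / real (Suc k)"
        by (simp add: frac_le)
      ultimately show ?thesis using 1 unfolding P_def
        by (auto intro: less_le_trans simp del: of_nat_Suc)
    qed
    thus ?thesis using 1 unfolding P_def by blast
  qed
  have ev: "\<forall>\<^sub>F n in sequentially. P n k (l n)" for k
  proof -
    have "\<forall>\<^sub>F n in sequentially. y n \<in> skorokhod_nbhd x (real k) (1 / real (Suc k))"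
      using L unfolding limitin_skorokhod_nbhd[OF assms(1)] by simp
    hence "\<forall>\<^sub>F n in sequentially. \<exists>l'. P n k l'"
      by (rule eventually_mono) (auto simp: skorokhod_nbhd_def P_def)
    with eventually_ge_at_top[of k] show ?thesis
      by eventually_elim (use key in blast)
  qed
  have small: "\<exists>k. T \<le> real k \<and> 1 / real (Suc k) < \<epsilon>" if pos: "\<epsilon> > 0" for T \<epsilon> :: real
  proof -
    obtain a where a: "1 / real (Suc a) < \<epsilon>" using nat_approx_posE[OF pos] by blast
    obtain b where b: "T \<le> real b" using real_arch_simple by blast
    have "1 / real (Suc (max a b)) \<le> 1 / real (Suc a)" by (simp add: frac_le)
    thus ?thesis using a b by (intro exI[of _ "max a b"]) auto
  qed
  show ?R
  proof (intro exI[of _ l] conjI allI)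
    show "l n \<in> time_changes" for n using key by blast
    show "uniform_limit {0..} l (\<lambda>s. s) sequentially"
    proof (rule uniform_limitI)
      fix \<epsilon> :: real assume "\<epsilon> > 0"
      then obtain k where k: "1 / real (Suc k) < \<epsilon>" using small by blast
      from ev[of k] show "\<forall>\<^sub>F n in sequentially. \<forall>s\<in>{0..}. dist (l n s) s < \<epsilon>"
      proof (rule eventually_mono)
        fix n assume "P n k (l n)"
        thus "\<forall>s\<in>{0..}. dist (l n s) s < \<epsilon>"
          using k unfolding P_def dist_real_def by (meson atLeast_iff less_trans)
      qed
    qed
    fix T
    show "uniform_limit {0..T} (\<lambda>n s. y n (l n s)) x sequentially"
    proof (rule uniform_limitI)
      fix \<epsilon> :: real assume "\<epsilon> > 0"
      then obtain k where k: "T \<le> real k" "1 / real (Suc k) < \<epsilon>" using small by blast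
      from ev[of k] show "\<forall>\<^sub>F n in sequentially. \<forall>s\<in>{0..T}. dist (y n (l n s)) (x s) < \<epsilon>"
      proof (rule eventually_mono)
        fix n assume "P n k (l n)"
        thus "\<forall>s\<in>{0..T}. dist (y n (l n s)) (x s) < \<epsilon>"
          using k unfolding P_def dist_real_def by (meson atLeastAtMost_iff less_trans order_trans)
      qed
    qed
  qed
qed

definition borel_of_top :: "'a topology \<Rightarrow> 'a measure" where
  "borel_of_top X = sigma (topspace X) {U. openin X U}"

definition weak_conv_top :: "'a topology \<Rightarrow> (nat \<Rightarrow> 'a measure) \<Rightarrow> 'a measure \<Rightarrow> bool" where
  "weak_conv_top X \<mu> \<nu> \<longleftrightarrow>
     (\<forall>\<phi>. continuous_map X euclideanreal \<phi> \<and> bounded (\<phi> ` topspace X) \<longrightarrow>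
        (\<lambda>n. integral\<^sup>L (\<mu> n) \<phi>) \<longlonglongrightarrow> integral\<^sup>L \<nu> \<phi>)"

text \<open>The grid point \<open>k * dt N\<close> is represented by the integer \<open>k\<close>, and \<open>w k\<close> is the sign
  attached to it. All processes are defined path by path.\<close>

definition dt :: "nat \<Rightarrow> real" where
  "dt N = 1 / real N"

definition dB :: "nat \<Rightarrow> (int \<Rightarrow> real) \<Rightarrow> int \<Rightarrow> real" where
  "dB N w k = sqrt (dt N) * w k"

definition zeta :: "real \<Rightarrow> real" where
  "zeta s = (\<Sum>n. real (Suc n) powr (- s))"

definition KH :: "real \<Rightarrow> real" where
  "KH H = (if H < 1/2 then - (H - 1/2) * zeta (3/2 - H) else 1)"

text \<open>The index \<open>j\<close> of the series stands for the grid point \<open>r = s - (j + 1) * dt N\<close>. For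
  \<open>H > 1/2\<close> the series is in general only conditionally convergent, so it is summed in the order
  of decreasing \<open>r\<close>. On the null set where it diverges its value is irrelevant.\<close>

definition dX :: "real \<Rightarrow> nat \<Rightarrow> (int \<Rightarrow> real) \<Rightarrow> int \<Rightarrow> real" where
  "dX H N w k = KH H * dt N powr (H - 1/2) * dB N w k +
     (\<Sum>j. (H - 1/2) * (real (Suc j) * dt N) powr (H - 3/2) * dt N * dB N w (k - int (Suc j)))"

definition X_grid :: "real \<Rightarrow> nat \<Rightarrow> (int \<Rightarrow> real) \<Rightarrow> nat \<Rightarrow> real" where
  "X_grid H N w n = (\<Sum>k<n. dX H N w (int k))"

definition X_path :: "real \<Rightarrow> nat \<Rightarrow> (int \<Rightarrow> real) \<Rightarrow> real \<Rightarrow> real" where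
  "X_path H N w t = X_grid H N w (nat \<lfloor>real N * t\<rfloor>)"

definition cH :: "real \<Rightarrow> real" where
  "cH H = ((LBINT u:{0..}. ((1 + u) powr (H - 1/2) - u powr (H - 1/2))\<^sup>2) + 1 / (2 * H)) powr (- 1/2)"

text \<open>Normal distributions may be degenerate, as is needed for Gaussian processes.\<close>

definition normal_rv :: "'a measure \<Rightarrow> ('a \<Rightarrow> real) \<Rightarrow> bool" where
  "normal_rv M Z \<longleftrightarrow> Z \<in> borel_measurable M \<and>
     ((\<exists>m. AE x in M. Z x = m) \<or> (\<exists>m. \<exists>\<sigma>>0. distributed M lborel Z (normal_density m \<sigma>)))"

definition gaussian_process :: "'a measure \<Rightarrow> (real \<Rightarrow> 'a \<Rightarrow> real) \<Rightarrow> bool" where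
  "gaussian_process M Y \<longleftrightarrow>
     (\<forall>S a. finite S \<and> S \<subseteq> {0..} \<longrightarrow> normal_rv M (\<lambda>x. \<Sum>t\<in>S. a t * Y t x))"

definition fractional_BM :: "real \<Rightarrow> 'a measure \<Rightarrow> (real \<Rightarrow> 'a \<Rightarrow> real) \<Rightarrow> bool" where
  "fractional_BM H M Y \<longleftrightarrow> prob_space M \<and>
     (\<forall>x\<in>space M. continuous_on {0..} (\<lambda>t. Y t x)) \<and>
     gaussian_process M Y \<and>
     (\<forall>t\<ge>0. integral\<^sup>L M (Y t) = 0) \<and>
     (\<forall>s\<ge>0. \<forall>t\<ge>0. integral\<^sup>L M (\<lambda>x. Y s x * Y t x) =
        (s powr (2*H) + t powr (2*H) - \<bar>t - s\<bar> powr (2*H)) / 2)"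

end

theory Submission
  imports Defs "HOL-Real_Asymp.Real_Asymp"
begin

text \<open>
  At the grid point \<open>n/N\<close> the process equals \<open>N powr (-H) * S n\<close>, where \<open>S n\<close> does not depend on
  \<open>N\<close> and is a linear combination \<open>\<Sum>i. kernel H n i * \<omega> i\<close> of the independent signs. Its kernel is a
  difference of two partial sums of the weights, and these partial sums behave like
  \<open>m powr (H - 1/2)\<close>. For \<open>H > 1/2\<close> this is a comparison of a sum with an integral. For \<open>H < 1/2\<close>
  the constant \<open>KH H\<close> is exactly the one that makes the weights sum to zero, so that a partial sum is
  a tail of the zeta series. After rescaling, the kernel is therefore a discrete version of the
  Mandelbrot--Van Ness kernel, and dominated convergence (\<open>kernel_var_asymp\<close>) gives
  \<open>Var (S n) / n powr (2*H) \<longlonglongrightarrow> 1 / (cH H)\<^sup>2\<close>. As the increments of \<open>S\<close> are stationary, the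
  covariances follow from the variances by polarization.

  Every linear combination of values of the process is a series of independent signs whose
  coefficients are uniformly small, because the kernel grows more slowly than \<open>n powr H\<close>. Its
  characteristic function is a product of cosines and so is close to that of a normal variable;
  with the covariances this gives convergence of all finite-dimensional characteristic functions
  (\<open>grid_fdd_char\<close>). The bound \<open>cosh x \<le> exp (x\<^sup>2 / 2)\<close> shows that the moment of order \<open>2p\<close> of
  a sign series is at most a constant times the \<open>p\<close>-th power of its variance. Taking \<open>p\<close> large compared
  with \<open>1/H\<close>, dyadic chaining bounds the oscillation of the process on short time intervals uniformly in
  \<open>N\<close> (\<open>grid_modulus_uniform\<close>). Second moments would suffice for \<open>H > 1/2\<close> only.

  The Skorokhod topology is coarser than that of locally uniform convergence, so a bounded
  continuous functional is the pointwise limit from below of functionals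
  that are Lipschitz for the supremum norm on a bounded interval (\<open>lipschitz_minorant\<close>). For such a
  minorant, replacing a path by the step path through its values at the multiples of \<open>1/m\<close> costs
  little, by the oscillation bound; and on step paths it is a continuous function of finitely many
  coordinates, for which convergence follows from that of characteristic functions by the
  Stone--Weierstrass theorem (\<open>char_tendsto_imp_expectation_tendsto\<close>). This bounds the lower limit of
  the expectations from below by the expectation in the limit, and the same bound for the negative
  functional completes the proof (\<open>weak_convergence\<close>). The minorants also
  give measurability: the indicator of an open set is lower semicontinuous, hence a limit of such
  functionals.
\<close>

section \<open>Partial sums of the weights\<close>

text \<open>The coefficient with which the sign at distance \<open>j\<close> in the past enters one increment, up to the
  factor \<open>N powr (-H)\<close>. It vanishes for negative \<open>j\<close>, so that sums over the past can be written as
  sums over all integers.\<close>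
definition weight :: "real \<Rightarrow> int \<Rightarrow> real" where
  "weight H j = (if j < 0 then 0 else if j = 0 then KH H else (H - 1/2) * real_of_int j powr (H - 3/2))"

definition cumweight :: "real \<Rightarrow> nat \<Rightarrow> real" where
  "cumweight H m = (\<Sum>j\<le>m. weight H (int j))"

lemma powr_mvt:
  fixes x y g :: real
  assumes "0 < x" "x < y"
  shows "\<exists>z. x < z \<and> z < y \<and> y powr g - x powr g = (y - x) * (g * z powr (g - 1))"
proof -
  have "((\<lambda>x. x powr g) has_real_derivative g * z powr (g - 1)) (at z)" if "x \<le> z" "z \<le> y" for z
    using that assms by (auto intro!: derivative_eq_intros)
  from MVT2[OF assms(2) this] show ?thesis by auto
qed

text \<open>This estimate and the next one compare \<open>g * j powr (g - 1)\<close> with differences of \<open>j powr g\<close>, which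
  telescope. The absolute values let one statement cover increasing (\<open>g > 0\<close>) and
  decreasing (\<open>g < 0\<close>) powers.\<close>
lemma powr_increment_upper:
  fixes x g :: real
  assumes "0 < x" "g \<le> 1"
  shows "\<bar>(x + 1) powr g - x powr g\<bar> \<le> \<bar>g * x powr (g - 1)\<bar>"
proof -
  obtain z where z: "x < z" "(x + 1) powr g - x powr g = (x + 1 - x) * (g * z powr (g - 1))"
    using powr_mvt[of x "x + 1" g] assms by auto
  have "z powr (g - 1) \<le> x powr (g - 1)" using assms z(1) by (intro powr_mono2') auto
  thus ?thesis unfolding z(2) by (simp add: abs_mult mult_left_mono)
qed

lemma powr_increment_lower:
  fixes x g :: real
  assumes "0 < x" "g \<le> 1"
  shows "\<bar>g * (x + 1) powr (g - 1)\<bar> \<le> \<bar>(x + 1) powr g - x powr g\<bar>"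
proof -
  obtain z where z: "x < z" "z < x + 1" "(x + 1) powr g - x powr g = (x + 1 - x) * (g * z powr (g - 1))"
    using powr_mvt[of x "x + 1" g] assms by auto
  have "(x + 1) powr (g - 1) \<le> z powr (g - 1)" using assms z(1,2) by (intro powr_mono2') auto
  thus ?thesis unfolding z(3) by (simp add: abs_mult mult_left_mono)
qed

lemma cumweight_Suc: "cumweight H (Suc m) = cumweight H m + (H - 1/2) * (real m + 1) powr (H - 3/2)"
  by (simp add: cumweight_def weight_def algebra_simps)

lemma cumweight_0: "cumweight H 0 = KH H" by (simp add: cumweight_def weight_def)

lemma cumweight_bounds_above_half:
  assumes "1/2 \<le> H" "H < 1"
  shows "(real m + 1) powr (H - 1/2) \<le> cumweight H m \<and> cumweight H m \<le> 1 + real m powr (H - 1/2)"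
proof (induction m)
  case 0 thus ?case using assms by (simp add: cumweight_0 KH_def)
next
  case (Suc m)
  have 1: "(real m + 1 + 1) powr (H - 1/2) - (real m + 1) powr (H - 1/2) \<le> (H - 1/2) * (real m + 1) powr (H - 1/2 - 1)"
    using powr_increment_upper[of "real m + 1" "H - 1/2"] assms by simp
  have 2: "(H - 1/2) * (real m + 1) powr (H - 1/2 - 1) \<le> 1 + (real m + 1) powr (H - 1/2) - 1 - real m powr (H - 1/2)"
  proof (cases "m = 0")
    case True thus ?thesis using assms by simp
  next
    case False
    have "real m powr (H - 1/2) \<le> (real m + 1) powr (H - 1/2)" using assms by (intro powr_mono2) auto
    thus ?thesis
    using powr_increment_lower[of "real m" "H - 1/2"] assms False by (simp add: abs_mult)
  qed
  have "H - 1/2 - 1 = H - 3/2" by simp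
  with Suc 1 2 show ?case unfolding cumweight_Suc by (simp add: algebra_simps)
qed

text \<open>Since \<open>KH H\<close> is the sum of the series \<open>(1/2 - H) * j powr (H - 3/2)\<close> over \<open>j \<ge> 1\<close>, the partial sum
  of the weights is a tail of this series, and the tail lies between two telescoping series.\<close>
lemma cumweight_bounds_below_half:
  assumes "0 < H" "H < 1/2"
  shows "(real m + 1) powr (H - 1/2) \<le> cumweight H m"
    and "m > 0 \<Longrightarrow> cumweight H m \<le> real m powr (H - 1/2)"
proof -
  let ?a = "\<lambda>n. real (Suc n) powr (H - 3/2)"
  have tend: "(\<lambda>n. real (n + k) powr (H - 1/2)) \<longlonglongrightarrow> 0" for k
    using assms by real_asymp
  have le: "(1/2 - H) * ?a (n + k) \<le> real (n + k) powr (H - 1/2) - real (Suc n + k) powr (H - 1/2)" if "k > 0" for n k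
  proof -
    have "real (Suc n + k) powr (H - 1/2) \<le> real (n + k) powr (H - 1/2)" using assms that by (intro powr_mono2') auto
    thus ?thesis using powr_increment_lower[of "real (n + k)" "H - 1/2"] assms that by (simp add: abs_mult add_ac)
  qed
  have ge: "real (n + Suc k) powr (H - 1/2) - real (Suc n + Suc k) powr (H - 1/2) \<le> (1/2 - H) * ?a (n + k)" for n k
  proof -
    have "real (Suc n + Suc k) powr (H - 1/2) \<le> real (n + Suc k) powr (H - 1/2)" using assms by (intro powr_mono2') auto
    thus ?thesis using powr_increment_upper[of "real (n + Suc k)" "H - 1/2"] assms by (simp add: abs_mult add_ac)
  qed
  have tel: "(\<lambda>n. real (n + k) powr (H - 1/2) - real (Suc n + k) powr (H - 1/2)) sums (real k powr (H - 1/2))" for k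
    using telescope_sums'[OF tend[of k]] by simp
  have summ1: "summable (\<lambda>n. (1/2 - H) * ?a (n + 1))"
    by (rule summable_comparison_test[OF _ sums_summable[OF tel[of 1]]])
       (use le[of 1] assms in \<open>auto simp del: of_nat_Suc of_nat_add\<close>)
  hence summ: "summable (\<lambda>n. (1/2 - H) * ?a n)"
    using summable_iff_shift[of "\<lambda>n. (1/2 - H) * ?a n" 1] by simp
  have tail: "cumweight H m = (\<Sum>n. (1/2 - H) * ?a (n + m))"
  proof (induction m)
    case 0
    have "summable ?a" using summ assms by (simp add: summable_cmult_iff del: of_nat_Suc)
    thus ?case using assms by (simp add: cumweight_0 KH_def zeta_def suminf_mult[symmetric] minus_divide_left[symmetric] del: of_nat_Suc)
  next
    case (Suc m)
    have "summable (\<lambda>n. (1/2 - H) * ?a (n + m))" using summ summable_iff_shift[of "\<lambda>n. (1/2 - H) * ?a n" m] by simp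
    from suminf_split_head[OF this] Suc show ?case by (simp add: cumweight_Suc algebra_simps)
  qed
  have sm: "summable (\<lambda>n. (1/2 - H) * ?a (n + m))" using summ summable_iff_shift[of "\<lambda>n. (1/2 - H) * ?a n" m] by simp
  show "(real m + 1) powr (H - 1/2) \<le> cumweight H m"
    using suminf_le[OF ge[of _ m] sums_summable[OF tel[of "Suc m"]] sm] unfolding tail sums_unique[OF tel[of "Suc m"], symmetric]
    by (simp add: add_ac)
  show "cumweight H m \<le> real m powr (H - 1/2)" if "m > 0"
    using suminf_le[OF le[OF that] sm sums_summable[OF tel[of m]]] unfolding tail sums_unique[OF tel[of m], symmetric] .
qed

text \<open>The normalization by \<open>m + 1\<close> in place of \<open>m\<close> is harmless in the limit and makes the ratio
  meaningful, hence bounded, at \<open>m = 0\<close> too.\<close>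
lemma cumweight_asymp:
  assumes "0 < H" "H < 1"
  shows "(\<lambda>m. cumweight H m / (real m + 1) powr (H - 1/2)) \<longlonglongrightarrow> 1"
proof (cases "H < 1/2")
  case True
  show ?thesis
  proof (rule tendsto_sandwich)
    show "\<forall>\<^sub>F m in sequentially. 1 \<le> cumweight H m / (real m + 1) powr (H - 1/2)"
      using cumweight_bounds_below_half(1)[OF assms(1) True] by (simp add: field_simps)
    show "\<forall>\<^sub>F m in sequentially. cumweight H m / (real m + 1) powr (H - 1/2) \<le> real m powr (H - 1/2) / (real m + 1) powr (H - 1/2)"
      using eventually_gt_at_top[of 0] by eventually_elim (use cumweight_bounds_below_half(2)[OF assms(1) True] in \<open>auto intro!: divide_right_mono\<close>)
    show "(\<lambda>m. real m powr (H - 1/2) / (real m + 1) powr (H - 1/2)) \<longlonglongrightarrow> 1"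
      by real_asymp
  qed auto
next
  case False
  show ?thesis
  proof (cases "H = 1/2")
    case True
    have "cumweight H m = 1" for m
      by (induction m) (simp_all add: cumweight_Suc cumweight_0 KH_def True)
    thus ?thesis unfolding True by simp
  next
    case F: False
    show ?thesis
    proof (rule tendsto_sandwich)
      show "\<forall>\<^sub>F m in sequentially. 1 \<le> cumweight H m / (real m + 1) powr (H - 1/2)"
        using cumweight_bounds_above_half[of H] assms False by (simp add: field_simps)
      show "\<forall>\<^sub>F m in sequentially. cumweight H m / (real m + 1) powr (H - 1/2) \<le> (1 + real m powr (H - 1/2)) / (real m + 1) powr (H - 1/2)"
        using cumweight_bounds_above_half[of H] assms False by (intro always_eventually allI divide_right_mono) auto
      have "H - 1/2 > 0" using F False by simp
      thus "(\<lambda>m. (1 + real m powr (H - 1/2)) / (real m + 1) powr (H - 1/2)) \<longlonglongrightarrow> 1"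
        by real_asymp
    qed auto
  qed
qed

lemma cumweight_nonneg: "0 < H \<Longrightarrow> H < 1 \<Longrightarrow> 0 \<le> cumweight H m"
  using cumweight_bounds_below_half(1)[of H m] cumweight_bounds_above_half[of H m] 
  by (cases "H < 1/2") (auto intro: order_trans[OF powr_ge_zero])

lemma cumweight_bound:
  assumes "0 < H" "H < 1"
  obtains C where "C > 0" "\<And>m. \<bar>cumweight H m\<bar> \<le> C * (real m + 1) powr (H - 1/2)"
proof -
  have "Bseq (\<lambda>m. cumweight H m / (real m + 1) powr (H - 1/2))"
    using cumweight_asymp[OF assms] by (intro convergent_imp_Bseq) (auto simp: convergent_def)
  then obtain C where C: "C > 0" "\<And>m. \<bar>cumweight H m / (real m + 1) powr (H - 1/2)\<bar> \<le> C"
    unfolding Bseq_def by auto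
  show ?thesis using C(2) by (intro that[OF C(1)]) (simp add: abs_divide field_simps)
qed

section \<open>The kernel of the partial sums\<close>

text \<open>The coefficient of the sign \<open>\<omega> i\<close> in the sum of the first \<open>n\<close> unscaled increments.\<close>
definition kernel :: "real \<Rightarrow> nat \<Rightarrow> int \<Rightarrow> real" where
  "kernel H n i = (\<Sum>k<n. weight H (int k - i))"

definition kernel_var :: "real \<Rightarrow> nat \<Rightarrow> real" where
  "kernel_var H n = (\<Sum>\<^sub>\<infinity>i\<in>UNIV. (kernel H n i)\<^sup>2)"

lemma kernel_future: "int n \<le> i \<Longrightarrow> kernel H n i = 0"
  by (simp add: kernel_def weight_def)

lemma kernel_present: "i \<le> n \<Longrightarrow> kernel H (Suc n) (int i) = cumweight H (n - i)"
proof (induction n)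
  case 0 thus ?case by (simp add: kernel_def cumweight_def)
next
  case (Suc n)
  show ?case
  proof (cases "i = Suc n")
    case True
    thus ?thesis by (simp add: kernel_def cumweight_def weight_def)
  next
    case False
    hence "i \<le> n" using Suc by simp
    moreover have "kernel H (Suc (Suc n)) (int i) = kernel H (Suc n) (int i) + weight H (int (Suc n) - int i)"
      by (simp add: kernel_def)
    moreover have "weight H (int (Suc n) - int i) = weight H (int (Suc (n - i)))"
      by (rule arg_cong[where f = "weight H"]) (use \<open>i \<le> n\<close> in simp)
    ultimately show ?thesis using Suc \<open>i \<le> n\<close> by (simp add: Suc_diff_le cumweight_def del: of_nat_Suc of_nat_diff)
  qed
qed

text \<open>The discrete counterpart of \<open>(t - r) powr (H - 1/2) - (- r) powr (H - 1/2)\<close> for \<open>r < 0\<close>.\<close>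
abbreviation past_kernel :: "real \<Rightarrow> nat \<Rightarrow> nat \<Rightarrow> real" where
  "past_kernel H n q \<equiv> cumweight H (n + q) - cumweight H q"

lemma kernel_past: "kernel H n (- int (Suc q)) = past_kernel H n q"
proof (induction n)
  case (Suc n)
  have "int n - - int (Suc q) = int (Suc (n + q))" by simp
  hence "weight H (int n - - int (Suc q)) = weight H (int (Suc (n + q)))" by (rule arg_cong)
  thus ?case using Suc unfolding kernel_def sum.lessThan_Suc by (simp add: cumweight_def del: of_nat_Suc)
qed (simp add: kernel_def)

text \<open>Stationarity of the increments: those after time \<open>m\<close> have the kernel of those after time \<open>0\<close>,
  shifted by \<open>m\<close>.\<close>
lemma kernel_add: "kernel H (m + d) i = kernel H m i + kernel H d (i - int m)"
proof (induction d)
  case (Suc d)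
  have "int (m + d) - i = int d - (i - int m)" by simp
  hence "weight H (int (m + d) - i) = weight H (int d - (i - int m))" by (rule arg_cong)
  with Suc show ?case by (simp add: kernel_def del: of_nat_add)
qed (simp add: kernel_def)

section \<open>Sums as integrals of step functions\<close>

abbreviation cell :: "nat \<Rightarrow> real \<Rightarrow> nat" where
  "cell n t \<equiv> nat \<lfloor>real n * t\<rfloor>"

text \<open>A step function with steps of width \<open>1/n\<close> turns a normalized sum into a Lebesgue integral.\<close>
lemma nn_integral_step:
  fixes F :: "nat \<Rightarrow> real"
  assumes n: "n > 0" and F: "\<And>q. 0 \<le> F q"
  shows "(\<integral>\<^sup>+u. ennreal (indicator {0..} u * F (cell n u)) \<partial>lborel) * ennreal (real n) = (\<Sum>q. ennreal (F q))"
proof -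
  let ?I = "\<lambda>q. {real q / real n..<real (Suc q) / real n}"
  have *: "ennreal (indicator {0..} u * F (cell n u)) = (\<Sum>q. ennreal (F q) * indicator (?I q) u)" for u
  proof (cases "u \<ge> 0")
    case True
    have "u \<in> ?I q \<longleftrightarrow> q = cell n u" for q
    proof -
      have "u \<in> ?I q \<longleftrightarrow> real q \<le> real n * u \<and> real n * u < real q + 1" using n by (simp add: field_simps)
      also have "\<dots> \<longleftrightarrow> \<lfloor>real n * u\<rfloor> = int q" by (simp add: floor_eq_iff)
      also have "\<dots> \<longleftrightarrow> q = cell n u" using True n by (auto simp: nat_eq_iff)
      finally show ?thesis .
    qed
    hence "(\<lambda>q. ennreal (F q) * indicator (?I q) u) = (\<lambda>q. if q = cell n u then ennreal (F q) else 0)"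
      by (auto simp: fun_eq_iff indicator_def)
    hence "(\<Sum>q. ennreal (F q) * indicator (?I q) u) = ennreal (F (cell n u))"
      using sums_single[of "cell n u" "\<lambda>q. ennreal (F q)"] by (simp add: sums_iff)
    thus ?thesis using True by simp
  next
    case False
    moreover have "0 \<le> real q / real n" for q by simp
    ultimately have "u \<notin> ?I q" for q using order_trans[of 0 "real q / real n" u] by auto
    thus ?thesis using False by simp
  qed
  have "(\<integral>\<^sup>+u. (\<Sum>q. ennreal (F q) * indicator (?I q) u) \<partial>lborel) = (\<Sum>q. \<integral>\<^sup>+u. ennreal (F q) * indicator (?I q) u \<partial>lborel)"
    by (rule nn_integral_suminf) auto
  also have "\<dots> = (\<Sum>q. ennreal (F q) * ennreal (1 / real n))"
  proof (intro suminf_cong)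
    fix q
    have "real q / real n \<le> real (Suc q) / real n" "real (Suc q) / real n - real q / real n = 1 / real n"
      using n by (auto simp: divide_simps)
    thus "(\<integral>\<^sup>+u. ennreal (F q) * indicator (?I q) u \<partial>lborel) = ennreal (F q) * ennreal (1 / real n)"
      by (simp add: nn_integral_cmult del: of_nat_Suc)
  qed
  also have "\<dots> = (\<Sum>q. ennreal (F q)) * ennreal (1 / real n)" by simp
  finally show ?thesis 
    unfolding * using n by (simp add: mult.assoc flip: ennreal_mult'')
qed

text \<open>Dominated convergence for the step functions above. The majorant also yields convergence of the
  series for each \<open>n\<close>, so nothing has to be known about the summands beforehand.\<close>
lemma tendsto_step_sum:
  fixes F :: "nat \<Rightarrow> nat \<Rightarrow> real" and f G :: "real \<Rightarrow> real"
  assumes F: "\<And>n q. 0 \<le> F n q" and [measurable]: "f \<in> borel_measurable borel"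
    and G: "set_integrable lborel {0..} G"
    and lim: "\<And>u. u > 0 \<Longrightarrow> (\<lambda>n. F n (cell n u)) \<longlonglongrightarrow> f u"
    and bound: "\<And>n u. n > 0 \<Longrightarrow> u > 0 \<Longrightarrow> F n (cell n u) \<le> G u"
  shows "n > 0 \<Longrightarrow> summable (F n)"
    and "(\<lambda>n. (\<Sum>q. F n q) / real n) \<longlonglongrightarrow> (LBINT u:{0..}. f u)"
proof -
  let ?s = "\<lambda>n u. indicator {0..} u * F n (cell n u)"
  have meas[measurable]: "?s n \<in> borel_measurable borel" for n by measurable
  have AE0: "AE u in lborel. (u::real) \<noteq> 0" by (rule AE_lborel_singleton)
  have lims: "AE u in lborel. (\<lambda>n. ?s (Suc n) u) \<longlonglongrightarrow> indicator {0..} u *\<^sub>R f u"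
    using AE0
  proof eventually_elim
    case (elim u)
    show ?case
    proof (cases "u > 0")
      case True thus ?thesis using LIMSEQ_Suc[OF lim[OF True]] by simp
    qed (use elim in auto)
  qed
  have bnd: "AE u in lborel. norm (?s (Suc n) u) \<le> indicator {0..} u *\<^sub>R G u" for n
    using AE0 
  proof eventually_elim
    case (elim u)
    show ?case
    proof (cases "u > 0")
      case True thus ?thesis using bound[OF _ True, of "Suc n"] F by simp
    qed (use elim in auto)
  qed
  have intS: "integrable lborel (?s (Suc n))" for n
    using G[unfolded set_integrable_def] by (rule Bochner_Integration.integrable_bound) (use bnd[of n] in \<open>auto\<close>)
  have eq: "summable (F n) \<and> (\<Sum>q. F n q) / real n = integral\<^sup>L lborel (?s n)" if n: "n > 0" for n
  proof -
    obtain m where m: "n = Suc m" using n gr0_implies_Suc by blast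
    have *: "(\<Sum>q. ennreal (F n q)) = ennreal (integral\<^sup>L lborel (?s n)) * ennreal (real n)"
      unfolding nn_integral_step[OF n F, symmetric]
      by (subst nn_integral_eq_integral) (use intS[of m] m F in auto)
    hence fin: "(\<Sum>q. ennreal (F n q)) \<noteq> top" by (simp add: ennreal_mult_eq_top_iff)
    hence sm: "summable (F n)" using F by (intro summable_suminf_not_top) auto
    have "ennreal (\<Sum>q. F n q) = ennreal (integral\<^sup>L lborel (?s n) * real n)"
      using * suminf_ennreal2[OF F sm] F by (simp add: ennreal_mult'')
    moreover have "0 \<le> integral\<^sup>L lborel (?s n)" using F by (intro integral_nonneg_AE) auto
    ultimately have "(\<Sum>q. F n q) = integral\<^sup>L lborel (?s n) * real n"
      using F sm by (subst (asm) ennreal_inj) (auto intro!: suminf_nonneg)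
    thus ?thesis using sm n by simp
  qed
  show "n > 0 \<Longrightarrow> summable (F n)" using eq by blast
  have "(\<lambda>n. integral\<^sup>L lborel (?s (Suc n))) \<longlonglongrightarrow> (LBINT u:{0..}. f u)"
    unfolding set_lebesgue_integral_def
    by (rule integral_dominated_convergence[OF _ _ G[unfolded set_integrable_def] lims bnd]) auto
  hence "(\<lambda>n. (\<Sum>q. F (Suc n) q) / real (Suc n)) \<longlonglongrightarrow> (LBINT u:{0..}. f u)"
    using eq by (simp del: of_nat_Suc)
  thus "(\<lambda>n. (\<Sum>q. F n q) / real n) \<longlonglongrightarrow> (LBINT u:{0..}. f u)" by (rule LIMSEQ_imp_Suc)
qed

section \<open>The growth of the variance\<close>

lemma cell_bounds:
  assumes "n > 0" "u > 0"
  defines "q \<equiv> cell n u"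
  shows "real q / real n \<le> u" "u \<le> (real q + 1) / real n" "(real q + 1) / real n \<le> u + 1"
proof -
  have "0 \<le> real n * u" using assms by simp
  hence 1: "real q \<le> real n * u" "real n * u \<le> real q + 1" unfolding q_def by linarith+
  thus "real q / real n \<le> u" "u \<le> (real q + 1) / real n" using assms by (auto simp: field_simps)
  have "real n \<ge> 1" using assms by simp
  hence "real q + 1 \<le> real n * u + real n" using 1 by linarith
  thus "(real q + 1) / real n \<le> u + 1" using assms by (simp add: field_simps)
qed

lemma cell_tendsto:
  assumes "u > 0"
  shows "(\<lambda>n. real (cell n u) / real n) \<longlonglongrightarrow> u"
    and "filterlim (\<lambda>n. cell n u) at_top sequentially"
proof -
  show "(\<lambda>n. real (cell n u) / real n) \<longlonglongrightarrow> u"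
  proof (rule tendsto_sandwich)
    show "(\<lambda>n. u - 1 / real n) \<longlonglongrightarrow> u" by real_asymp
    show "\<forall>\<^sub>F n in sequentially. u - 1 / real n \<le> real (cell n u) / real n"
      using eventually_gt_at_top[of 0]
    proof eventually_elim
      case (elim n)
      thus ?case using cell_bounds(2)[OF elim assms] by (simp add: add_divide_distrib)
    qed
    show "\<forall>\<^sub>F n in sequentially. real (cell n u) / real n \<le> u"
      using eventually_gt_at_top[of 0] by eventually_elim (use cell_bounds(1) assms in auto)
  qed auto
  show "filterlim (\<lambda>n. cell n u) at_top sequentially"
    by (intro filterlim_compose[OF filterlim_nat_sequentially] filterlim_compose[OF filterlim_floor_sequentially])
       (use assms in real_asymp)
qed

text \<open>The rescaled partial sums converge to \<open>u powr (H - 1/2)\<close> at every \<open>u > 0\<close>: this is the pointwise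
  convergence of the discrete kernel to the continuous one.\<close>
lemma cumweight_scaled:
  assumes H: "0 < H" "H < 1" and q: "filterlim q at_top sequentially"
    "(\<lambda>n. real (q n) / real n) \<longlonglongrightarrow> u" "u > 0"
  shows "(\<lambda>n. cumweight H (q n) / real n powr (H - 1/2)) \<longlonglongrightarrow> u powr (H - 1/2)"
proof -
  have "(\<lambda>n. real (q n) / real n + 1 / real n) \<longlonglongrightarrow> u + 0"
    by (intro tendsto_add q lim_1_over_n)
  hence "(\<lambda>n. ((real (q n) + 1) / real n) powr (H - 1/2)) \<longlonglongrightarrow> u powr (H - 1/2)"
    using q(3) by (intro tendsto_powr) (auto simp: add_divide_distrib)
  hence "(\<lambda>n. cumweight H (q n) / (real (q n) + 1) powr (H - 1/2) * ((real (q n) + 1) / real n) powr (H - 1/2)) \<longlonglongrightarrow> 1 * u powr (H - 1/2)"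
    by (intro tendsto_mult filterlim_compose[OF cumweight_asymp[OF H] q(1)])
  moreover have "cumweight H (q n) / (real (q n) + 1) powr (H - 1/2) * ((real (q n) + 1) / real n) powr (H - 1/2) = cumweight H (q n) / real n powr (H - 1/2)" for n
    by (subst powr_divide) auto
  ultimately show ?thesis by simp
qed

text \<open>A bound that holds for either sign of the exponent: for \<open>g \<le> 0\<close> the first summand dominates,
  for \<open>g > 0\<close> the second.\<close>
lemma powr_le_sum:
  fixes u y b g :: real
  assumes "0 < u" "u \<le> y" "y \<le> b" "1 \<le> b" "\<bar>g\<bar> \<le> 1"
  shows "y powr g \<le> u powr g + b"
proof (cases "g \<le> 0")
  case True
  hence "y powr g \<le> u powr g" using assms by (intro powr_mono2') auto
  thus ?thesis using assms by simp
next
  case False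
  hence "y powr g \<le> b powr g" using assms by (intro powr_mono2) auto
  also have "\<dots> \<le> b powr 1" using assms by (intro powr_mono) auto
  finally show ?thesis using assms powr_ge_zero[of u g] by (simp add: add_increasing)
qed

text \<open>The decay of the kernel in the remote past, used for the part \<open>u \<ge> 1\<close> of the integral, where the
  two partial sums nearly cancel.\<close>
lemma cumweight_diff_bound:
  assumes "H < 1"
  shows "\<bar>past_kernel H n q\<bar> \<le> \<bar>H - 1/2\<bar> * real n * (real q + 1) powr (H - 3/2)"
proof (induction n)
  case (Suc n)
  have "(real (n + q) + 1) powr (H - 3/2) \<le> (real q + 1) powr (H - 3/2)" using assms by (intro powr_mono2') auto
  hence "\<bar>(H - 1/2) * (real (n + q) + 1) powr (H - 3/2)\<bar> \<le> \<bar>H - 1/2\<bar> * (real q + 1) powr (H - 3/2)"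
    by (simp add: abs_mult mult_left_mono)
  moreover have "cumweight H (Suc n + q) - cumweight H q = past_kernel H n q + (H - 1/2) * (real (n + q) + 1) powr (H - 3/2)"
    by (simp add: cumweight_Suc)
  ultimately have "\<bar>cumweight H (Suc n + q) - cumweight H q\<bar> \<le> 
     \<bar>H - 1/2\<bar> * real n * (real q + 1) powr (H - 3/2) + \<bar>H - 1/2\<bar> * (real q + 1) powr (H - 3/2)" using Suc by linarith
  thus ?case by (simp add: algebra_simps)
qed simp

lemma set_integrable_powr_0_1:
  fixes a :: real assumes "a > -1" shows "set_integrable lborel {0..1} (\<lambda>u. u powr a)"
    "(LBINT u:{0..1}. u powr a) = 1 / (a + 1)"
proof -
  have *: "((\<lambda>u. u powr a) has_integral 1 / (a + 1)) {0..1}"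
    using has_integral_powr_from_0[of a 1] assms by simp
  hence "(\<lambda>u. u powr a) absolutely_integrable_on {0..1}"
    by (intro nonnegative_absolutely_integrable_1) (auto simp: integrable_on_def)
  thus 1: "set_integrable lborel {0..1} (\<lambda>u. u powr a)"
    unfolding set_integrable_def by (subst (asm) integrable_completion) auto
  show "(LBINT u:{0..1}. u powr a) = 1 / (a + 1)"
    using has_integral_unique[OF * set_borel_integral_eq_integral(1)[OF 1, THEN integrable_integral]]
      set_borel_integral_eq_integral(2)[OF 1] by simp
qed

lemma set_integrable_powr_1_inf:
  fixes a :: real assumes "a < -1" shows "set_integrable lborel {1..} (\<lambda>u. u powr a)"
proof -
  have "(\<lambda>u. u powr a) absolutely_integrable_on {1..}"
    using has_integral_powr_to_inf[of a 1] assms by (intro nonnegative_absolutely_integrable_1) (auto simp: integrable_on_def)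
  thus 1: "set_integrable lborel {1..} (\<lambda>u. u powr a)"
    unfolding set_integrable_def by (subst (asm) integrable_completion) auto
qed

text \<open>With \<open>g = H - 1/2\<close> the singularity at \<open>0\<close> has exponent \<open>2*H - 1 > -1\<close> and the decay at infinity has
  exponent \<open>2*H - 3 < -1\<close>.\<close>
lemma set_integrable_majorant:
  fixes g C D E :: real assumes "\<bar>g\<bar> < 1/2"
  shows "set_integrable lborel {0..} (\<lambda>u. if u < 1 then C * u powr (2*g) + D else E * u powr (2*g - 2))"
proof -
  have "integrable lborel (\<lambda>u. C * (indicator {0..1} u * u powr (2*g)) + D * indicator {0..1} u + E * (indicator {1..} u * u powr (2*g-2)))"
    using set_integrable_powr_0_1(1)[of "2*g"] set_integrable_powr_1_inf[of "2*g-2"] assms unfolding set_integrable_def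
    by (intro Bochner_Integration.integrable_add integrable_mult_right) (auto)
  thus ?thesis unfolding set_integrable_def
  proof (rule integrable_cong_AE_imp)
    have "AE u in lborel. (u::real) \<noteq> 1" by (rule AE_lborel_singleton)
    thus "AE u in lborel. C * (indicator {0..1} u * u powr (2*g)) + D * indicator {0..1} u + E * (indicator {1..} u * u powr (2*g-2)) =
      indicat_real {0..} u *\<^sub>R (if u < 1 then C * u powr (2*g) + D else E * u powr (2*g - 2))"
      by eventually_elim (auto simp: indicator_def)
  qed measurable
qed

text \<open>The squared norm of the Mandelbrot--Van Ness kernel at time \<open>1\<close>; the summand \<open>1 / (2*H)\<close> comes from
  the interval from \<open>0\<close> to \<open>1\<close>.\<close>
definition var_const :: "real \<Rightarrow> real" where
  "var_const H = (LBINT u:{0..}. ((1 + u) powr (H - 1/2) - u powr (H - 1/2))\<^sup>2) + 1 / (2 * H)"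

text \<open>Both limits are instances of dominated convergence with a common majorant: a constant plus a multiple of
  \<open>u powr (2*H - 1)\<close> for \<open>u < 1\<close>, where the kernel is estimated by its two terms
  separately, and a multiple of \<open>u powr (2*H - 3)\<close> for \<open>u \<ge> 1\<close>, where it is estimated by its decay.\<close>
lemma kernel_var_parts:
  assumes H: "0 < H" "H < 1"
  shows "n > 0 \<Longrightarrow> summable (\<lambda>q. (past_kernel H n q)\<^sup>2)"
    and "(\<lambda>n. (\<Sum>q. (past_kernel H n q)\<^sup>2) / real n powr (2 * H)) \<longlonglongrightarrow>
      (LBINT u:{0..}. ((1 + u) powr (H - 1/2) - u powr (H - 1/2))\<^sup>2)"
    and "(\<lambda>n. (\<Sum>q<n. (cumweight H q)\<^sup>2) / real n powr (2 * H)) \<longlonglongrightarrow> 1 / (2 * H)"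
proof -
  define g where "g = H - 1/2"
  have g: "\<bar>g\<bar> < 1/2" "H - 3/2 = g - 1" unfolding g_def using H by linarith+
  obtain C where C: "C > 0" "\<And>m. \<bar>cumweight H m\<bar> \<le> C * (real m + 1) powr g"
    using cumweight_bound[OF H] unfolding g_def by metis
  \<comment> \<open>The numbers come from \<open>(2 * v + 5)\<^sup>2 \<le> 8 * v\<^sup>2 + 50\<close> with \<open>v = u powr g\<close>.\<close>
  define G where "G u = (if u < 1 then (8 * C\<^sup>2) * u powr (2*g) + 50 * C\<^sup>2 else g\<^sup>2 * u powr (2*g - 2))" for u
  have G: "set_integrable lborel {0..} G" unfolding G_def by (rule set_integrable_majorant[OF g(1)])
  have sq: "(u powr a)\<^sup>2 = u powr (2*a)" for u a :: real by (simp add: power2_eq_square flip: powr_add)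
  have scaled: "\<bar>cumweight H m / real n powr g\<bar> \<le> C * ((real m + 1) / real n) powr g" for m n
    using C(2)[of m] by (subst powr_divide) (auto simp: abs_divide divide_right_mono)
  have small: "\<bar>cumweight H q / real n powr g\<bar> \<le> C * (u powr g + 2)" 
     "\<bar>cumweight H (n + q) / real n powr g\<bar> \<le> C * (u powr g + 3)"
    if nu: "n > 0" "0 < u" "u < 1" "q = cell n u" for n u q
  proof -
    have c: "u \<le> (real q + 1) / real n" "(real q + 1) / real n \<le> u + 1"
      using cell_bounds[OF nu(1,2)] nu(4) by auto
    have c': "(real (n + q) + 1) / real n = 1 + (real q + 1) / real n" using nu by (simp add: field_simps)
    have "((real q + 1) / real n) powr g \<le> u powr g + 2"
      using c g nu by (intro powr_le_sum) auto
    thus "\<bar>cumweight H q / real n powr g\<bar> \<le> C * (u powr g + 2)"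
      using scaled[of q n] C(1) by (meson mult_left_mono order_trans less_imp_le)
    have "((real (n + q) + 1) / real n) powr g \<le> u powr g + 3"
      unfolding c' using c g nu by (intro powr_le_sum) auto
    thus "\<bar>cumweight H (n + q) / real n powr g\<bar> \<le> C * (u powr g + 3)"
      using scaled[of "n + q" n] C(1) by (meson mult_left_mono order_trans less_imp_le)
  qed
  have G_small: "(C * (2 * u powr g + 5))\<^sup>2 \<le> G u" if "u < 1" for u
  proof -
    have "(2 * u powr g + 5)\<^sup>2 \<le> 8 * (u powr g)\<^sup>2 + 50"
      using sum_squares_bound[of "2 * u powr g" 5] by (simp add: power2_eq_square algebra_simps)
    hence "C\<^sup>2 * (2 * u powr g + 5)\<^sup>2 \<le> C\<^sup>2 * (8 * (u powr g)\<^sup>2 + 50)" by (rule mult_left_mono) simp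
    also have "\<dots> = G u" using that by (simp add: G_def sq algebra_simps)
    finally show ?thesis by (simp only: power_mult_distrib)
  qed
  let ?B = "\<lambda>n q. (past_kernel H n q / real n powr g)\<^sup>2"
  let ?A = "\<lambda>n q. if q < n then (cumweight H q / real n powr g)\<^sup>2 else 0"
  have scale: "s / (real n powr g)\<^sup>2 / real n = s / real n powr (2 * H)" if "n > 0" for s n
  proof -
    have "(real n powr g)\<^sup>2 * real n = real n powr (2 * g + 1)" using that by (simp add: sq powr_add)
    thus ?thesis by (simp add: g_def)
  qed
  have limB: "(\<lambda>n. ?B n (cell n u)) \<longlonglongrightarrow> ((1 + u) powr g - u powr g)\<^sup>2" if u: "u > 0" for u
  proof -
    have 1: "(\<lambda>n. cumweight H (cell n u) / real n powr g) \<longlonglongrightarrow> u powr g"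
      unfolding g_def by (rule cumweight_scaled[OF H cell_tendsto(2,1)[OF u] u])
    have "(\<lambda>n. cumweight H (n + cell n u) / real n powr g) \<longlonglongrightarrow> (1 + u) powr g"
      unfolding g_def
    proof (rule cumweight_scaled[OF H])
      show "filterlim (\<lambda>n. n + cell n u) at_top sequentially"
        by (rule filterlim_at_top_mono[OF filterlim_ident]) auto
      have "(\<lambda>n. 1 + real (cell n u) / real n) \<longlonglongrightarrow> 1 + u"
        by (intro tendsto_intros cell_tendsto u)
      moreover have "\<forall>\<^sub>F n in sequentially. 1 + real (cell n u) / real n = real (n + cell n u) / real n"
        using eventually_gt_at_top[of 0] by eventually_elim (simp add: field_simps)
      ultimately show "(\<lambda>n. real (n + cell n u) / real n) \<longlonglongrightarrow> 1 + u"
        by (rule Lim_transform_eventually)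
    qed (use u in auto)
    from tendsto_power[OF tendsto_diff[OF this 1], of 2] show ?thesis by (simp add: diff_divide_distrib)
  qed
  have bndB: "?B n (cell n u) \<le> G u" if nu: "n > 0" "u > 0" for n u
  proof (cases "u < 1")
    case True
    define q where "q = cell n u"
    have "\<bar>past_kernel H n q / real n powr g\<bar> \<le> C * (2 * u powr g + 5)"
      unfolding diff_divide_distrib using small[OF nu True q_def] by (simp add: algebra_simps abs_if split: if_splits)
    hence "?B n q \<le> (C * (2 * u powr g + 5))\<^sup>2" using C(1) by (intro abs_le_square_iff[THEN iffD1]) simp
    thus ?thesis using G_small[OF True] q_def by simp
  next
    case False
    define q where "q = cell n u"
    have n: "real n > 0" using nu by simp
    have "\<bar>past_kernel H n q / real n powr g\<bar> \<le> \<bar>g\<bar> * real n * (real q + 1) powr (g - 1) / real n powr g"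
      using cumweight_diff_bound[OF H(2), of n q] unfolding abs_divide g(2) g_def[symmetric] by (simp add: divide_right_mono)
    also have "\<dots> = \<bar>g\<bar> * ((real q + 1) / real n) powr (g - 1)"
      using n by (simp add: powr_divide powr_diff mult_ac)
    also have "\<dots> \<le> \<bar>g\<bar> * u powr (g - 1)"
      using cell_bounds(2)[OF nu] g nu unfolding q_def by (intro mult_left_mono powr_mono2') auto
    finally have "?B n q \<le> (\<bar>g\<bar> * u powr (g - 1))\<^sup>2" by (intro abs_le_square_iff[THEN iffD1]) simp
    also have "\<dots> = G u" unfolding G_def using False by (simp add: power_mult_distrib sq algebra_simps)
    finally show ?thesis unfolding q_def .
  qed
  have sB: "summable (?B n)" if "n > 0" for n by (rule tendsto_step_sum(1)[OF _ _ G limB bndB]) (auto simp: that)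
  have summ: "summable (\<lambda>q. (past_kernel H n q)\<^sup>2)" if n: "n > 0" for n
    using summable_mult[OF sB[OF n], of "(real n powr g)\<^sup>2"] n by (simp add: power_divide)
  thus "n > 0 \<Longrightarrow> summable (\<lambda>q. (past_kernel H n q)\<^sup>2)" .
  have "(\<lambda>n. (\<Sum>q. ?B n q) / real n) \<longlonglongrightarrow> (LBINT u:{0..}. ((1 + u) powr g - u powr g)\<^sup>2)"
    by (rule tendsto_step_sum(2)[OF _ _ G limB bndB]) auto
  moreover have "(\<Sum>q. ?B n q) / real n = (\<Sum>q. (past_kernel H n q)\<^sup>2) / real n powr (2 * H)" if "n > 0" for n
  proof -
    have "(\<Sum>q. ?B n q) = (\<Sum>q. (past_kernel H n q)\<^sup>2) / (real n powr g)\<^sup>2"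
      unfolding power_divide by (rule suminf_divide[OF summ[OF that]])
    thus ?thesis using scale[OF that] by simp
  qed
  ultimately show "(\<lambda>n. (\<Sum>q. (past_kernel H n q)\<^sup>2) / real n powr (2 * H)) \<longlonglongrightarrow>
      (LBINT u:{0..}. ((1 + u) powr (H - 1/2) - u powr (H - 1/2))\<^sup>2)"
    unfolding g_def[symmetric] by (rule Lim_transform_eventually[OF _ eventually_mono[OF eventually_gt_at_top[of 0]]])
  have limA: "(\<lambda>n. ?A n (cell n u)) \<longlonglongrightarrow> indicator {..<1} u * u powr (2 * g)" if u: "u > 0" for u
  proof (cases "u < 1")
    case True
    have "(\<lambda>n. cumweight H (cell n u) / real n powr g) \<longlonglongrightarrow> u powr g"
      unfolding g_def by (rule cumweight_scaled[OF H cell_tendsto(2,1)[OF u] u])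
    hence *: "(\<lambda>n. (cumweight H (cell n u) / real n powr g)\<^sup>2) \<longlonglongrightarrow> indicator {..<1} u * u powr (2 * g)"
      using True by (auto intro: tendsto_eq_intros simp: sq)
    have ev: "\<forall>\<^sub>F n in sequentially. (cumweight H (cell n u) / real n powr g)\<^sup>2 = ?A n (cell n u)"
      using eventually_gt_at_top[of 0]
    proof eventually_elim
      case (elim n)
      have "real (cell n u) \<le> real n * u" using cell_bounds(1)[OF elim u] elim by (simp add: field_simps)
      also have "\<dots> < real n" using True elim by simp
      finally show ?case by simp
    qed
    show ?thesis by (rule Lim_transform_eventually[OF * ev])
  next
    case False
    have "\<not> cell n u < n" for n
    proof -
      have "real n \<le> real n * u" using False by (simp add: mult_le_cancel_left1)
      thus ?thesis by linarith
    qed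
    thus ?thesis using False by simp
  qed
  have bndA: "?A n (cell n u) \<le> G u" if nu: "n > 0" "u > 0" for n u
  proof (cases "u < 1")
    case True
    define q where "q = cell n u"
    have "C * (u powr g + 2) \<le> C * (2 * u powr g + 5)" using C(1) by (simp add: add_mono)
    hence "\<bar>cumweight H q / real n powr g\<bar> \<le> C * (2 * u powr g + 5)"
      using small(1)[OF nu True q_def] by simp
    hence "(cumweight H q / real n powr g)\<^sup>2 \<le> (C * (2 * u powr g + 5))\<^sup>2" using C(1) by (intro abs_le_square_iff[THEN iffD1]) simp
    thus ?thesis using order_trans[OF zero_le_power2 G_small[OF True]] order_trans[OF _ G_small[OF True]] q_def by auto
  next
    case False
    have "real n \<le> real n * u" using False by (simp add: mult_le_cancel_left1)
    hence "\<not> cell n u < n" by linarith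
    thus ?thesis using False by (simp add: G_def)
  qed
  have "(\<lambda>n. (\<Sum>q. ?A n q) / real n) \<longlonglongrightarrow> (LBINT u:{0..}. indicator {..<1} u * u powr (2 * g))"
    by (rule tendsto_step_sum(2)[OF _ _ G limA bndA]) auto
  also have "(LBINT u:{0..}. indicator {..<1} u * u powr (2 * g)) = (LBINT u:{0..1}. u powr (2 * g))"
    unfolding set_lebesgue_integral_def
  proof (rule integral_cong_AE)
    have "AE u in lborel. (u::real) \<noteq> 1" by (rule AE_lborel_singleton)
    thus "AE u in lborel. indicat_real {0..} u *\<^sub>R (indicat_real {..<1} u * u powr (2 * g)) = indicator {0..1} u *\<^sub>R u powr (2 * g)"
      by eventually_elim (auto simp: indicator_def)
  qed measurable
  also have "\<dots> = 1 / (2 * H)" using H by (subst set_integrable_powr_0_1(2)) (auto simp: g_def)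
  finally have "(\<lambda>n. (\<Sum>q. ?A n q) / real n) \<longlonglongrightarrow> 1 / (2 * H)" .
  moreover have "(\<Sum>q. ?A n q) / real n = (\<Sum>q<n. (cumweight H q)\<^sup>2) / real n powr (2 * H)" if "n > 0" for n
  proof -
    have "(\<Sum>q. ?A n q) = (\<Sum>q<n. ?A n q)" by (rule suminf_finite) auto
    also have "\<dots> = (\<Sum>q<n. (cumweight H q)\<^sup>2) / (real n powr g)\<^sup>2"
      by (simp add: power_divide sum_divide_distrib)
    finally show ?thesis using scale[OF that] by simp
  qed
  ultimately show "(\<lambda>n. (\<Sum>q<n. (cumweight H q)\<^sup>2) / real n powr (2 * H)) \<longlonglongrightarrow> 1 / (2 * H)"
    by (rule Lim_transform_eventually[OF _ eventually_mono[OF eventually_gt_at_top[of 0]]])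
qed

text \<open>The integers split into the times in \<open>{0..<n}\<close>, the later ones, where the kernel vanishes, and the
  negative ones.\<close>
lemma kernel_has_sum:
  assumes H: "0 < H" "H < 1" and n: "n > 0"
  shows "((\<lambda>i. (kernel H n i)\<^sup>2) has_sum ((\<Sum>q<n. (cumweight H q)\<^sup>2) + (\<Sum>q. (past_kernel H n q)\<^sup>2))) UNIV"
proof -
  have "((\<lambda>i. (kernel H n i)\<^sup>2) has_sum (\<Sum>i\<in>int ` {..<n}. (kernel H n i)\<^sup>2)) (int ` {..<n})" by (rule has_sum_finite) auto
  also have "(\<Sum>i\<in>int ` {..<n}. (kernel H n i)\<^sup>2) = (\<Sum>i<n. (cumweight H (n - Suc i))\<^sup>2)"
    using kernel_present[of _ "n - 1" H] n by (subst sum.reindex) auto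
  also have "\<dots> = (\<Sum>q<n. (cumweight H q)\<^sup>2)" by (rule sum.nat_diff_reindex)
  finally have 1: "((\<lambda>i. (kernel H n i)\<^sup>2) has_sum (\<Sum>q<n. (cumweight H q)\<^sup>2)) (int ` {..<n})" .
  have 2: "((\<lambda>i. (kernel H n i)\<^sup>2) has_sum 0) {int n..}"
    by (rule has_sum_0) (auto simp: kernel_future)
  have "((\<lambda>q. (kernel H n (- int (Suc q)))\<^sup>2) has_sum (\<Sum>q. (past_kernel H n q)\<^sup>2)) UNIV"
    unfolding kernel_past using kernel_var_parts(1)[OF H n] by (intro sums_nonneg_imp_has_sum summable_sums) auto
  hence 3: "((\<lambda>i. (kernel H n i)\<^sup>2) has_sum (\<Sum>q. (past_kernel H n q)\<^sup>2)) (range (\<lambda>q. - int (Suc q)))"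
    by (subst has_sum_reindex) (auto simp: inj_on_def o_def)
  have "UNIV = int ` {..<n} \<union> {int n..} \<union> range (\<lambda>q. - int (Suc q))"
  proof (intro equalityI subsetI)
    fix i :: int
    show "i \<in> int ` {..<n} \<union> {int n..} \<union> range (\<lambda>q. - int (Suc q))"
    proof (cases "i < 0")
      case True
      hence "i = - int (Suc (nat (- i - 1)))" by simp
      thus ?thesis by blast
    next
      case False
      hence "i = int (nat i)" by simp
      thus ?thesis using False by (cases "i < int n") (auto intro!: image_eqI[of i int "nat i"])
    qed
  qed auto
  moreover have "((\<lambda>i. (kernel H n i)\<^sup>2) has_sum ((\<Sum>q<n. (cumweight H q)\<^sup>2) + 0 + (\<Sum>q. (past_kernel H n q)\<^sup>2)))
     (int ` {..<n} \<union> {int n..} \<union> range (\<lambda>q. - int (Suc q)))"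
    by (intro has_sum_Un_disjoint 1 2 3) auto
  ultimately show ?thesis by simp
qed

lemma kernel_sq_summable:
  assumes H: "0 < H" "H < 1" shows "(\<lambda>i. (kernel H n i)\<^sup>2) summable_on UNIV"
  using kernel_has_sum[OF H, of n] by (cases "n = 0") (auto simp: kernel_def has_sum_imp_summable)

lemma kernel_var_0: "kernel_var H 0 = 0" by (simp add: kernel_var_def kernel_def)

theorem kernel_var_asymp:
  assumes H: "0 < H" "H < 1"
  shows "(\<lambda>n. kernel_var H n / real n powr (2 * H)) \<longlonglongrightarrow> var_const H"
proof -
  have "(\<lambda>n. (\<Sum>q. (past_kernel H n q)\<^sup>2) / real n powr (2 * H) + (\<Sum>q<n. (cumweight H q)\<^sup>2) / real n powr (2 * H)) \<longlonglongrightarrow> var_const H"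
    unfolding var_const_def by (intro tendsto_add kernel_var_parts H)
  moreover have "\<forall>\<^sub>F n in sequentially. (\<Sum>q. (past_kernel H n q)\<^sup>2) / real n powr (2 * H) + (\<Sum>q<n. (cumweight H q)\<^sup>2) / real n powr (2 * H) = kernel_var H n / real n powr (2 * H)"
    using eventually_gt_at_top[of 0]
    by eventually_elim (simp add: kernel_var_def infsumI[OF kernel_has_sum[OF H]] add_divide_distrib)
  ultimately show ?thesis by (rule Lim_transform_eventually)
qed

lemma kernel_var_bound:
  assumes H: "0 < H" "H < 1"
  obtains C where "C > 0" "\<And>n. kernel_var H n \<le> C * real n powr (2 * H)"
proof -
  have "Bseq (\<lambda>n. kernel_var H n / real n powr (2 * H))"
    using kernel_var_asymp[OF assms] by (intro convergent_imp_Bseq) (auto simp: convergent_def)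
  then obtain C where C: "C > 0" "\<And>n. \<bar>kernel_var H n / real n powr (2 * H)\<bar> \<le> C"
    unfolding Bseq_def by auto
  show ?thesis 
  proof (rule that[OF C(1)])
    fix n show "kernel_var H n \<le> C * real n powr (2 * H)"
      using C(2)[of n] by (cases "n = 0") (auto simp: kernel_var_0 field_simps abs_le_iff)
  qed
qed

lemma var_const_pos: "0 < H \<Longrightarrow> var_const H > 0"
  unfolding var_const_def set_lebesgue_integral_def by (intro add_nonneg_pos integral_nonneg_AE) auto

text \<open>So \<open>cH H\<close> normalizes the limiting variance at time \<open>1\<close> to one.\<close>
lemma cH_sq: "0 < H \<Longrightarrow> (cH H)\<^sup>2 * var_const H = 1"
  using var_const_pos[of H] unfolding cH_def var_const_def[symmetric]
  by (simp add: power2_eq_square powr_minus_divide flip: powr_add)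

section \<open>Series of independent signs\<close>

text \<open>A symmetric sign takes values in an interval of length \<open>2\<close>, so this is Hoeffding's lemma for it.\<close>
lemma cosh_le_exp_half_sq: "cosh (x::real) \<le> exp (x\<^sup>2 / 2)"
proof -
  have *: "cosh y \<le> exp (y\<^sup>2 / 2)" if "y \<ge> 0" for y :: real
  proof -
    have "- (2 * y) * (1/2) + ln (1 + (1/2) * (exp (2 * y) - 1)) \<le> (2 * y)\<^sup>2 / 8"
      using Hoeffdings_lemma_aux[of "2 * y" "1/2"] that by simp
    moreover have "cosh y = exp (- y) * (1 + (1/2) * (exp (2 * y) - 1))"
      by (simp add: cosh_def field_simps flip: exp_add)
    moreover have "ln (exp (- y) * (1 + (1/2) * (exp (2 * y) - 1))) = - y + ln (1 + (1/2) * (exp (2 * y) - 1))"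
      by (subst ln_mult_pos) (auto simp: add_pos_pos field_simps)
    ultimately have "ln (cosh y) \<le> y\<^sup>2 / 2" by (simp add: power2_eq_square)
    thus ?thesis using cosh_real_pos[of y] by (metis exp_le_cancel_iff exp_ln)
  qed
  show ?thesis using *[of "\<bar>x\<bar>"] by (simp add: cosh_real_abs)
qed

lemma power_le_fact_cosh:
  fixes x :: real
  shows "x ^ (2 * p) \<le> 2 * fact (2 * p) * cosh x"
proof -
  have "\<bar>x\<bar> ^ (2 * p) /\<^sub>R fact (2 * p) \<le> (\<Sum>n. \<bar>x\<bar> ^ n /\<^sub>R fact n)"
    using sum_le_suminf[OF summable_exp_generic[of "\<bar>x\<bar>"], of "{2 * p}"] by simp
  hence "\<bar>x\<bar> ^ (2 * p) / fact (2 * p) \<le> exp \<bar>x\<bar>"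
    by (simp add: exp_def divide_inverse mult.commute)
  also have "\<dots> \<le> 2 * cosh x" by (simp add: cosh_def abs_if)
  finally show ?thesis by (simp add: power_even_abs field_simps)
qed

definition moment_const :: "nat \<Rightarrow> real" where
  "moment_const p = 2 * fact (2 * p) * exp (1/2)"

lemma moment_const_pos: "moment_const p > 0" by (simp add: moment_const_def)

text \<open>Both functions equal \<open>1 - b\<^sup>2 / 2\<close> up to an error of fourth order.\<close>
lemma cos_exp_diff_bound:
  fixes b :: real
  shows "\<bar>cos b - exp (- (b\<^sup>2) / 2)\<bar> \<le> b ^ 4"
proof -
  have "cmod (iexp b - (\<Sum>k\<le>3. (\<i> * b)^k / fact k)) \<le> \<bar>b\<bar> ^ 4 / fact 4"
    using iexp_approx1[of b 3] by (simp add: eval_nat_numeral)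
  moreover have "\<bar>Re (iexp b - (\<Sum>k\<le>3. (\<i> * b)^k / fact k))\<bar> \<le> cmod (iexp b - (\<Sum>k\<le>3. (\<i> * b)^k / fact k))"
    by (rule abs_Re_le_cmod)
  moreover have "Re (iexp b - (\<Sum>k\<le>3. (\<i> * b)^k / fact k)) = cos b - (1 - b\<^sup>2 / 2)"
    by (simp add: eval_nat_numeral Re_exp field_simps)
  ultimately have 1: "\<bar>cos b - (1 - b\<^sup>2 / 2)\<bar> \<le> b ^ 4 / 24" by (simp add: fact_numeral)
  have 2: "\<bar>exp (- y) - (1 - y)\<bar> \<le> y\<^sup>2 / 2" if "y \<ge> 0" for y :: real
  proof -
    have "((\<lambda>y. 1 - y + y\<^sup>2 / 2 - exp (- y)) has_real_derivative (-1 + y + exp (- y))) (at y)" for y :: real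
      by (auto intro!: derivative_eq_intros)
    moreover have "-1 + z + exp (- z) \<ge> 0" for z :: real using exp_ge_add_one_self[of "- z"] by simp
    ultimately have "1 - 0 + 0\<^sup>2 / 2 - exp (- 0) \<le> 1 - y + y\<^sup>2 / 2 - exp (- y)"
      using that by (intro DERIV_nonneg_imp_nondecreasing[where f = "\<lambda>y. 1 - y + y\<^sup>2 / 2 - exp (- y)"]) auto
    thus ?thesis using exp_ge_add_one_self[of "- y"] by simp
  qed
  have "\<bar>exp (- (b\<^sup>2 / 2)) - (1 - b\<^sup>2 / 2)\<bar> \<le> b ^ 4 / 8"
    using 2[of "b\<^sup>2 / 2"] by (simp add: power_divide flip: power_mult)
  moreover have "0 \<le> b ^ 4" by simp
  ultimately show ?thesis using 1 unfolding minus_divide_left[symmetric] by linarith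
qed

lemma finite_sum_le_has_sum:
  fixes f :: "'b \<Rightarrow> real"
  assumes "(f has_sum s) UNIV" "\<And>i. f i \<ge> 0" "finite I" shows "sum f I \<le> s"
  using assms has_sum_mono2[OF has_sum_finite[OF assms(3)] assms(1)] by auto

locale rademacher = prob_space M for M :: "'a measure" +
  fixes \<omega> :: "int \<Rightarrow> 'a \<Rightarrow> real"
  assumes indep_signs: "indep_vars (\<lambda>_. borel) \<omega> UNIV"
    and prob_plus: "prob {x \<in> space M. \<omega> k x = 1} = 1/2"
    and prob_minus: "prob {x \<in> space M. \<omega> k x = -1} = 1/2"
begin

lemma sign_measurable [measurable]: "\<omega> k \<in> borel_measurable M"
  using indep_signs unfolding indep_vars_def by auto

lemma AE_sign: "AE x in M. \<omega> k x = 1 \<or> \<omega> k x = -1"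
proof -
  have "prob ({x \<in> space M. \<omega> k x = 1} \<union> {x \<in> space M. \<omega> k x = -1}) = 1"
    by (subst finite_measure_Union) (auto simp: prob_plus prob_minus)
  from AE_prob_1[OF this] show ?thesis by eventually_elim auto
qed

lemma AE_signs: "AE x in M. \<forall>k. \<omega> k x = 1 \<or> \<omega> k x = -1"
  unfolding AE_all_countable using AE_sign by blast

lemma integrable_sign:
  fixes f :: "real \<Rightarrow> 'b::{banach, second_countable_topology}"
  assumes [measurable]: "f \<in> borel_measurable borel"
  shows "integrable M (\<lambda>x. f (\<omega> k x))"
  by (rule integrable_const_bound[of _ "max (norm (f 1)) (norm (f (-1)))"])
     (use AE_sign[of k] in \<open>auto elim!: eventually_mono\<close>)

lemma expectation_sign:
  fixes f :: "real \<Rightarrow> 'b::{banach, second_countable_topology}"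
  assumes [measurable]: "f \<in> borel_measurable borel"
  shows "integral\<^sup>L M (\<lambda>x. f (\<omega> k x)) = (1/2) *\<^sub>R (f 1 + f (-1))"
proof -
  have "integral\<^sup>L M (\<lambda>x. f (\<omega> k x)) = 
    integral\<^sup>L M (\<lambda>x. indicator {x \<in> space M. \<omega> k x = 1} x *\<^sub>R f 1 + indicator {x \<in> space M. \<omega> k x = -1} x *\<^sub>R f (-1))"
    by (rule integral_cong_AE) (use AE_sign[of k] in \<open>auto elim!: eventually_mono simp: indicator_def\<close>)
  also have "\<dots> = (1/2) *\<^sub>R (f 1 + f (-1))"
    by (subst Bochner_Integration.integral_add) (auto intro!: integrable_scaleR_left integrable_real_indicator simp: prob_plus prob_minus scaleR_add_right less_top[symmetric])
  finally show ?thesis .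
qed

lemma expectation_prod_signs:
  fixes f :: "int \<Rightarrow> real \<Rightarrow> 'b::{real_normed_field, banach, second_countable_topology}"
  assumes "finite I" "\<And>i. f i \<in> borel_measurable borel"
  shows "integral\<^sup>L M (\<lambda>x. \<Prod>i\<in>I. f i (\<omega> i x)) = (\<Prod>i\<in>I. (1/2) *\<^sub>R (f i 1 + f i (-1)))"
proof -
  have "indep_vars (\<lambda>_. borel) (\<lambda>i x. f i (\<omega> i x)) I"
    by (rule indep_vars_compose2[OF indep_vars_subset[OF indep_signs]]) (use assms in auto)
  hence "integral\<^sup>L M (\<lambda>x. \<Prod>i\<in>I. f i (\<omega> i x)) = (\<Prod>i\<in>I. integral\<^sup>L M (\<lambda>x. f i (\<omega> i x)))"
    by (intro indep_vars_lebesgue_integral assms integrable_sign)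
  also have "\<dots> = (\<Prod>i\<in>I. (1/2) *\<^sub>R (f i 1 + f i (-1)))"
    by (intro prod.cong refl expectation_sign assms)
  finally show ?thesis .
qed

lemma sign_sum_bounded:
  assumes "finite I"
  shows "AE x in M. \<bar>\<Sum>i\<in>I. \<beta> i * \<omega> i x\<bar> \<le> (\<Sum>i\<in>I. \<bar>\<beta> i\<bar>)"
  using AE_signs
proof eventually_elim
  case (elim x)
  have "\<bar>\<omega> i x\<bar> = 1" for i using elim[rule_format, of i] by auto
  hence "(\<Sum>i\<in>I. \<bar>\<beta> i * \<omega> i x\<bar>) = (\<Sum>i\<in>I. \<bar>\<beta> i\<bar>)" by (simp add: abs_mult)
  thus ?case using sum_abs[of "\<lambda>i. \<beta> i * \<omega> i x" I] by simp
qed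

lemma sign_sum_mgf:
  assumes "finite I"
  shows "integrable M (\<lambda>x. exp (l * (\<Sum>i\<in>I. \<beta> i * \<omega> i x)))"
    and "expectation (\<lambda>x. exp (l * (\<Sum>i\<in>I. \<beta> i * \<omega> i x))) = (\<Prod>i\<in>I. cosh (l * \<beta> i))"
proof -
  show "integrable M (\<lambda>x. exp (l * (\<Sum>i\<in>I. \<beta> i * \<omega> i x)))"
  proof (rule integrable_const_bound)
    show "AE x in M. norm (exp (l * (\<Sum>i\<in>I. \<beta> i * \<omega> i x))) \<le> exp (\<bar>l\<bar> * (\<Sum>i\<in>I. \<bar>\<beta> i\<bar>))"
      using sign_sum_bounded[OF assms, of \<beta>]
    proof eventually_elim
      case (elim x)
      have "l * (\<Sum>i\<in>I. \<beta> i * \<omega> i x) \<le> \<bar>l\<bar> * \<bar>\<Sum>i\<in>I. \<beta> i * \<omega> i x\<bar>" by (metis abs_ge_self abs_mult)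
      also have "\<dots> \<le> \<bar>l\<bar> * (\<Sum>i\<in>I. \<bar>\<beta> i\<bar>)" using elim by (intro mult_left_mono) auto
      finally show ?case by simp
    qed
  qed measurable
  have "expectation (\<lambda>x. exp (l * (\<Sum>i\<in>I. \<beta> i * \<omega> i x))) = expectation (\<lambda>x. \<Prod>i\<in>I. exp (l * \<beta> i * \<omega> i x))"
    by (simp add: exp_sum[OF assms] sum_distrib_left mult.assoc)
  also have "\<dots> = (\<Prod>i\<in>I. (1/2) *\<^sub>R (exp (l * \<beta> i * 1) + exp (l * \<beta> i * - 1)))"
    by (rule expectation_prod_signs[OF assms, of "\<lambda>i y. exp (l * \<beta> i * y)"]) measurable
  also have "\<dots> = (\<Prod>i\<in>I. cosh (l * \<beta> i))" by (simp add: cosh_def)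
  finally show "expectation (\<lambda>x. exp (l * (\<Sum>i\<in>I. \<beta> i * \<omega> i x))) = (\<Prod>i\<in>I. cosh (l * \<beta> i))" .
qed

text \<open>The variable divided by \<open>sqrt s\<close> has exponential moments bounded independently of the coefficients,
  and these bound its moments of every order.\<close>
lemma sign_sum_moment:
  assumes I: "finite I" and s: "(\<Sum>i\<in>I. (\<beta> i)\<^sup>2) \<le> s" and p: "p > 0"
  shows "integrable M (\<lambda>x. (\<Sum>i\<in>I. \<beta> i * \<omega> i x) ^ (2 * p))"
    and "expectation (\<lambda>x. (\<Sum>i\<in>I. \<beta> i * \<omega> i x) ^ (2 * p)) \<le> moment_const p * s ^ p"
proof -
  let ?S = "\<lambda>x. \<Sum>i\<in>I. \<beta> i * \<omega> i x"
  show int: "integrable M (\<lambda>x. (?S x) ^ (2 * p))"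
  proof (rule integrable_const_bound)
    show "AE x in M. norm ((?S x) ^ (2 * p)) \<le> (\<Sum>i\<in>I. \<bar>\<beta> i\<bar>) ^ (2 * p)"
      using sign_sum_bounded[OF I, of \<beta>] 
    proof eventually_elim
      case (elim x)
      have "\<bar>?S x\<bar> ^ (2 * p) \<le> (\<Sum>i\<in>I. \<bar>\<beta> i\<bar>) ^ (2 * p)" by (rule power_mono[OF elim]) simp
      thus ?case unfolding real_norm_def power_abs .
    qed
  qed measurable
  show "expectation (\<lambda>x. (?S x) ^ (2 * p)) \<le> moment_const p * s ^ p"
  proof (cases "s > 0")
    case True
    \<comment> \<open>The exponent \<open>l\<close> is chosen to normalize the variance bound.\<close>
    define l where "l = 1 / sqrt s"
    have l: "l ^ 2 = 1 / s" "l > 0" using True by (auto simp: l_def power_divide)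
    have "expectation (\<lambda>x. cosh (l * ?S x)) = (expectation (\<lambda>x. exp (l * ?S x)) + expectation (\<lambda>x. exp (- l * ?S x))) / 2"
      unfolding cosh_def using sign_sum_mgf(1)[OF I, of l \<beta>] sign_sum_mgf(1)[OF I, of "-l" \<beta>]
      by simp
    also have "\<dots> = (\<Prod>i\<in>I. cosh (l * \<beta> i))"
      unfolding sign_sum_mgf(2)[OF I] by simp
    also have "\<dots> \<le> (\<Prod>i\<in>I. exp ((l * \<beta> i)\<^sup>2 / 2))"
      by (intro prod_mono conjI cosh_le_exp_half_sq cosh_real_nonneg)
    also have "\<dots> = exp (l\<^sup>2 * (\<Sum>i\<in>I. (\<beta> i)\<^sup>2) / 2)"
      by (simp add: exp_sum[OF I, symmetric] power_mult_distrib sum_distrib_left sum_divide_distrib)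
    also have "\<dots> \<le> exp (1/2)" using s True unfolding l(1) by simp
    finally have mgf: "expectation (\<lambda>x. cosh (l * ?S x)) \<le> exp (1/2)" .
    have "expectation (\<lambda>x. (l * ?S x) ^ (2 * p)) \<le> expectation (\<lambda>x. 2 * fact (2 * p) * cosh (l * ?S x))"
    proof (rule integral_mono)
      show "integrable M (\<lambda>x. (l * ?S x) ^ (2 * p))" using int by (simp add: power_mult_distrib)
      show "integrable M (\<lambda>x. 2 * fact (2 * p) * cosh (l * ?S x))"
        unfolding cosh_def using sign_sum_mgf(1)[OF I, of l \<beta>] sign_sum_mgf(1)[OF I, of "-l" \<beta>]
        by simp
    qed (rule power_le_fact_cosh)
    also have "\<dots> \<le> moment_const p" using mgf by (simp add: moment_const_def)
    finally have F: "l ^ (2 * p) * expectation (\<lambda>x. (?S x) ^ (2 * p)) \<le> moment_const p"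
      by (simp add: power_mult_distrib)
    have lp: "l ^ (2 * p) = 1 / s ^ p" using l(1) by (simp add: power_mult power_one_over)
    show ?thesis using F[unfolded lp] True by (simp add: pos_divide_le_eq)
  next
    case False
    have "0 \<le> (\<Sum>i\<in>I. (\<beta> i)\<^sup>2)" by (intro sum_nonneg) auto
    hence "s = 0" "(\<Sum>i\<in>I. (\<beta> i)\<^sup>2) = 0" using s False by auto
    hence "\<forall>i\<in>I. \<beta> i = 0" using I by (simp add: sum_nonneg_eq_0_iff)
    hence "?S x = 0" for x by simp
    thus ?thesis using p \<open>s = 0\<close> by (simp add: power_0_left)
  qed
qed

text \<open>The series over all integers is summed symmetrically and need only converge almost surely.\<close>
definition series_limit :: "(int \<Rightarrow> real) \<Rightarrow> ('a \<Rightarrow> real) \<Rightarrow> bool" where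
  "series_limit \<beta> W \<longleftrightarrow> W \<in> borel_measurable M \<and>
     (AE x in M. (\<lambda>I. \<Sum>i\<in>{- int I..int I}. \<beta> i * \<omega> i x) \<longlonglongrightarrow> W x)"

lemma series_limit_moment:
  assumes W: "series_limit \<beta> W" and s: "((\<lambda>i. (\<beta> i)\<^sup>2) has_sum s) UNIV" and p: "p > 0"
  shows "(\<integral>\<^sup>+x. ennreal (W x ^ (2 * p)) \<partial>M) \<le> ennreal (moment_const p * s ^ p)"
proof -
  let ?S = "\<lambda>I x. \<Sum>i\<in>{- int I..int I}. \<beta> i * \<omega> i x"
  have "(\<integral>\<^sup>+x. ennreal (W x ^ (2 * p)) \<partial>M) = (\<integral>\<^sup>+x. liminf (\<lambda>I. ennreal (?S I x ^ (2 * p))) \<partial>M)"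
  proof (rule nn_integral_cong_AE)
    show "AE x in M. ennreal (W x ^ (2 * p)) = liminf (\<lambda>I. ennreal (?S I x ^ (2 * p)))"
      using W[unfolded series_limit_def, THEN conjunct2]
    proof eventually_elim
      case (elim x)
      hence "(\<lambda>I. ennreal (?S I x ^ (2 * p))) \<longlonglongrightarrow> ennreal (W x ^ (2 * p))"
        by (intro tendsto_ennrealI tendsto_power)
      from lim_imp_Liminf[OF _ this] show ?case by simp
    qed
  qed
  also have "\<dots> \<le> liminf (\<lambda>I. \<integral>\<^sup>+x. ennreal (?S I x ^ (2 * p)) \<partial>M)"
    by (rule nn_integral_liminf) measurable
  also have "\<dots> \<le> liminf (\<lambda>I::nat. ennreal (moment_const p * s ^ p))"
  proof (intro Liminf_mono always_eventually allI)
    fix I :: nat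
    have le: "(\<Sum>i\<in>{- int I..int I}. (\<beta> i)\<^sup>2) \<le> s" by (rule finite_sum_le_has_sum[OF s]) auto
    have "(\<integral>\<^sup>+x. ennreal (?S I x ^ (2 * p)) \<partial>M) = ennreal (expectation (\<lambda>x. ?S I x ^ (2 * p)))"
      by (rule nn_integral_eq_integral[OF sign_sum_moment(1)[OF _ le p]]) auto
    also have "\<dots> \<le> ennreal (moment_const p * s ^ p)"
      by (intro ennreal_leI sign_sum_moment(2)[OF _ le p]) auto
    finally show "(\<integral>\<^sup>+x. ennreal (?S I x ^ (2 * p)) \<partial>M) \<le> ennreal (moment_const p * s ^ p)" .
  qed
  also have "\<dots> = ennreal (moment_const p * s ^ p)" by (simp add: Liminf_const)
  finally show ?thesis .
qed

lemma series_limit_tail: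
  assumes W: "series_limit \<beta> W" and s: "((\<lambda>i. (\<beta> i)\<^sup>2) has_sum s) UNIV" and p: "p > 0" and e: "e > 0"
  shows "prob {x \<in> space M. \<bar>W x\<bar> > e} \<le> moment_const p * s ^ p / e ^ (2 * p)"
proof -
  have [measurable]: "W \<in> borel_measurable M" using W by (simp add: series_limit_def)
  have s0: "s \<ge> 0" using has_sum_nonneg[OF s] by simp
  have "emeasure M {x \<in> space M. \<bar>W x\<bar> > e} \<le> emeasure M ({x \<in> space M. 1 \<le> ennreal (1 / e ^ (2 * p)) * ennreal (W x ^ (2 * p))} \<inter> space M)"
  proof (rule emeasure_mono)
    show "{x \<in> space M. \<bar>W x\<bar> > e} \<subseteq> {x \<in> space M. 1 \<le> ennreal (1 / e ^ (2 * p)) * ennreal (W x ^ (2 * p))} \<inter> space M"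
    proof safe
      fix x assume "e < \<bar>W x\<bar>"
      hence "e ^ (2 * p) \<le> \<bar>W x\<bar> ^ (2 * p)" using e by (intro power_mono) auto
      hence "1 \<le> 1 / e ^ (2 * p) * W x ^ (2 * p)" using e by (simp add: power_even_abs)
      thus "1 \<le> ennreal (1 / e ^ (2 * p)) * ennreal (W x ^ (2 * p))"
        by (subst ennreal_mult[symmetric]) (use e in auto)
    qed
  qed measurable
  also have "\<dots> \<le> ennreal (1 / e ^ (2 * p)) * (\<integral>\<^sup>+x. ennreal (W x ^ (2 * p)) * indicator (space M) x \<partial>M)"
    using nn_integral_Markov_inequality[of "\<lambda>x. ennreal (W x ^ (2 * p))" "space M" M "ennreal (1 / e ^ (2 * p))"]
    by (simp add: Int_def conj_commute)
  also have "(\<integral>\<^sup>+x. ennreal (W x ^ (2 * p)) * indicator (space M) x \<partial>M) = (\<integral>\<^sup>+x. ennreal (W x ^ (2 * p)) \<partial>M)"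
    by (intro nn_integral_cong) auto
  also have "ennreal (1 / e ^ (2 * p)) * \<dots> \<le> ennreal (1 / e ^ (2 * p)) * ennreal (moment_const p * s ^ p)"
    by (intro mult_left_mono series_limit_moment[OF W s p]) auto
  also have "\<dots> = ennreal (moment_const p * s ^ p / e ^ (2 * p))"
    using e s0 moment_const_pos[of p] by (subst ennreal_mult[symmetric]) (auto simp: less_imp_le)
  finally show ?thesis unfolding emeasure_eq_measure
    using e s0 moment_const_pos[of p] by (subst (asm) ennreal_le_iff) (auto simp: less_imp_le)
qed

text \<open>The characteristic function of a finite sum is a product of cosines. Comparing it factor by factor with
  the product of Gaussian factors costs \<open>\<Sum>i. (\<beta> i) ^ 4 \<le> d\<^sup>2 * s\<close>, which is uniform in
  the number of terms.\<close>
lemma series_limit_char: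
  assumes W: "series_limit \<beta> W" and s: "((\<lambda>i. (\<beta> i)\<^sup>2) has_sum s) UNIV" and d: "\<And>i. \<bar>\<beta> i\<bar> \<le> d"
  shows "cmod ((CLINT x|M. iexp (W x)) - complex_of_real (exp (- s / 2))) \<le> d\<^sup>2 * s"
proof -
  let ?S = "\<lambda>I x. \<Sum>i\<in>{- int I..int I}. \<beta> i * \<omega> i x"
  have [measurable]: "W \<in> borel_measurable M" using W by (simp add: series_limit_def)
  have lim: "(\<lambda>I. CLINT x|M. iexp (?S I x)) \<longlonglongrightarrow> (CLINT x|M. iexp (W x))"
  proof (rule integral_dominated_convergence[where w = "\<lambda>_. 1"])
    show "AE x in M. (\<lambda>I. iexp (?S I x)) \<longlonglongrightarrow> iexp (W x)"
      using W[unfolded series_limit_def, THEN conjunct2]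
    proof eventually_elim
      case (elim x) 
      from isCont_tendsto_compose[OF isCont_iexp this] show ?case .
    qed
  qed auto
  have fin: "(CLINT x|M. iexp (?S I x)) = of_real (\<Prod>i\<in>{- int I..int I}. cos (\<beta> i))" for I :: nat
  proof -
    have "(CLINT x|M. iexp (?S I x)) = (CLINT x|M. (\<Prod>i\<in>{- int I..int I}. iexp (\<beta> i * \<omega> i x)))"
      by (simp add: exp_sum sum_distrib_left)
    also have "\<dots> = (\<Prod>i\<in>{- int I..int I}. (1/2) *\<^sub>R (iexp (\<beta> i * 1) + iexp (\<beta> i * - 1)))"
      by (rule expectation_prod_signs[where f = "\<lambda>i y. iexp (\<beta> i * y)"]) auto
    also have "\<dots> = (\<Prod>i\<in>{- int I..int I}. complex_of_real (cos (\<beta> i)))"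
      by (intro prod.cong) (auto simp: complex_eq_iff Re_exp Im_exp)
    finally show ?thesis by simp
  qed
  have sums: "(\<lambda>I. \<Sum>i\<in>{- int I..int I}. (\<beta> i)\<^sup>2) \<longlonglongrightarrow> s"
  proof -
    have "filterlim (\<lambda>I. {- int I..int I}) (finite_subsets_at_top UNIV) sequentially"
      unfolding filterlim_finite_subsets_at_top
    proof (intro allI impI)
      fix X :: "int set" assume "finite X \<and> X \<subseteq> UNIV"
      hence X: "finite X" by simp
      obtain B where B: "\<And>i. i \<in> X \<Longrightarrow> \<bar>i\<bar> \<le> B" using X by (metis finite_abs_int_segment finite_imageI bdd_above_finite bdd_above.E imageI)
      show "\<forall>\<^sub>F I in sequentially. finite {- int I..int I} \<and> X \<subseteq> {- int I..int I} \<and> {- int I..int I} \<subseteq> UNIV"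
        using eventually_ge_at_top[of "nat B"]
      proof eventually_elim
        case (elim I)
        thus ?case using B by (fastforce simp: abs_le_iff)
      qed
    qed
    from filterlim_compose[OF s[unfolded has_sum_def] this] show ?thesis .
  qed
  have L: "(\<lambda>I. cmod ((CLINT x|M. iexp (?S I x)) - complex_of_real (exp (- (\<Sum>i\<in>{- int I..int I}. (\<beta> i)\<^sup>2) / 2)))) \<longlonglongrightarrow> 
     cmod ((CLINT x|M. iexp (W x)) - complex_of_real (exp (- s / 2)))"
    by (intro tendsto_norm tendsto_diff lim tendsto_of_real tendsto_exp tendsto_divide tendsto_minus sums tendsto_const) auto
  have B: "cmod ((CLINT x|M. iexp (?S I x)) - complex_of_real (exp (- (\<Sum>i\<in>{- int I..int I}. (\<beta> i)\<^sup>2) / 2))) \<le> d\<^sup>2 * s" for I :: nat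
  proof -
    let ?I = "{- int I..int I}"
    have "cmod ((CLINT x|M. iexp (?S I x)) - complex_of_real (exp (- (\<Sum>i\<in>?I. (\<beta> i)\<^sup>2) / 2))) = \<bar>(\<Prod>i\<in>?I. cos (\<beta> i)) - (\<Prod>i\<in>?I. exp (- ((\<beta> i)\<^sup>2) / 2))\<bar>"
      unfolding fin of_real_diff[symmetric] norm_of_real by (simp add: exp_sum[symmetric] sum_negf sum_divide_distrib)
    also have "\<dots> \<le> (\<Sum>i\<in>?I. \<bar>cos (\<beta> i) - exp (- ((\<beta> i)\<^sup>2) / 2)\<bar>)"
      using norm_prod_diff[of ?I "\<lambda>i. cos (\<beta> i)" "\<lambda>i. exp (- ((\<beta> i)\<^sup>2) / 2)"] by simp
    also have "\<dots> \<le> (\<Sum>i\<in>?I. d\<^sup>2 * (\<beta> i)\<^sup>2)"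
    proof (intro sum_mono)
      fix i
      have "(\<beta> i)\<^sup>2 \<le> d\<^sup>2" using d[of i] by (metis abs_le_square_iff abs_of_nonneg abs_ge_zero order_trans)
      hence "(\<beta> i)\<^sup>2 * (\<beta> i)\<^sup>2 \<le> d\<^sup>2 * (\<beta> i)\<^sup>2" by (intro mult_right_mono) auto
      thus "\<bar>cos (\<beta> i) - exp (- ((\<beta> i)\<^sup>2) / 2)\<bar> \<le> d\<^sup>2 * (\<beta> i)\<^sup>2"
        using cos_exp_diff_bound[of "\<beta> i"] by (simp flip: power_add)
    qed
    also have "\<dots> \<le> d\<^sup>2 * s"
      unfolding sum_distrib_left[symmetric] by (intro mult_left_mono finite_sum_le_has_sum[OF s]) auto
    finally show ?thesis .
  qed
  show ?thesis by (rule LIMSEQ_le_const2[OF L]) (use B in blast)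
qed

end

section \<open>The increments of the process as series of signs\<close>

lemma summation_by_parts:
  fixes a w :: "nat \<Rightarrow> real"
  shows "(\<Sum>j<n. a j * w j) = a n * (\<Sum>j<n. w j) + (\<Sum>j<n. (a j - a (Suc j)) * (\<Sum>i<Suc j. w i))"
  by (induction n) (simp_all add: algebra_simps)

text \<open>For \<open>g > 0\<close> the weights are not absolutely summable. Summation by parts replaces them by their
  differences, which gain one power of decay, at the price of the partial sums of \<open>w\<close>. A bound for
  those that is slightly weaker than square-root growth suffices, as \<open>g < 1/2\<close> leaves some room.\<close>
lemma summable_powr_weighted:
  fixes w :: "nat \<Rightarrow> real" and g :: real
  assumes g: "g < 1/2" and w: "\<forall>\<^sub>F n in sequentially. \<bar>\<Sum>j<n. w j\<bar> \<le> real n powr (1/2 + (1/2 - g) / 2)"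
  shows "summable (\<lambda>j. g * real (Suc j) powr (g - 1) * w j)"
proof -
  \<comment> \<open>Half of the room is given to the growth of the partial sums, the other half is kept as decay.\<close>
  define d where "d = (1/2 - g) / 2"
  have d: "d > 0" using g by (simp add: d_def)
  define a where "a j = g * real (Suc j) powr (g - 1)" for j
  define W where "W n = (\<Sum>j<n. w j)" for n
  have W: "\<forall>\<^sub>F n in sequentially. \<bar>W n\<bar> \<le> real n powr (1/2 + d)" using w by (simp add: W_def d_def)
  have "(\<lambda>n. a n * W n) \<longlonglongrightarrow> 0"
  proof (rule Lim_null_comparison)
    show "\<forall>\<^sub>F n in sequentially. norm (a n * W n) \<le> \<bar>g\<bar> * real (Suc n) powr (- d)"
      using W
    proof eventually_elim
      case (elim n)
      have "real n powr (1/2 + d) \<le> real (Suc n) powr (1/2 + d)" using d by (intro powr_mono2) auto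
      hence "norm (a n * W n) \<le> \<bar>g\<bar> * real (Suc n) powr (g - 1) * real (Suc n) powr (1/2 + d)"
        using elim by (auto simp: a_def abs_mult intro!: mult_mono)
      also have "\<dots> = \<bar>g\<bar> * real (Suc n) powr (g - 1 + (1/2 + d))" by (simp only: powr_add mult.assoc)
      also have "g - 1 + (1/2 + d) = - d" by (simp add: d_def field_simps)
      finally show ?case .
    qed
    show "(\<lambda>n. \<bar>g\<bar> * real (Suc n) powr (- d)) \<longlonglongrightarrow> 0" using d by real_asymp
  qed
  moreover have "summable (\<lambda>j. (a j - a (Suc j)) * W (Suc j))"
  proof (rule summable_comparison_test_ev)
    have "\<forall>\<^sub>F n in sequentially. \<bar>W (Suc n)\<bar> \<le> real (Suc n) powr (1/2 + d)"
      using W by (subst eventually_sequentially_Suc)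
    thus "\<forall>\<^sub>F n in sequentially. norm ((a n - a (Suc n)) * W (Suc n)) \<le> \<bar>g\<bar> * \<bar>g - 1\<bar> * real (Suc n) powr (- 1 - d)"
    proof eventually_elim
      case (elim n)
      have "\<bar>real (Suc (Suc n)) powr (g - 1) - real (Suc n) powr (g - 1)\<bar> \<le> \<bar>(g - 1) * real (Suc n) powr (g - 1 - 1)\<bar>"
        using powr_increment_upper[of "real (Suc n)" "g - 1"] g by (simp add: add_ac)
      hence "\<bar>a n - a (Suc n)\<bar> \<le> \<bar>g\<bar> * \<bar>(g - 1) * real (Suc n) powr (g - 1 - 1)\<bar>"
        unfolding a_def right_diff_distrib[symmetric] abs_mult by (intro mult_left_mono) (auto simp: abs_minus_commute)
      hence "norm ((a n - a (Suc n)) * W (Suc n)) \<le> (\<bar>g\<bar> * \<bar>(g - 1) * real (Suc n) powr (g - 1 - 1)\<bar>) * real (Suc n) powr (1/2 + d)"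
        unfolding real_norm_def abs_mult[of _ "W _"] using elim by (intro mult_mono) auto
      also have "\<dots> = \<bar>g\<bar> * \<bar>g - 1\<bar> * real (Suc n) powr (g - 1 - 1 + (1/2 + d))"
        by (simp only: powr_add abs_mult mult.assoc abs_of_nonneg[OF powr_ge_zero])
      also have "g - 1 - 1 + (1/2 + d) = - 1 - d" by (simp add: d_def field_simps)
      finally show ?case .
    qed
    have "summable (\<lambda>n. real (Suc n) powr (- 1 - d))"
      using d by (subst summable_Suc_iff) (simp add: summable_real_powr_iff)
    thus "summable (\<lambda>n. \<bar>g\<bar> * \<bar>g - 1\<bar> * real (Suc n) powr (- 1 - d))" by (rule summable_mult)
  qed
  ultimately have "convergent (\<lambda>n. a n * W n + (\<Sum>j<n. (a j - a (Suc j)) * W (Suc j)))"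
    unfolding summable_iff_convergent by (intro convergent_add) (auto simp: convergent_def)
  thus ?thesis unfolding summable_iff_convergent W_def a_def using summation_by_parts[of "\<lambda>j. g * real (Suc j) powr (g - 1)" w] by simp
qed

text \<open>The increment for grid size \<open>1\<close>; the one for general \<open>N\<close> is a scalar multiple.\<close>
definition unit_incr :: "real \<Rightarrow> (int \<Rightarrow> real) \<Rightarrow> int \<Rightarrow> real" where
  "unit_incr H w k = KH H * w k + (\<Sum>j. weight H (int (Suc j)) * w (k - int (Suc j)))"

text \<open>The symmetric partial sums over all integers run through a subsequence of the partial sums of the
  series in the definition, because the weights of future signs vanish.\<close>
lemma weight_partial_sums:
  assumes "summable (\<lambda>j. weight H (int (Suc j)) * w (int k - int (Suc j)))"
  shows "(\<lambda>I. \<Sum>i\<in>{- int I..int I}. weight H (int k - i) * w i) \<longlonglongrightarrow> unit_incr H w (int k)"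
proof -
  let ?f = "\<lambda>j. weight H (int (Suc j)) * w (int k - int (Suc j))"
  have "(\<lambda>n. \<Sum>j<n. ?f j) \<longlonglongrightarrow> suminf ?f" using summable_LIMSEQ[OF assms] .
  hence "(\<lambda>I. \<Sum>j<k + I. ?f j) \<longlonglongrightarrow> suminf ?f"
    by (rule filterlim_compose) (rule filterlim_add_const_nat_at_top[THEN filterlim_cong[THEN iffD1, rotated -1]], auto simp: add.commute)
  hence "(\<lambda>I. KH H * w (int k) + (\<Sum>j<k + I. ?f j)) \<longlonglongrightarrow> unit_incr H w (int k)"
    unfolding unit_incr_def by (intro tendsto_intros)
  moreover have "\<forall>\<^sub>F I in sequentially. KH H * w (int k) + (\<Sum>j<k + I. ?f j) = (\<Sum>i\<in>{- int I..int I}. weight H (int k - i) * w i)"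
    using eventually_ge_at_top[of k]
  proof eventually_elim
    case (elim I)
    have "(\<Sum>i\<in>{- int I..int I}. weight H (int k - i) * w i) = (\<Sum>i\<in>{- int I..int k}. weight H (int k - i) * w i)"
      by (rule sum.mono_neutral_right) (use elim in \<open>auto simp: weight_def\<close>)
    also have "\<dots> = (\<Sum>j\<le>k + I. weight H (int j) * w (int k - int j))"
      by (rule sum.reindex_bij_witness[of _ "\<lambda>j. int k - int j" "\<lambda>i. nat (int k - i)"]) auto
    also have "\<dots> = KH H * w (int k) + (\<Sum>j<k + I. ?f j)"
      unfolding sum.atMost_shift by (simp add: weight_def)
    finally show ?case by simp
  qed
  ultimately show ?thesis by (rule Lim_transform_eventually)
qed

lemma dX_eq_unit_incr:
  assumes N: "N > 0" and s: "summable (\<lambda>j. weight H (int (Suc j)) * w (k - int (Suc j)))"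
  shows "dX H N w k = real N powr (- H) * unit_incr H w k"
proof -
  have N': "real N > 0" using N by simp
  have sq: "sqrt (dt N) = real N powr (- (1/2))" using N'
    by (simp add: dt_def real_sqrt_divide powr_minus_divide powr_half_sqrt)
  have dt: "dt N = real N powr (- 1)" using N' by (simp add: dt_def powr_minus_divide)
  have dt_powr: "dt N powr a = real N powr (- a)" for a by (simp only: dt powr_powr) simp
  have 1: "dt N powr (H - 1/2) * sqrt (dt N) = real N powr (- H)"
    unfolding dt_powr sq by (simp flip: powr_add)
  have 2: "(real (Suc j) * dt N) powr (H - 3/2) * dt N * sqrt (dt N) = real (Suc j) powr (H - 3/2) * real N powr (- H)" for j
  proof -
    have "(real (Suc j) * dt N) powr (H - 3/2) * dt N * sqrt (dt N) = real (Suc j) powr (H - 3/2) * (real N powr (- (H - 3/2)) * real N powr (-1) * real N powr (- (1/2)))"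
    proof -
      have "(real (Suc j) * dt N) powr (H - 3/2) = real (Suc j) powr (H - 3/2) * real N powr (- (H - 3/2))"
        unfolding dt_powr[symmetric] by (subst powr_mult) (auto simp: dt_def)
      thus ?thesis unfolding sq unfolding dt by (simp only: mult.assoc)
    qed
    also have "real N powr (- (H - 3/2)) * real N powr (-1) * real N powr (- (1/2)) = real N powr (- (H - 3/2) + -1 + - (1/2))"
      by (simp only: powr_add)
    also have "- (H - 3/2) + -1 + - (1/2) = - H" by simp
    finally show ?thesis .
  qed
  have E: "(H - 1/2) * (real (Suc j) * dt N) powr (H - 3/2) * dt N * dB N w (k - int (Suc j)) =
     real N powr (- H) * (weight H (int (Suc j)) * w (k - int (Suc j)))" for j
  proof -
    have "(H - 1/2) * (real (Suc j) * dt N) powr (H - 3/2) * dt N * dB N w (k - int (Suc j)) =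
       (H - 1/2) * ((real (Suc j) * dt N) powr (H - 3/2) * dt N * sqrt (dt N)) * w (k - int (Suc j))"
      by (simp add: dB_def del: of_nat_Suc)
    thus ?thesis unfolding 2 by (simp add: weight_def algebra_simps)
  qed
  have "dX H N w k = KH H * (dt N powr (H - 1/2) * sqrt (dt N)) * w k + (\<Sum>j. real N powr (- H) * (weight H (int (Suc j)) * w (k - int (Suc j))))"
    unfolding dX_def E by (simp add: dB_def)
  also have "\<dots> = real N powr (- H) * unit_incr H w k"
    unfolding 1 suminf_mult[OF s] unit_incr_def by (simp add: algebra_simps)
  finally show ?thesis .
qed

text \<open>The normalized process at the grid point \<open>n/N\<close>, as a random variable.\<close>
definition grid :: "(int \<Rightarrow> 'a \<Rightarrow> real) \<Rightarrow> real \<Rightarrow> nat \<Rightarrow> nat \<Rightarrow> 'a \<Rightarrow> real" where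
  "grid w H N n x = cH H * X_grid H N (\<lambda>k. w k x) n"

definition scaling :: "real \<Rightarrow> nat \<Rightarrow> real" where
  "scaling H N = cH H * real N powr (- H)"

context rademacher begin

text \<open>The moments of order \<open>2p\<close> of the normalized partial sums are summable once \<open>p\<close> is large enough,
  so almost surely the series of their \<open>2p\<close>-th powers converges and its terms tend to zero.\<close>
lemma AE_sign_sums_growth:
  assumes e: "inj e" and d: "d > 0"
  shows "AE x in M. \<forall>\<^sub>F n in sequentially. \<bar>\<Sum>j<n. \<omega> (e j) x\<bar> \<le> real n powr (1/2 + d)"
proof -
  obtain p :: nat where p: "p > 0" "2 * d * real p \<ge> 2"
  proof -
    obtain p :: nat where "real p > 1 / d" using reals_Archimedean2 by blast
    thus ?thesis using d by (intro that[of p]) (auto simp: field_simps intro: Nat.gr0I)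
  qed
  define W where "W n x = (\<Sum>j<n. \<omega> (e j) x)" for n x
  have [measurable]: "W n \<in> borel_measurable M" for n unfolding W_def by measurable
  define Q where "Q n x = (W (Suc n) x / real (Suc n) powr (1/2 + d)) ^ (2 * p)" for n x
  have Q0: "Q n x \<ge> 0" for n x by (simp add: Q_def zero_le_even_power)
  have [measurable]: "Q n \<in> borel_measurable M" for n unfolding Q_def by measurable
  have W_eq: "W n x = (\<Sum>i\<in>e ` {..<n}. 1 * \<omega> i x)" for n x
    unfolding W_def using e by (subst sum.reindex) (auto intro: inj_on_subset)
  have card: "(\<Sum>i\<in>e ` {..<n}. (1::real)\<^sup>2) \<le> real n" for n
    using card_image_le[of "{..<n}" e] by simp
  have EQ: "(\<integral>\<^sup>+x. ennreal (Q n x) \<partial>M) \<le> ennreal (moment_const p * (1 / real (Suc n) ^ 2))" for n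
  proof -
    let ?c = "real (Suc n) powr (1/2 + d)"
    note mom = sign_sum_moment[OF _ card[of "Suc n"] p(1), folded W_eq]
    have int: "integrable M (Q n)" unfolding Q_def power_divide using mom(1) by simp
    have "?c ^ (2 * p) = real (Suc n) powr (real (2 * p) * (1/2 + d))"
      by (simp add: powr_powr mult.commute flip: powr_realpow del: of_nat_Suc)
    also have "real (2 * p) * (1/2 + d) = real p + 2 * d * real p" by (simp add: algebra_simps)
    also have "real (Suc n) powr (real p + 2) \<le> real (Suc n) powr (real p + 2 * d * real p)"
      using p(2) by (intro powr_mono) auto
    also have "real (Suc n) powr (real p + 2) = real (Suc n) ^ p * real (Suc n) ^ 2"
      by (simp add: powr_add powr_realpow del: of_nat_Suc)
    finally have c: "real (Suc n) ^ p * real (Suc n) ^ 2 \<le> ?c ^ (2 * p)" .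
    have "expectation (Q n) = expectation (\<lambda>x. W (Suc n) x ^ (2 * p)) / ?c ^ (2 * p)"
      unfolding Q_def power_divide by simp
    also have "\<dots> \<le> moment_const p * real (Suc n) ^ p / (real (Suc n) ^ p * real (Suc n) ^ 2)"
      using c mom(2) moment_const_pos[of p] by (intro frac_le) (auto simp: less_imp_le simp del: of_nat_Suc)
    also have "\<dots> = moment_const p * (1 / real (Suc n) ^ 2)" by (simp del: of_nat_Suc)
    finally show ?thesis using int Q0 by (subst nn_integral_eq_integral) (auto intro!: ennreal_leI)
  qed
  have "(\<integral>\<^sup>+x. (\<Sum>n. ennreal (Q n x)) \<partial>M) = (\<Sum>n. \<integral>\<^sup>+x. ennreal (Q n x) \<partial>M)"
    by (rule nn_integral_suminf) measurable
  also have "\<dots> \<le> (\<Sum>n. ennreal (moment_const p * (1 / real (Suc n) ^ 2)))" by (intro suminf_le EQ) auto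
  also have "\<dots> = ennreal (\<Sum>n. moment_const p * (1 / real (Suc n) ^ 2))"
  proof (rule suminf_ennreal2)
    show "summable (\<lambda>n. moment_const p * (1 / real (Suc n) ^ 2))"
      using inverse_squares_sums by (intro summable_mult) (simp add: sums_iff add.commute)
  qed (use moment_const_pos[of p] in auto)
  also have "\<dots> < \<infinity>" by simp
  finally have "AE x in M. (\<Sum>n. ennreal (Q n x)) \<noteq> \<infinity>" by (intro nn_integral_noteq_infinite) auto
  thus ?thesis
  proof eventually_elim
    case (elim x)
    have "summable (\<lambda>n. Q n x)" using elim Q0 by (intro summable_suminf_not_top) auto
    hence "(\<lambda>n. Q n x) \<longlonglongrightarrow> 0" by (rule summable_LIMSEQ_zero)
    hence "\<forall>\<^sub>F n in sequentially. Q n x < 1" by (rule order_tendstoD) simp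
    hence "\<forall>\<^sub>F n in sequentially. \<bar>W (Suc n) x\<bar> \<le> real (Suc n) powr (1/2 + d)"
    proof eventually_elim
      case (elim n)
      have "\<bar>W (Suc n) x / real (Suc n) powr (1/2 + d)\<bar> ^ (2 * p) < 1" using elim unfolding Q_def by (subst power_even_abs) auto
      hence "\<bar>W (Suc n) x / real (Suc n) powr (1/2 + d)\<bar> < 1" by (metis not_less one_le_power)
      thus ?case by (simp add: abs_divide field_simps del: of_nat_Suc)
    qed
    thus ?case unfolding W_def by (subst (asm) eventually_sequentially_Suc)
  qed
qed

lemma AE_weight_summable:
  assumes "H < 1"
  shows "AE x in M. \<forall>k. summable (\<lambda>j. weight H (int (Suc j)) * \<omega> (k - int (Suc j)) x)"
  unfolding AE_all_countable
proof
  fix k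
  have "AE x in M. \<forall>\<^sub>F n in sequentially. \<bar>\<Sum>j<n. \<omega> (k - int (Suc j)) x\<bar> \<le> real n powr (1/2 + (1/2 - (H - 1/2)) / 2)"
    using assms by (intro AE_sign_sums_growth) (auto simp: inj_on_def)
  thus "AE x in M. summable (\<lambda>j. weight H (int (Suc j)) * \<omega> (k - int (Suc j)) x)"
  proof eventually_elim
    case (elim x)
    have "H - 1/2 - 1 = H - 3/2" by simp
    with summable_powr_weighted[OF _ elim] show ?case using assms by (simp add: weight_def)
  qed
qed

lemma X_grid_measurable [measurable]: "(\<lambda>x. X_grid H N (\<lambda>k. \<omega> k x) n) \<in> borel_measurable M"
  unfolding X_grid_def dX_def dB_def by measurable

lemma grid_measurable [measurable]: "grid \<omega> H N n \<in> borel_measurable M"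
  unfolding grid_def by measurable

lemma series_limit_grid:
  assumes H: "H < 1" and N: "N > 0"
  shows "series_limit (\<lambda>i. scaling H N * kernel H n i) (grid \<omega> H N n)"
  unfolding series_limit_def
proof
  show "AE x in M. (\<lambda>I. \<Sum>i\<in>{- int I..int I}. scaling H N * kernel H n i * \<omega> i x) \<longlonglongrightarrow> grid \<omega> H N n x"
    using AE_weight_summable[OF H]
  proof eventually_elim
    case (elim x)
    let ?w = "\<lambda>i. \<omega> i x"
    have "(\<lambda>I. scaling H N * (\<Sum>k<n. \<Sum>i\<in>{- int I..int I}. weight H (int k - i) * ?w i)) \<longlonglongrightarrow> scaling H N * (\<Sum>k<n. unit_incr H ?w (int k))"
      using elim by (intro tendsto_mult_left tendsto_sum weight_partial_sums) auto
    moreover have "scaling H N * (\<Sum>k<n. \<Sum>i\<in>{- int I..int I}. weight H (int k - i) * ?w i) = (\<Sum>i\<in>{- int I..int I}. scaling H N * kernel H n i * \<omega> i x)" for I :: nat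
      unfolding kernel_def by (subst sum.swap) (simp add: sum_distrib_left sum_distrib_right mult.assoc)
    moreover have "scaling H N * (\<Sum>k<n. unit_incr H ?w (int k)) = grid \<omega> H N n x"
      using elim N by (simp add: grid_def X_grid_def scaling_def dX_eq_unit_incr[OF N] sum_distrib_left mult.assoc)
    ultimately show ?case by simp
  qed
qed measurable

lemma series_limit_sum:
  assumes "finite T" "\<And>t. t \<in> T \<Longrightarrow> series_limit (\<beta> t) (W t)"
  shows "series_limit (\<lambda>i. \<Sum>t\<in>T. a t * \<beta> t i) (\<lambda>x. \<Sum>t\<in>T. a t * W t x)"
  unfolding series_limit_def
proof
  have [measurable]: "t \<in> T \<Longrightarrow> W t \<in> borel_measurable M" for t using assms(2) by (auto simp: series_limit_def)
  show "(\<lambda>x. \<Sum>t\<in>T. a t * W t x) \<in> borel_measurable M" by measurable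
  have "AE x in M. \<forall>t\<in>T. (\<lambda>I. \<Sum>i\<in>{- int I..int I}. \<beta> t i * \<omega> i x) \<longlonglongrightarrow> W t x"
    using assms by (intro AE_finite_allI) (auto simp: series_limit_def)
  thus "AE x in M. (\<lambda>I. \<Sum>i\<in>{- int I..int I}. (\<Sum>t\<in>T. a t * \<beta> t i) * \<omega> i x) \<longlonglongrightarrow> (\<Sum>t\<in>T. a t * W t x)"
  proof eventually_elim
    case (elim x)
    hence "(\<lambda>I. \<Sum>t\<in>T. a t * (\<Sum>i\<in>{- int I..int I}. \<beta> t i * \<omega> i x)) \<longlonglongrightarrow> (\<Sum>t\<in>T. a t * W t x)"
      by (intro tendsto_sum tendsto_mult_left) auto
    moreover have "(\<Sum>t\<in>T. a t * (\<Sum>i\<in>{- int I..int I}. \<beta> t i * \<omega> i x)) = (\<Sum>i\<in>{- int I..int I}. (\<Sum>t\<in>T. a t * \<beta> t i) * \<omega> i x)" for I :: nat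
      unfolding sum_distrib_left sum_distrib_right by (subst sum.swap) (simp add: mult.assoc)
    ultimately show ?case by simp
  qed
qed

end

section \<open>Convergence of the finite-dimensional characteristic functions\<close>

definition fbm_cov :: "real \<Rightarrow> real \<Rightarrow> real \<Rightarrow> real" where
  "fbm_cov H s t = (s powr (2*H) + t powr (2*H) - \<bar>t - s\<bar> powr (2*H)) / 2"

text \<open>The exponent \<open>max (H - 1/2) 0\<close> is smaller than \<open>H\<close>, so after scaling each single sign has a
  negligible influence. For \<open>H < 1/2\<close> the partial sums of the weights are bounded. For \<open>H \<ge> 1/2\<close> the
  weights \<open>(H - 1/2) * j powr (H - 3/2)\<close> are nonnegative and decreasing in \<open>j\<close>, so a block of them
  is largest at the start.\<close>
lemma kernel_bound:
  assumes H: "0 < H" "H < 1"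
  obtains C where "C > 0" "\<And>n i. \<bar>kernel H n i\<bar> \<le> C * (real n + 1) powr (max (H - 1/2) 0)"
proof -
  obtain C where C: "C > 0" "\<And>m. \<bar>cumweight H m\<bar> \<le> C * (real m + 1) powr (H - 1/2)"
    using cumweight_bound[OF H] by metis
  let ?h = "max (H - 1/2) 0"
  have small: "\<bar>cumweight H m\<bar> \<le> C * (real n + 1) powr ?h" if "m \<le> n" for m n
  proof -
    have "(real m + 1) powr (H - 1/2) \<le> (real m + 1) powr ?h" by (intro powr_mono) auto
    also have "\<dots> \<le> (real n + 1) powr ?h" using that by (intro powr_mono2) auto
    finally show ?thesis using C by (meson mult_left_mono order_trans less_imp_le)
  qed
  have "\<bar>kernel H n i\<bar> \<le> (2 * C) * (real n + 1) powr ?h" for n i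
  proof -
    consider "int n \<le> i" | "0 \<le> i" "i < int n" | "i < 0" by linarith
    thus ?thesis
    proof cases
      case 1 thus ?thesis using C(1) by (simp add: kernel_future)
    next
      case 2
      hence "kernel H n i = cumweight H (n - 1 - nat i)" using kernel_present[of "nat i" "n - 1" H] by simp
      moreover have "C * (real n + 1) powr ?h \<le> 2 * C * (real n + 1) powr ?h" using C(1) by simp
      ultimately show ?thesis using small[of "n - 1 - nat i" n] by simp
    next
      case 3
      define q where "q = nat (- i - 1)"
      have "i = - int (Suc q)" using 3 by (simp add: q_def)
      hence k: "kernel H n i = past_kernel H n q" using kernel_past by simp
      show ?thesis
      proof (cases "H < 1/2")
        case True
        have "\<bar>cumweight H m\<bar> \<le> C" for m
        proof -
          have "(real m + 1) powr (H - 1/2) \<le> 1 powr (H - 1/2)" using True by (intro powr_mono2') auto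
          hence "C * (real m + 1) powr (H - 1/2) \<le> C" using C(1) by simp
          thus ?thesis using C(2)[of m] by linarith
        qed
        from this[of "n + q"] this[of q] have "\<bar>kernel H n i\<bar> \<le> 2 * C" unfolding k by linarith
        also have "\<dots> = (2 * C) * (real n + 1) powr ?h" using True by simp
        finally show ?thesis .
      next
        case False
        have "0 \<le> past_kernel H n q \<and> past_kernel H n q \<le> cumweight H n - cumweight H 0"
        proof (induction n)
          case (Suc n)
          have "(real (n + q) + 1) powr (H - 3/2) \<le> (real n + 1) powr (H - 3/2)" using H by (intro powr_mono2') auto
          hence "(H - 1/2) * (real (n + q) + 1) powr (H - 3/2) \<le> (H - 1/2) * (real n + 1) powr (H - 3/2)"
            using False by (intro mult_left_mono) auto
          moreover have "0 \<le> (H - 1/2) * (real (n + q) + 1) powr (H - 3/2)" using False by simp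
          ultimately show ?case using Suc unfolding add_Suc cumweight_Suc by linarith
        qed simp
        hence "\<bar>kernel H n i\<bar> \<le> \<bar>cumweight H n\<bar>" unfolding k using cumweight_nonneg[OF H, of 0] by linarith
        also have "\<dots> \<le> C * (real n + 1) powr ?h" by (rule small) simp
        also have "\<dots> \<le> (2 * C) * (real n + 1) powr ?h" using C(1) by simp
        finally show ?thesis .
      qed
    qed
  qed
  thus ?thesis using C(1) by (intro that[of "2 * C"]) auto
qed

lemma kernel_shift_has_sum:
  assumes H: "0 < H" "H < 1"
  shows "((\<lambda>i. (kernel H n (i - m))\<^sup>2) has_sum kernel_var H n) UNIV"
proof -
  have "bij_betw (\<lambda>i. i - m) UNIV UNIV" by (rule bij_betwI[of _ _ _ "\<lambda>i. i + m"]) auto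
  from has_sum_reindex_bij_betw[OF this, of "\<lambda>i. (kernel H n i)\<^sup>2" "kernel_var H n"] kernel_sq_summable[OF H, of n]
  show ?thesis by (simp add: kernel_var_def)
qed

text \<open>The distance of two natural numbers, written with truncated subtraction.\<close>
abbreviation nat_dist :: "nat \<Rightarrow> nat \<Rightarrow> nat" where
  "nat_dist m n \<equiv> (m - n) + (n - m)"

text \<open>Polarization: the difference of the two kernels is a shifted kernel, so the mixed sum is determined by
  three sums of squares. This is the origin of the covariance of fractional Brownian motion.\<close>
lemma kernel_product_has_sum:
  assumes H: "0 < H" "H < 1"
  shows "((\<lambda>i. kernel H m i * kernel H n i) has_sum (kernel_var H m + kernel_var H n - kernel_var H (nat_dist m n)) / 2) UNIV"
proof -
  have *: "((\<lambda>i. kernel H m i * kernel H n i) has_sum (kernel_var H m + kernel_var H n - kernel_var H (n - m)) / 2) UNIV"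
    if "m \<le> n" for m n
  proof -
    have n: "kernel H n i = kernel H m i + kernel H (n - m) (i - int m)" for i
      using kernel_add[of H m "n - m" i] that by simp
    have "((\<lambda>i. (1/2) * ((kernel H m i)\<^sup>2 + (kernel H n i)\<^sup>2 + (-1) * (kernel H (n - m) (i - int m))\<^sup>2)) has_sum
       (1/2) * (kernel_var H m + kernel_var H n + (-1) * kernel_var H (n - m))) UNIV"
      using kernel_shift_has_sum[OF H, of m 0] kernel_shift_has_sum[OF H, of n 0]
      by (intro has_sum_cmult_right has_sum_add kernel_shift_has_sum H) auto
    moreover have "(1/2) * ((kernel H m i)\<^sup>2 + (kernel H n i)\<^sup>2 + (-1) * (kernel H (n - m) (i - int m))\<^sup>2) = kernel H m i * kernel H n i" for i
      unfolding n by (simp add: power2_eq_square algebra_simps)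
    ultimately show ?thesis by (simp add: field_simps)
  qed
  show ?thesis
  proof (cases "m \<le> n")
    case True thus ?thesis using *[OF True] by simp
  next
    case False thus ?thesis using *[of n m] by (simp add: mult.commute add.commute)
  qed
qed

lemma has_sum_sum_real:
  fixes f :: "'b \<Rightarrow> 'c \<Rightarrow> real"
  assumes "finite T" "\<And>t. t \<in> T \<Longrightarrow> (f t has_sum s t) A"
  shows "((\<lambda>i. \<Sum>t\<in>T. f t i) has_sum (\<Sum>t\<in>T. s t)) A"
  using assms by (induction T rule: finite_induct) (auto intro!: has_sum_add)

lemma combination_has_sum:
  assumes H: "0 < H" "H < 1" and T: "finite T"
  shows "((\<lambda>i. (\<Sum>t\<in>T. a t * (c * kernel H (n t) i))\<^sup>2) has_sum
    (\<Sum>s\<in>T. \<Sum>t\<in>T. a s * a t * (c\<^sup>2 * ((kernel_var H (n s) + kernel_var H (n t) - kernel_var H (nat_dist (n s) (n t))) / 2)))) UNIV"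
proof -
  have "(\<Sum>t\<in>T. a t * (c * kernel H (n t) i))\<^sup>2 = (\<Sum>s\<in>T. \<Sum>t\<in>T. a s * a t * (c\<^sup>2 * (kernel H (n s) i * kernel H (n t) i)))" for i
    unfolding power2_eq_square sum_product by (intro sum.cong) (auto simp: mult_ac)
  moreover have "((\<lambda>i. \<Sum>s\<in>T. \<Sum>t\<in>T. a s * a t * (c\<^sup>2 * (kernel H (n s) i * kernel H (n t) i))) has_sum 
    (\<Sum>s\<in>T. \<Sum>t\<in>T. a s * a t * (c\<^sup>2 * ((kernel_var H (n s) + kernel_var H (n t) - kernel_var H (nat_dist (n s) (n t))) / 2)))) UNIV"
    by (intro has_sum_sum_real T has_sum_cmult_right kernel_product_has_sum H)
  ultimately show ?thesis by simp
qed

lemma kernel_var_nonneg: "0 \<le> kernel_var H n"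
  unfolding kernel_var_def by (rule infsum_nonneg) simp

lemma scaling_sq: "(scaling H N)\<^sup>2 = (cH H)\<^sup>2 * real N powr (- 2 * H)"
proof -
  have "(real N powr (- H))\<^sup>2 = real N powr (- H + - H)" unfolding power2_eq_square by (simp only: powr_add)
  thus ?thesis by (simp add: scaling_def power_mult_distrib)
qed

lemma scaled_var_le:
  assumes H: "0 < H" and N: "N > 0" and C: "\<And>n. kernel_var H n \<le> C * real n powr (2 * H)"
  shows "(scaling H N)\<^sup>2 * kernel_var H n \<le> (cH H)\<^sup>2 * C * (real n / real N) powr (2 * H)"
proof -
  have "(scaling H N)\<^sup>2 * kernel_var H n \<le> (scaling H N)\<^sup>2 * (C * real n powr (2 * H))" by (intro mult_left_mono C) auto
  also have "\<dots> = (cH H)\<^sup>2 * C * (real n / real N) powr (2 * H)"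
    using N unfolding scaling_sq by (subst powr_divide) (auto simp: powr_minus field_simps)
  finally show ?thesis .
qed

text \<open>For \<open>\<tau> = 0\<close> the index \<open>d N\<close> need not tend to infinity, and the asymptotics of the variance is
  replaced by the bound valid for all indices.\<close>
lemma scaled_var_tendsto:
  assumes H: "0 < H" "H < 1" and lim: "(\<lambda>N. real (d N) / real N) \<longlonglongrightarrow> \<tau>" and \<tau>: "\<tau> \<ge> 0"
  shows "(\<lambda>N. (scaling H N)\<^sup>2 * kernel_var H (d N)) \<longlonglongrightarrow> \<tau> powr (2 * H)"
proof (cases "\<tau> = 0")
  case True
  obtain C where C: "C > 0" "\<And>n. kernel_var H n \<le> C * real n powr (2 * H)" using kernel_var_bound[OF H] by metis
  have "(\<lambda>N. (scaling H N)\<^sup>2 * kernel_var H (d N)) \<longlonglongrightarrow> 0"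
  proof (rule Lim_null_comparison)
    show "\<forall>\<^sub>F N in sequentially. norm ((scaling H N)\<^sup>2 * kernel_var H (d N)) \<le> (cH H)\<^sup>2 * C * (real (d N) / real N) powr (2 * H)"
      using eventually_gt_at_top[of 0] by eventually_elim (use scaled_var_le[OF H(1) _ C(2)] kernel_var_nonneg in simp)
    have "(\<lambda>N. (real (d N) / real N) powr (2 * H)) \<longlonglongrightarrow> 0 powr (2 * H)"
      using H lim True by (intro tendsto_powr') auto
    from tendsto_mult_right_zero[OF this[simplified], of "(cH H)\<^sup>2 * C"]
    show "(\<lambda>N. (cH H)\<^sup>2 * C * (real (d N) / real N) powr (2 * H)) \<longlonglongrightarrow> 0" .
  qed
  thus ?thesis using True by simp
next
  case False
  hence \<tau>: "\<tau> > 0" using \<tau> by simp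
  have "filterlim (\<lambda>N. real (d N) / real N * real N) at_top sequentially"
    by (rule filterlim_tendsto_pos_mult_at_top[OF lim \<tau> filterlim_real_sequentially])
  moreover have "\<forall>\<^sub>F N in sequentially. real (d N) / real N * real N = real (d N)"
    using eventually_gt_at_top[of 0] by eventually_elim simp
  ultimately have "filterlim (\<lambda>N. real (d N)) at_top sequentially" by (simp cong: filterlim_cong)
  hence d: "filterlim d at_top sequentially" by (simp add: filterlim_sequentially_iff_filterlim_real)
  have "(\<lambda>N. (cH H)\<^sup>2 * (kernel_var H (d N) / real (d N) powr (2 * H)) * (real (d N) / real N) powr (2 * H)) \<longlonglongrightarrow> (cH H)\<^sup>2 * var_const H * \<tau> powr (2 * H)"
    using False by (intro tendsto_intros filterlim_compose[OF kernel_var_asymp[OF H] d] lim) auto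
  moreover have "\<forall>\<^sub>F N in sequentially. (cH H)\<^sup>2 * (kernel_var H (d N) / real (d N) powr (2 * H)) * (real (d N) / real N) powr (2 * H) = (scaling H N)\<^sup>2 * kernel_var H (d N)"
    using eventually_gt_at_top[of 0] d[unfolded filterlim_at_top, rule_format, of 1]
  proof eventually_elim
    case (elim N)
    thus ?case unfolding scaling_sq by (subst powr_divide) (auto simp: powr_minus field_simps)
  qed
  ultimately have "(\<lambda>N. (scaling H N)\<^sup>2 * kernel_var H (d N)) \<longlonglongrightarrow> (cH H)\<^sup>2 * var_const H * \<tau> powr (2 * H)"
    by (rule Lim_transform_eventually)
  thus ?thesis using cH_sq[OF H(1)] by simp
qed

lemma floor_scaled_tendsto:
  assumes "t \<ge> 0" shows "(\<lambda>N. real (cell N t) / real N) \<longlonglongrightarrow> t"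
  using cell_tendsto(1)[of t] assms by (cases "t = 0") auto

lemma dist_scaled_tendsto:
  assumes "s \<ge> 0" "t \<ge> 0"
  shows "(\<lambda>N. real (nat_dist (cell N s) (cell N t)) / real N) \<longlonglongrightarrow> \<bar>t - s\<bar>"
proof -
  have "real (nat_dist m n) / real N = \<bar>real n / real N - real m / real N\<bar>" for m n N :: nat
  proof -
    have "real (nat_dist m n) = \<bar>real n - real m\<bar>" by (cases "m \<le> n") (auto simp: of_nat_diff)
    thus ?thesis by (simp add: abs_divide flip: diff_divide_distrib)
  qed
  thus ?thesis by (simp only:) (intro tendsto_intros floor_scaled_tendsto assms)
qed

theorem grid_fdd_char:
  fixes M :: "nat \<Rightarrow> 'a measure" and w :: "nat \<Rightarrow> int \<Rightarrow> 'a \<Rightarrow> real" and t :: "nat \<Rightarrow> real"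
  assumes H: "0 < H" "H < 1" and R: "\<And>N. N \<ge> 1 \<Longrightarrow> rademacher (M N) (w N)" and t: "\<And>k. t k \<ge> 0"
  shows "(\<lambda>N. CLINT x|M N. iexp (\<Sum>k<m. a k * grid (w N) H N (cell N (t k)) x))
     \<longlonglongrightarrow> complex_of_real (exp (- (\<Sum>k<m. \<Sum>l<m. a k * a l * fbm_cov H (t k) (t l)) / 2))"
proof -
  define n where "n N k = cell N (t k)" for N k
  define s where "s N = (\<Sum>k<m. \<Sum>l<m. a k * a l * ((scaling H N)\<^sup>2 * ((kernel_var H (n N k) + kernel_var H (n N l) - kernel_var H (nat_dist (n N k) (n N l))) / 2)))" for N
  define S where "S = (\<Sum>k<m. \<Sum>l<m. a k * a l * fbm_cov H (t k) (t l))"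
  have s: "s \<longlonglongrightarrow> S" unfolding s_def S_def
  proof (intro tendsto_sum tendsto_mult_left)
    fix k l
    have "(\<lambda>N. ((scaling H N)\<^sup>2 * kernel_var H (n N k) + (scaling H N)\<^sup>2 * kernel_var H (n N l) - (scaling H N)\<^sup>2 * kernel_var H (nat_dist (n N k) (n N l))) / 2) \<longlonglongrightarrow> fbm_cov H (t k) (t l)"
      unfolding fbm_cov_def n_def
      by (intro tendsto_divide tendsto_diff tendsto_add tendsto_const scaled_var_tendsto H floor_scaled_tendsto dist_scaled_tendsto t) auto
    thus "(\<lambda>N. (scaling H N)\<^sup>2 * ((kernel_var H (n N k) + kernel_var H (n N l) - kernel_var H (nat_dist (n N k) (n N l))) / 2)) \<longlonglongrightarrow> fbm_cov H (t k) (t l)"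
      by (simp add: algebra_simps)
  qed
  obtain C where C: "C > 0" "\<And>n i. \<bar>kernel H n i\<bar> \<le> C * (real n + 1) powr (max (H - 1/2) 0)"
    using kernel_bound[OF H] by metis
  define h where "h = max (H - 1/2) 0"
  have h: "0 \<le> h" "h < H" using H by (auto simp: h_def)
  define T where "T = (\<Sum>k<m. t k)"
  have T: "T \<ge> 0" "\<And>k. k < m \<Longrightarrow> t k \<le> T" unfolding T_def using t by (auto intro!: sum_nonneg member_le_sum)
  define d where "d N = (\<Sum>k<m. \<bar>a k\<bar>) * \<bar>cH H\<bar> * C * (real N powr (- H) * (real N * T + 1) powr h)" for N
  have "(\<lambda>N. real N powr (- H) * (real N * T + 1) powr h) \<longlonglongrightarrow> 0"
  proof (cases "T = 0")
    case True thus ?thesis using H by simp real_asymp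
  next
    case False hence "T > 0" using T by simp
    thus ?thesis using h by real_asymp
  qed
  hence d: "d \<longlonglongrightarrow> 0" unfolding d_def by (rule tendsto_mult_right_zero)
  have bound: "cmod ((CLINT x|M N. iexp (\<Sum>k<m. a k * grid (w N) H N (n N k) x)) - complex_of_real (exp (- s N / 2))) \<le> (d N)\<^sup>2 * s N" if N: "N \<ge> 1" for N
  proof -
    interpret rademacher "M N" "w N" using R[OF N] .
    have N0: "N > 0" using N by simp
    show ?thesis
    proof (rule series_limit_char)
      show "series_limit (\<lambda>i. \<Sum>k<m. a k * (scaling H N * kernel H (n N k) i)) (\<lambda>x. \<Sum>k<m. a k * grid (w N) H N (n N k) x)"
        by (intro series_limit_sum series_limit_grid H N0) auto
      show "((\<lambda>i. (\<Sum>k<m. a k * (scaling H N * kernel H (n N k) i))\<^sup>2) has_sum s N) UNIV"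
        unfolding s_def by (rule combination_has_sum[OF H]) simp
      fix i
      have "\<bar>\<Sum>k<m. a k * (scaling H N * kernel H (n N k) i)\<bar> \<le> (\<Sum>k<m. \<bar>a k * (scaling H N * kernel H (n N k) i)\<bar>)" by (rule sum_abs)
      also have "\<dots> \<le> (\<Sum>k<m. \<bar>a k\<bar> * (\<bar>cH H\<bar> * real N powr (- H) * (C * (real N * T + 1) powr h)))"
      proof (rule sum_mono)
        fix k assume k: "k \<in> {..<m}"
        have "real (n N k) \<le> real N * t k" unfolding n_def using t[of k] by simp
        also have "\<dots> \<le> real N * T" using T(2)[of k] k by (intro mult_left_mono) auto
        finally have "(real (n N k) + 1) powr h \<le> (real N * T + 1) powr h" using h by (intro powr_mono2) auto
        hence "\<bar>kernel H (n N k) i\<bar> \<le> C * (real N * T + 1) powr h"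
          using C(2)[of "n N k" i] C(1) unfolding h_def by (meson mult_left_mono order_trans less_imp_le)
        thus "\<bar>a k * (scaling H N * kernel H (n N k) i)\<bar> \<le> \<bar>a k\<bar> * (\<bar>cH H\<bar> * real N powr (- H) * (C * (real N * T + 1) powr h))"
          unfolding abs_mult scaling_def by (intro mult_left_mono mult_mono) auto
      qed
      also have "\<dots> = d N" unfolding d_def sum_distrib_right[symmetric] by (simp add: mult_ac)
      finally show "\<bar>\<Sum>k<m. a k * (scaling H N * kernel H (n N k) i)\<bar> \<le> d N" .
    qed
  qed
  have "(\<lambda>N. (CLINT x|M N. iexp (\<Sum>k<m. a k * grid (w N) H N (n N k) x)) - complex_of_real (exp (- s N / 2))) \<longlonglongrightarrow> 0"
  proof (rule Lim_null_comparison)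
    show "\<forall>\<^sub>F N in sequentially. norm ((CLINT x|M N. iexp (\<Sum>k<m. a k * grid (w N) H N (n N k) x)) - complex_of_real (exp (- s N / 2))) \<le> (d N)\<^sup>2 * s N"
      using eventually_ge_at_top[of 1] by eventually_elim (rule bound)
    have "(\<lambda>N. (d N)\<^sup>2 * s N) \<longlonglongrightarrow> 0\<^sup>2 * S" by (intro tendsto_intros d s)
    thus "(\<lambda>N. (d N)\<^sup>2 * s N) \<longlonglongrightarrow> 0" by simp
  qed
  moreover have "(\<lambda>N. complex_of_real (exp (- s N / 2))) \<longlonglongrightarrow> complex_of_real (exp (- S / 2))"
    by (intro tendsto_intros s) auto
  ultimately have "(\<lambda>N. (CLINT x|M N. iexp (\<Sum>k<m. a k * grid (w N) H N (n N k) x)) - complex_of_real (exp (- s N / 2)) + complex_of_real (exp (- s N / 2))) \<longlonglongrightarrow> 0 + complex_of_real (exp (- S / 2))"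
    by (rule tendsto_add)
  thus ?thesis by (simp add: n_def S_def)
qed

section \<open>Oscillation on short time intervals\<close>

text \<open>Every \<open>k < 2 ^ L\<close> is reached from \<open>0\<close> by at most one dyadic step of each length \<open>2 ^ l\<close> with \<open>l < L\<close>,
  taken in decreasing order of length.\<close>
lemma dyadic_chaining:
  fixes S e :: "nat \<Rightarrow> real"
  assumes "\<And>l i. l < L \<Longrightarrow> i < 2 ^ (L - l) \<Longrightarrow> \<bar>S (a + Suc i * 2 ^ l) - S (a + i * 2 ^ l)\<bar> \<le> e l"
    and "\<And>l. 0 \<le> e l" and "k < 2 ^ L"
  shows "\<bar>S (a + k) - S a\<bar> \<le> (\<Sum>l<L. e l)"
  using assms
proof (induction L arbitrary: a k)
  case (Suc L)
  have sub: "i < (2::nat) ^ (Suc L - l)" if "i < 2 ^ (L - l)" for i l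
    using that by (rule less_le_trans) (intro power_increasing, auto)
  show ?case
  proof (cases "k < 2 ^ L")
    case True
    have "\<bar>S (a + k) - S a\<bar> \<le> (\<Sum>l<L. e l)"
      by (rule Suc.IH[OF _ Suc.prems(2) True]) (use Suc.prems(1) sub in auto)
    thus ?thesis using Suc.prems(2)[of L] by simp
  next
    case False
    define k' where "k' = k - 2 ^ L"
    have k': "k = 2 ^ L + k'" "k' < 2 ^ L" using False Suc.prems(3) by (auto simp: k'_def)
    have "\<bar>S (a + 2 ^ L + k') - S (a + 2 ^ L)\<bar> \<le> (\<Sum>l<L. e l)"
    proof (rule Suc.IH[OF _ Suc.prems(2) k'(2)])
      fix l i assume l: "l < L" and i: "i < (2::nat) ^ (L - l)"
      have p: "(2::nat) ^ L = 2 ^ (L - l) * 2 ^ l" using l by (simp flip: power_add)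
      have "(2::nat) ^ (Suc L - l) = 2 ^ (L - l) + 2 ^ (L - l)" using l by (simp add: Suc_diff_le)
      hence "i + 2 ^ (L - l) < 2 ^ (Suc L - l)" using i by simp
      from Suc.prems(1)[OF _ this] l show "\<bar>S (a + 2 ^ L + Suc i * 2 ^ l) - S (a + 2 ^ L + i * 2 ^ l)\<bar> \<le> e l"
        unfolding p by (simp add: algebra_simps)
    qed
    moreover have "\<bar>S (a + 2 ^ L) - S a\<bar> \<le> e L" using Suc.prems(1)[of L 0] by simp
    ultimately show ?thesis unfolding k'(1) by (simp add: add.assoc)
  qed
qed simp

text \<open>Outside an event of probability at most \<open>\<eta>\<close>, the path on \<open>[0, T]\<close> stays within \<open>\<epsilon>\<close> of the step path that
  interpolates its values at the multiples of \<open>1/m\<close>. The exceptional event is an explicit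
  measurable set, as the supremum over \<open>t\<close> is uncountable.\<close>
abbreviation small_oscillation ::
  "'a measure \<Rightarrow> (nat \<Rightarrow> 'a \<Rightarrow> real) \<Rightarrow> nat \<Rightarrow> nat \<Rightarrow> nat \<Rightarrow> real \<Rightarrow> real \<Rightarrow> bool" where
  "small_oscillation M A N m T \<epsilon> \<eta> \<equiv> \<exists>B\<in>sets M. measure M B \<le> \<eta> \<and>
     (\<forall>x\<in>space M - B. \<forall>t\<in>{0..real T}.
        \<bar>A (cell N t) x - A (cell N (real (cell m t) / real m)) x\<bar> \<le> \<epsilon>)"

context rademacher begin

text \<open>Markov's inequality for the moment of order \<open>2p\<close>; the increment has the variance of the process
  itself at the difference of the times.\<close>
lemma grid_increment_tail:
  assumes H: "0 < H" "H < 1" and N: "N > 0" and p: "p > 0" and e: "e > 0" and mn: "m \<le> n"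
    and C: "\<And>n. kernel_var H n \<le> C * real n powr (2 * H)"
  shows "prob {x \<in> space M. \<bar>grid \<omega> H N n x - grid \<omega> H N m x\<bar> > e}
    \<le> moment_const p * ((cH H)\<^sup>2 * C) ^ p * (real (n - m) / real N) powr (2 * H * real p) / e ^ (2 * p)"
proof -
  have lim: "series_limit (\<lambda>i. scaling H N * kernel H (n - m) (i - int m)) (\<lambda>x. grid \<omega> H N n x - grid \<omega> H N m x)"
    unfolding series_limit_def
  proof
    show "AE x in M. (\<lambda>I. \<Sum>i = - int I..int I. scaling H N * kernel H (n - m) (i - int m) * \<omega> i x) \<longlonglongrightarrow> grid \<omega> H N n x - grid \<omega> H N m x"
      using series_limit_grid[OF H(2) N, of n, unfolded series_limit_def, THEN conjunct2]
        series_limit_grid[OF H(2) N, of m, unfolded series_limit_def, THEN conjunct2]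
    proof eventually_elim
      case (elim x)
      have k: "kernel H (n - m) (i - int m) = kernel H n i - kernel H m i" for i
        using kernel_add[of H m "n - m" i] mn by simp
      show ?case using tendsto_diff[OF elim] unfolding k by (simp add: algebra_simps flip: sum_subtractf)
    qed
  qed measurable
  have sum: "((\<lambda>i. (scaling H N * kernel H (n - m) (i - int m))\<^sup>2) has_sum (scaling H N)\<^sup>2 * kernel_var H (n - m)) UNIV"
    unfolding power_mult_distrib by (intro has_sum_cmult_right kernel_shift_has_sum H)
  let ?r = "real (n - m) / real N"
  have pow: "(z powr u) ^ p = z powr (u * real p)" if "z \<ge> 0" for z u :: real
    using p that by (cases "z = 0") (auto simp: power_0_left powr_powr simp flip: powr_realpow)
  have "((scaling H N)\<^sup>2 * kernel_var H (n - m)) ^ p \<le> ((cH H)\<^sup>2 * C * ?r powr (2 * H)) ^ p"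
    using kernel_var_nonneg by (intro power_mono scaled_var_le H N C) auto
  also have "\<dots> = ((cH H)\<^sup>2 * C) ^ p * ?r powr (2 * H * real p)"
    unfolding power_mult_distrib by (subst pow) auto
  finally have "moment_const p * ((scaling H N)\<^sup>2 * kernel_var H (n - m)) ^ p \<le> moment_const p * (((cH H)\<^sup>2 * C) ^ p * ?r powr (2 * H * real p))"
    using moment_const_pos[of p] by (intro mult_left_mono) auto
  hence "moment_const p * ((scaling H N)\<^sup>2 * kernel_var H (n - m)) ^ p / e ^ (2 * p) \<le> moment_const p * (((cH H)\<^sup>2 * C) ^ p * ?r powr (2 * H * real p)) / e ^ (2 * p)"
    using e by (intro divide_right_mono) auto
  thus ?thesis using series_limit_tail[OF lim sum p e] by (simp add: mult.assoc)
qed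

text \<open>There are \<open>2 ^ (L - l)\<close> dyadic increments of length \<open>2 ^ l\<close>, each of which exceeds its share of \<open>\<epsilon>\<close>
  with a probability of order \<open>(2 ^ l / N) powr (2 * H * p)\<close>. With \<open>H * p \<ge> 2\<close> the sum of
  these probabilities over all levels is governed by the coarsest level.\<close>
lemma grid_oscillation_tail:
  assumes H: "0 < H" "H < 1" and N: "N > 0" and p: "H * real p \<ge> 2" and \<epsilon>: "\<epsilon> > 0"
    and C: "\<And>n. kernel_var H n \<le> C * real n powr (2 * H)" "C \<ge> 0"
  defines "K \<equiv> moment_const p * ((cH H)\<^sup>2 * C) ^ p / (1 - 2 powr (- H / 2)) ^ (2 * p)"
  shows "prob {x \<in> space M. \<exists>k<2 ^ L. \<bar>grid \<omega> H N (a + k) x - grid \<omega> H N a x\<bar> > \<epsilon>}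
    \<le> K * (2 ^ L / real N) powr (2 * H * real p) / \<epsilon> ^ (2 * p)"
proof -
  have p0: "p > 0" using p by (intro Nat.gr0I) auto
  define \<rho> :: real where "\<rho> = 2 powr (- H / 2)"
  define q where "q = 2 * H * real p"
  define r :: real where "r = 2 powr (- q / 2)"
  define K0 where "K0 = moment_const p * ((cH H)\<^sup>2 * C) ^ p"
  \<comment> \<open>The shares of \<open>\<epsilon>\<close> decay geometrically towards the fine levels, at half of the rate allowed by
    the exponent \<open>H\<close>; the other half makes the sum of the probabilities converge.\<close>
  define e where "e l = \<epsilon> * (1 - \<rho>) * \<rho> ^ (L - l)" for l
  have \<rho>: "0 < \<rho>" "\<rho> < 1" using H by (auto simp: \<rho>_def powr_less_one)
  have e: "e l > 0" for l using \<rho> \<epsilon> by (simp add: e_def)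
  have K0: "K0 \<ge> 0" using C(2) moment_const_pos[of p] by (simp add: K0_def less_imp_le)
  have geo: "(\<Sum>l<L. x ^ (L - l)) \<le> x / (1 - x)" if "0 \<le> x" "x < 1" for x :: real
  proof -
    have "(\<Sum>l<L. x ^ (L - l)) = (\<Sum>l<L. x * x ^ (L - Suc l))"
      by (intro sum.cong refl) (simp add: Suc_diff_Suc flip: power_Suc)
    also have "\<dots> = x * (\<Sum>l<L. x ^ l)"
      by (simp add: sum_distrib_left[symmetric] sum.nat_diff_reindex)
    also have "(\<Sum>l<L. x ^ l) \<le> 1 / (1 - x)"
      using that sum_le_suminf[of "\<lambda>l. x ^ l" "{..<L}"] by (simp add: suminf_geometric summable_geometric)
    finally show ?thesis using that by (simp add: mult_left_mono)
  qed
  have sum_e: "(\<Sum>l<L. e l) \<le> \<epsilon>"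
  proof -
    have "(\<Sum>l<L. e l) = \<epsilon> * (1 - \<rho>) * (\<Sum>l<L. \<rho> ^ (L - l))" by (simp add: e_def sum_distrib_left)
    also have "\<dots> \<le> \<epsilon> * (1 - \<rho>) * (\<rho> / (1 - \<rho>))" using \<rho> \<epsilon> by (intro mult_left_mono geo) auto
    also have "\<dots> \<le> \<epsilon>" using \<rho> \<epsilon> by simp
    finally show ?thesis .
  qed
  define E where "E l i = {x \<in> space M. \<bar>grid \<omega> H N (a + Suc i * 2 ^ l) x - grid \<omega> H N (a + i * 2 ^ l) x\<bar> > e l}" for l i :: nat
  have [measurable]: "E l i \<in> sets M" for l i unfolding E_def by measurable
  have "{x \<in> space M. \<exists>k<2 ^ L. \<bar>grid \<omega> H N (a + k) x - grid \<omega> H N a x\<bar> > \<epsilon>} \<subseteq> (\<Union>l\<in>{..<L}. \<Union>i\<in>{..<2 ^ (L - l)}. E l i)"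
  proof (rule subsetI, rule ccontr)
    fix x assume x: "x \<in> {x \<in> space M. \<exists>k<2 ^ L. \<bar>grid \<omega> H N (a + k) x - grid \<omega> H N a x\<bar> > \<epsilon>}"
      and nx: "x \<notin> (\<Union>l\<in>{..<L}. \<Union>i\<in>{..<2 ^ (L - l)}. E l i)"
    then obtain k where k: "k < 2 ^ L" "\<bar>grid \<omega> H N (a + k) x - grid \<omega> H N a x\<bar> > \<epsilon>" by auto
    have "\<bar>grid \<omega> H N (a + k) x - grid \<omega> H N a x\<bar> \<le> (\<Sum>l<L. e l)"
      by (rule dyadic_chaining[where S = "\<lambda>n. grid \<omega> H N n x", OF _ _ k(1)])
         (use nx x e in \<open>auto simp: E_def not_less less_imp_le\<close>)
    thus False using k(2) sum_e by simp
  qed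
  hence "prob {x \<in> space M. \<exists>k<2 ^ L. \<bar>grid \<omega> H N (a + k) x - grid \<omega> H N a x\<bar> > \<epsilon>} \<le> prob (\<Union>l\<in>{..<L}. \<Union>i\<in>{..<2 ^ (L - l)}. E l i)"
    by (intro finite_measure_mono) auto
  also have "\<dots> \<le> (\<Sum>l<L. prob (\<Union>i\<in>{..<2 ^ (L - l)}. E l i))"
    by (rule finite_measure_subadditive_finite) auto
  also have "\<dots> \<le> (\<Sum>l<L. \<Sum>i<2 ^ (L - l). prob (E l i))"
    by (intro sum_mono finite_measure_subadditive_finite) auto
  also have "\<dots> \<le> (\<Sum>l<L. \<Sum>i<(2::nat) ^ (L - l). K0 * (2 ^ l / real N) powr q / e l ^ (2 * p))"
  proof (intro sum_mono)
    fix l i :: nat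
    have "(a + Suc i * 2 ^ l) - (a + i * 2 ^ l) = 2 ^ l" by simp
    thus "prob (E l i) \<le> K0 * (2 ^ l / real N) powr q / e l ^ (2 * p)"
      using grid_increment_tail[OF H N p0 e[of l], of "a + i * 2 ^ l" "a + Suc i * 2 ^ l", OF _ C(1)]
      unfolding E_def K0_def q_def by simp
  qed
  also have "\<dots> \<le> (\<Sum>l<L. K * (2 ^ L / real N) powr q / \<epsilon> ^ (2 * p) * (1/2) ^ (L - l))"
  proof (intro sum_mono)
    fix l assume l: "l \<in> {..<L}"
    define j where "j = L - l"
    have "(2::real) ^ L = 2 ^ l * 2 ^ j" using l by (simp add: j_def flip: power_add)
    hence "2 ^ l / real N = (2 ^ L / real N) / 2 ^ j" by simp
    hence 1: "(2 ^ l / real N) powr q = (2 ^ L / real N) powr q / (2 ^ j) powr q"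
      by (simp only: powr_divide)
    have r2: "r * r = 2 powr (- q)" unfolding r_def powr_add[symmetric] by simp
    have "(2 ^ j) powr q = (2 powr q) ^ j" by (simp add: powr_powr mult.commute flip: powr_realpow)
    also have "2 powr q = 1 / (r * r)" unfolding r2 by (simp add: powr_minus_divide)
    finally have 2: "(2 ^ j) powr q = 1 / (r ^ j * r ^ j)" by (simp add: power_divide power_mult_distrib)
    have "\<rho> ^ (2 * p) = r" unfolding \<rho>_def r_def q_def by (simp add: powr_powr mult_ac flip: powr_realpow)
    moreover have "(\<rho> ^ j) ^ (2 * p) = (\<rho> ^ (2 * p)) ^ j" by (metis power_mult mult.commute)
    ultimately have 3: "e l ^ (2 * p) = \<epsilon> ^ (2 * p) * (1 - \<rho>) ^ (2 * p) * r ^ j"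
      unfolding e_def j_def[symmetric] by (simp only: power_mult_distrib)
    \<comment> \<open>Passing to the next finer level multiplies the level sum by \<open>2 * r \<le> 1/2\<close>.\<close>
    have r: "0 < r" "r \<le> 1/4"
    proof -
      have "r \<le> 2 powr (-2)" unfolding r_def q_def using p by (intro powr_mono) auto
      thus "r \<le> 1/4" by (simp add: powr_minus_divide)
    qed (simp add: r_def)
    have KK: "K = K0 / (1 - \<rho>) ^ (2 * p)" by (simp add: K_def K0_def \<rho>_def)
    have "(\<Sum>i<(2::nat) ^ (L - l). K0 * (2 ^ l / real N) powr q / e l ^ (2 * p)) = 2 ^ j * (K0 * (2 ^ l / real N) powr q / e l ^ (2 * p))"
      by (simp add: j_def)
    also have "\<dots> = K * (2 ^ L / real N) powr q / \<epsilon> ^ (2 * p) * (2 * r) ^ j"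
      unfolding 1 2 3 KK using r \<epsilon> \<rho> by (simp add: field_simps)
    also have "\<dots> \<le> K * (2 ^ L / real N) powr q / \<epsilon> ^ (2 * p) * (1/2) ^ j"
      using r K0 \<epsilon> \<rho> unfolding KK by (intro mult_left_mono power_mono) auto
    finally show "(\<Sum>i<(2::nat) ^ (L - l). K0 * (2 ^ l / real N) powr q / e l ^ (2 * p)) \<le> K * (2 ^ L / real N) powr q / \<epsilon> ^ (2 * p) * (1/2) ^ (L - l)"
      by (simp add: j_def)
  qed
  also have "\<dots> = K * (2 ^ L / real N) powr q / \<epsilon> ^ (2 * p) * (\<Sum>l<L. (1/2) ^ (L - l))" by (simp add: sum_distrib_left)
  also have "\<dots> \<le> K * (2 ^ L / real N) powr q / \<epsilon> ^ (2 * p) * 1"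
    using geo[of "1/2"] K0 \<epsilon> \<rho> by (intro mult_left_mono) (auto simp: K_def K0_def \<rho>_def)
  finally show ?thesis by (simp add: q_def)
qed

text \<open>A union bound over the \<open>m * T + 1\<close> blocks of length \<open>1/m\<close>. Each block has at most \<open>N / m + 1\<close> grid
  steps and is covered by a dyadic block of at most \<open>4 * N / m\<close> steps.\<close>
lemma grid_modulus:
  assumes H: "0 < H" "H < 1" and N: "m \<le> N" "m > 0" and p: "H * real p \<ge> 2" and \<epsilon>: "\<epsilon> > 0"
    and C: "\<And>n. kernel_var H n \<le> C * real n powr (2 * H)" "C \<ge> 0"
  defines "K \<equiv> moment_const p * ((cH H)\<^sup>2 * C) ^ p / (1 - 2 powr (- H / 2)) ^ (2 * p)"
  shows "small_oscillation M (grid \<omega> H N) N m T \<epsilon>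
    ((real (m * T) + 1) * (K * (4 / real m) powr (2 * H * real p) / \<epsilon> ^ (2 * p)))"
proof -
  have N0: "N > 0" using N by simp
  define y where "y = real N / real m + 1"
  have y: "1 \<le> y" "y \<le> 2 * real N / real m" using N by (auto simp: y_def field_simps)
  \<comment> \<open>The least dyadic length that covers a block exceeds the block by a factor of at most two.\<close>
  have "\<exists>L. y \<le> 2 ^ L" using real_arch_pow[of 2 y] by (auto intro: less_imp_le)
  define L where "L = (LEAST L. y \<le> 2 ^ L)"
  have L1: "y \<le> 2 ^ L" unfolding L_def by (rule LeastI_ex) fact
  have "2 ^ L \<le> 2 * y"
  proof (cases L)
    case 0 thus ?thesis using y by simp
  next
    case (Suc L')
    hence "\<not> y \<le> 2 ^ L'" using not_less_Least[of L' "\<lambda>L. y \<le> 2 ^ L"] by (simp add: L_def)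
    thus ?thesis using Suc by simp
  qed
  moreover have "y \<le> 2 * (real N / real m)" using y(2) by simp
  ultimately have "2 ^ L \<le> 4 * (real N / real m)" by linarith
  hence L2: "2 ^ L / real N \<le> 4 / real m" using N by (simp add: field_simps)
  define a where "a q = cell N (real q / real m)" for q
  define E where "E q = {x \<in> space M. \<exists>k<2 ^ L. \<bar>grid \<omega> H N (a q + k) x - grid \<omega> H N (a q) x\<bar> > \<epsilon>}" for q
  have [measurable]: "E q \<in> sets M" for q unfolding E_def by measurable
  define B where "B = (\<Union>q\<in>{..m * T}. E q)"
  have "K \<ge> 0" using C(2) moment_const_pos[of p] by (simp add: K_def less_imp_le)
  have "prob B \<le> (\<Sum>q\<in>{..m * T}. prob (E q))" unfolding B_def by (rule finite_measure_subadditive_finite) auto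
  also have "\<dots> \<le> (\<Sum>q\<in>{..m * T}. K * (4 / real m) powr (2 * H * real p) / \<epsilon> ^ (2 * p))"
  proof (rule sum_mono)
    fix q
    have "prob (E q) \<le> K * (2 ^ L / real N) powr (2 * H * real p) / \<epsilon> ^ (2 * p)"
      unfolding E_def K_def by (rule grid_oscillation_tail[OF H N0 p \<epsilon> C])
    also have "\<dots> \<le> K * (4 / real m) powr (2 * H * real p) / \<epsilon> ^ (2 * p)"
      using L2 \<open>K \<ge> 0\<close> \<epsilon> H by (intro divide_right_mono mult_left_mono powr_mono2) auto
    finally show "prob (E q) \<le> K * (4 / real m) powr (2 * H * real p) / \<epsilon> ^ (2 * p)" .
  qed
  also have "\<dots> = (real (m * T) + 1) * (K * (4 / real m) powr (2 * H * real p) / \<epsilon> ^ (2 * p))" by simp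
  finally have 1: "prob B \<le> (real (m * T) + 1) * (K * (4 / real m) powr (2 * H * real p) / \<epsilon> ^ (2 * p))" .
  have 2: "\<bar>grid \<omega> H N (cell N t) x - grid \<omega> H N (cell N (real (cell m t) / real m)) x\<bar> \<le> \<epsilon>"
    if x: "x \<in> space M - B" and t: "t \<in> {0..real T}" for x t
  proof -
    define q where "q = cell m t"
    have mt: "0 \<le> real m * t" "real m * t \<le> real (m * T)" using t by (auto intro: mult_left_mono)
    hence q: "real q \<le> real m * t" "real m * t < real q + 1" unfolding q_def by linarith+
    have "q \<le> m * T" using q(1) mt(2) by linarith
    hence nE: "x \<notin> E q" using x by (auto simp: B_def)
    have qt: "real q / real m \<le> t" "t < real q / real m + 1 / real m" using q N by (auto simp: field_simps)
    have u: "real N * (real q / real m) \<le> real N * t" using qt(1) by (rule mult_left_mono) simp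
    have "real N * t < real N * (real q / real m + 1 / real m)" using qt(2) N0 by (intro mult_strict_left_mono) auto
    hence v: "real N * t < real N * (real q / real m) + real N / real m" by (simp add: distrib_left)
    have u0: "0 \<le> real N * (real q / real m)" by simp
    define n where "n = cell N t"
    have an: "a q \<le> n" unfolding a_def n_def using u by (intro nat_mono floor_mono)
    have "real n \<le> real N * t" unfolding n_def using u u0 by linarith
    moreover have "real N * (real q / real m) < real (a q) + 1" unfolding a_def using u0 by linarith
    ultimately have "real n - real (a q) < y" using v unfolding y_def by linarith
    hence "real (n - a q) < 2 ^ L" using an L1 by (simp add: of_nat_diff)
    hence "real (n - a q) < real (2 ^ L)" by simp
    hence "n - a q < 2 ^ L" by (rule of_nat_less_imp_less)
    hence "\<not> \<bar>grid \<omega> H N (a q + (n - a q)) x - grid \<omega> H N (a q) x\<bar> > \<epsilon>" using nE x unfolding E_def by blast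
    thus ?thesis using an unfolding n_def a_def q_def by simp
  qed
  have "B \<in> sets M" unfolding B_def by measurable
  thus ?thesis using 1 2 by blast
qed

end

text \<open>The number of blocks grows linearly in \<open>m\<close>, while the bound for each of them decays with the exponent
  \<open>2 * H * p \<ge> 4\<close>.\<close>
lemma grid_modulus_uniform:
  fixes M :: "nat \<Rightarrow> 'a measure" and w :: "nat \<Rightarrow> int \<Rightarrow> 'a \<Rightarrow> real"
  assumes H: "0 < H" "H < 1" and R: "\<And>N. N \<ge> 1 \<Longrightarrow> rademacher (M N) (w N)"
    and \<epsilon>: "\<epsilon> > 0" "\<eta> > 0"
  shows "\<forall>\<^sub>F m in sequentially. \<forall>N\<ge>m. small_oscillation (M N) (grid (w N) H N) N m T \<epsilon> \<eta>"
proof -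
  obtain C where C: "C > 0" "\<And>n. kernel_var H n \<le> C * real n powr (2 * H)" using kernel_var_bound[OF H] by metis
  obtain p :: nat where p: "H * real p \<ge> 2"
  proof -
    obtain p :: nat where "real p > 2 / H" using reals_Archimedean2 by blast
    thus ?thesis using H by (intro that[of p]) (auto simp: field_simps)
  qed
  define K where "K = moment_const p * ((cH H)\<^sup>2 * C) ^ p / (1 - 2 powr (- H / 2)) ^ (2 * p)"
  define q where "q = 2 * H * real p"
  have q: "q \<ge> 4" using p by (simp add: q_def)
  have "(\<lambda>m. (real (m * T) + 1) * (K * (4 / real m) powr q / \<epsilon> ^ (2 * p))) \<longlonglongrightarrow> 0"
  proof -
    have "(\<lambda>m. real m * (4 / real m) powr q) \<longlonglongrightarrow> 0" "(\<lambda>m. (4 / real m) powr q) \<longlonglongrightarrow> 0"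
      using q by real_asymp+
    hence "(\<lambda>m. (K / \<epsilon> ^ (2 * p)) * (real T * (real m * (4 / real m) powr q) + (4 / real m) powr q)) \<longlonglongrightarrow> (K / \<epsilon> ^ (2 * p)) * (real T * 0 + 0)"
      by (intro tendsto_intros)
    thus ?thesis by (simp add: algebra_simps add_divide_distrib)
  qed
  hence "\<forall>\<^sub>F m in sequentially. (real (m * T) + 1) * (K * (4 / real m) powr q / \<epsilon> ^ (2 * p)) < \<eta>"
    using \<epsilon>(2) by (rule order_tendstoD)
  thus ?thesis using eventually_gt_at_top[of 0]
  proof eventually_elim
    case (elim m)
    show ?case
    proof (intro allI impI)
      fix N assume N: "m \<le> N"
      interpret rademacher "M N" "w N" using R[of N] N elim by simp
      from grid_modulus[OF H N elim(2) p \<epsilon>(1) C(2) less_imp_le[OF C(1)], of T, folded K_def q_def] elim(1)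
      show "small_oscillation (M N) (grid (w N) H N) N m T \<epsilon> \<eta>"
        by (meson less_imp_le order_trans)
    qed
  qed
qed

section \<open>From characteristic functions to expectations\<close>

text \<open>Real trigonometric sums with arbitrary frequencies. The phase \<open>\<theta>\<close> includes the sines and makes the
  family closed under products.\<close>
inductive_set trig_sums :: "((nat \<Rightarrow> real) \<Rightarrow> real) set" where
  trig: "(\<lambda>x. c * cos ((\<Sum>k<n. a k * x k) + \<theta>)) \<in> trig_sums"
| add: "f \<in> trig_sums \<Longrightarrow> g \<in> trig_sums \<Longrightarrow> (\<lambda>x. f x + g x) \<in> trig_sums"

lemma trig_sums_const: "(\<lambda>_. c) \<in> trig_sums"
  using trig_sums.trig[where c = c and n = 0 and \<theta> = 0] by simp

lemma trig_sums_sin: "(\<lambda>x. sin (b * x k)) \<in> trig_sums"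
proof -
  have S: "(\<Sum>i<Suc k. (if i = k then b else 0) * x i) = b * x k" for x :: "nat \<Rightarrow> real"
    by simp
  have "(\<lambda>x. sin (b * x k)) = (\<lambda>x. 1 * cos ((\<Sum>i<Suc k. (if i = k then b else 0) * x i) + (- (pi / 2))))"
    unfolding S by (rule ext) (subst cos_add, simp)
  thus ?thesis by (simp only:) (rule trig_sums.trig)
qed

lemma sum_pad:
  fixes x :: "nat \<Rightarrow> real" assumes "n \<le> m"
  shows "(\<Sum>k<n. a k * x k) = (\<Sum>k<m. (if k < n then a k else 0) * x k)"
  by (rule sum.mono_neutral_cong_left) (use assms in auto)

lemma trig_sums_mult:
  assumes "f \<in> trig_sums" "g \<in> trig_sums"
  shows "(\<lambda>x. f x * g x) \<in> trig_sums"
  using assms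
proof (induction f rule: trig_sums.induct)
  case (trig c a n \<theta>)
  from trig.prems show ?case
  proof (induction g rule: trig_sums.induct)
    case (trig c' a' n' \<theta>')
    define m where "m = max n n'"
    define A where "A k = (if k < n then a k else 0)" for k
    define A' where "A' k = (if k < n' then a' k else 0)" for k
    have s: "(\<Sum>k<n. a k * x k) = (\<Sum>k<m. A k * x k)" "(\<Sum>k<n'. a' k * x k) = (\<Sum>k<m. A' k * x k)" for x
      unfolding A_def A'_def m_def by (rule sum_pad; simp)+
    have "(\<lambda>x. c * cos ((\<Sum>k<n. a k * x k) + \<theta>) * (c' * cos ((\<Sum>k<n'. a' k * x k) + \<theta>'))) =
      (\<lambda>x. (c * c' / 2) * cos ((\<Sum>k<m. (A k - A' k) * x k) + (\<theta> - \<theta>')) + (c * c' / 2) * cos ((\<Sum>k<m. (A k + A' k) * x k) + (\<theta> + \<theta>')))"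
    proof
      fix x
      define u v where "u = (\<Sum>k<m. A k * x k) + \<theta>" and "v = (\<Sum>k<m. A' k * x k) + \<theta>'"
      have D: "(\<Sum>k<m. (A k - A' k) * x k) + (\<theta> - \<theta>') = u - v" "(\<Sum>k<m. (A k + A' k) * x k) + (\<theta> + \<theta>') = u + v"
        by (simp_all add: u_def v_def algebra_simps sum_subtractf sum.distrib)
      show "c * cos ((\<Sum>k<n. a k * x k) + \<theta>) * (c' * cos ((\<Sum>k<n'. a' k * x k) + \<theta>')) =
        (c * c' / 2) * cos ((\<Sum>k<m. (A k - A' k) * x k) + (\<theta> - \<theta>')) + (c * c' / 2) * cos ((\<Sum>k<m. (A k + A' k) * x k) + (\<theta> + \<theta>'))"
        unfolding s u_def[symmetric] v_def[symmetric] D cos_add cos_diff by (simp add: algebra_simps)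
    qed
    thus ?case by (simp only:) (intro trig_sums.add trig_sums.trig)
  next
    case (add f' g')
    from trig_sums.add[OF add.IH] show ?case by (simp add: algebra_simps)
  qed
next
  case (add f' g')
  from trig_sums.add[OF add.IH(1,2)] add.prems show ?case by (simp add: algebra_simps)
qed

lemma trig_sums_measurable:
  assumes "f \<in> trig_sums" and [measurable]: "\<And>k. U k \<in> borel_measurable M"
  shows "(\<lambda>x. f (\<lambda>k. U k x)) \<in> borel_measurable M"
  using assms(1) by induction measurable

lemma trig_sums_bounded:
  assumes "f \<in> trig_sums" shows "\<exists>C. \<forall>x. \<bar>f x\<bar> \<le> C"
  using assms
proof induction
  case (trig c a n \<theta>)
  have "\<bar>c * cos y\<bar> \<le> \<bar>c\<bar>" for y by (simp add: abs_mult mult_left_le)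
  thus ?case by blast
next
  case (add f g)
  then obtain C D where "\<And>x. \<bar>f x\<bar> \<le> C" "\<And>x. \<bar>g x\<bar> \<le> D" by blast
  hence "\<bar>f x + g x\<bar> \<le> C + D" for x using abs_triangle_ineq[of "f x" "g x"] by (meson add_mono order_trans)
  thus ?case by blast
qed

lemma (in prob_space) integrable_iexp_real:
  assumes "X \<in> borel_measurable M" shows "integrable M (\<lambda>x. iexp (X x))"
  using integrable_iexp[of "\<lambda>x. complex_of_real (X x)"] assms by simp

lemma (in prob_space) expectation_cos_shift:
  assumes [measurable]: "X \<in> borel_measurable M"
  shows "expectation (\<lambda>x. c * cos (X x + \<theta>)) = c * Re (iexp \<theta> * (CLINT x|M. iexp (X x)))"
proof -
  have E: "cos (X x + \<theta>) = Re (iexp \<theta> * iexp (X x))" for x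
    by (simp only: exp_add[symmetric]) (simp add: Re_exp add.commute)
  have "expectation (\<lambda>x. c * cos (X x + \<theta>)) = c * expectation (\<lambda>x. Re (iexp \<theta> * iexp (X x)))" unfolding E by simp
  also have "expectation (\<lambda>x. Re (iexp \<theta> * iexp (X x))) = Re (CLINT x|M. iexp \<theta> * iexp (X x))"
    by (rule integral_Re) (simp add: integrable_iexp_real)
  finally show ?thesis by simp
qed

lemma trig_sums_tendsto:
  fixes M :: "nat \<Rightarrow> 'a measure" and P :: "'b measure"
  assumes prob: "\<And>N. N \<ge> 1 \<Longrightarrow> prob_space (M N)" "prob_space P"
    and U: "\<And>N k. N \<ge> 1 \<Longrightarrow> U N k \<in> borel_measurable (M N)" and V: "\<And>k. V k \<in> borel_measurable P"
    and char: "\<And>n a. (\<lambda>N. CLINT x|M N. iexp (\<Sum>k<n. a k * U N k x)) \<longlonglongrightarrow> (CLINT x|P. iexp (\<Sum>k<n. a k * V k x))"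
    and f: "f \<in> trig_sums"
  shows "(\<lambda>N. (LINT x|M N. f (\<lambda>k. U N k x))) \<longlonglongrightarrow> (LINT x|P. f (\<lambda>k. V k x))"
  using f
proof induction
  case (trig c a n \<theta>)
  interpret P: prob_space P by fact
  note [measurable] = V
  have "(\<lambda>N. c * Re (iexp \<theta> * (CLINT x|M N. iexp (\<Sum>k<n. a k * U N k x)))) \<longlonglongrightarrow> c * Re (iexp \<theta> * (CLINT x|P. iexp (\<Sum>k<n. a k * V k x)))"
    by (intro tendsto_intros char)
  moreover have "\<forall>\<^sub>F N in sequentially. c * Re (iexp \<theta> * (CLINT x|M N. iexp (\<Sum>k<n. a k * U N k x))) = (LINT x|M N. c * cos ((\<Sum>k<n. a k * U N k x) + \<theta>))"
    using eventually_ge_at_top[of 1]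
  proof eventually_elim
    case (elim N)
    interpret prob_space "M N" using prob elim by simp
    have [measurable]: "U N k \<in> borel_measurable (M N)" for k using U elim by simp
    show ?case by (subst expectation_cos_shift) simp_all
  qed
  moreover have "c * Re (iexp \<theta> * (CLINT x|P. iexp (\<Sum>k<n. a k * V k x))) = (LINT x|P. c * cos ((\<Sum>k<n. a k * V k x) + \<theta>))"
    by (subst P.expectation_cos_shift) simp_all
  ultimately show ?case by (auto intro: Lim_transform_eventually)
next
  case (add f g)
  have int: "integrable Q (\<lambda>x. h (\<lambda>k. W k x))" if "prob_space Q" and W: "\<And>k. W k \<in> borel_measurable Q" and h: "h \<in> trig_sums"
    for Q :: "'z measure" and W h
  proof -
    interpret prob_space Q by fact
    obtain C where "\<And>x. \<bar>h x\<bar> \<le> C" using trig_sums_bounded[OF h] by blast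
    thus ?thesis by (intro integrable_const_bound[where B = C, OF _ trig_sums_measurable[OF h W]]) auto
  qed
  have "\<forall>\<^sub>F N in sequentially. (LINT x|M N. f (\<lambda>k. U N k x)) + (LINT x|M N. g (\<lambda>k. U N k x)) = (LINT x|M N. f (\<lambda>k. U N k x) + g (\<lambda>k. U N k x))"
    using eventually_ge_at_top[of 1]
    by eventually_elim (rule Bochner_Integration.integral_add[symmetric, OF int int]; (rule prob U add.hyps; assumption?))
  moreover have "(LINT x|P. f (\<lambda>k. V k x)) + (LINT x|P. g (\<lambda>k. V k x)) = (LINT x|P. f (\<lambda>k. V k x) + g (\<lambda>k. V k x))"
    by (rule Bochner_Integration.integral_add[symmetric, OF int[OF prob(2) V add.hyps(1)] int[OF prob(2) V add.hyps(2)]])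
  ultimately show ?case using Lim_transform_eventually[OF tendsto_add[OF add.IH]] by simp
qed

text \<open>Splits an expectation over a good and an exceptional event.\<close>
lemma (in prob_space) expectation_diff_bound:
  assumes int: "integrable M f" "integrable M g" and B: "B \<in> sets M"
    and off: "\<And>x. x \<in> space M - B \<Longrightarrow> \<bar>f x - g x\<bar> \<le> e" and all: "\<And>x. x \<in> space M \<Longrightarrow> \<bar>f x - g x\<bar> \<le> C" and "e \<ge> 0"
  shows "\<bar>expectation f - expectation g\<bar> \<le> e + C * prob B"
proof -
  have C: "C \<ge> 0" using all not_empty by (meson abs_ge_zero order_trans ex_in_conv)
  have "\<bar>expectation f - expectation g\<bar> = \<bar>expectation (\<lambda>x. f x - g x)\<bar>" using int by simp
  also have "\<dots> \<le> expectation (\<lambda>x. \<bar>f x - g x\<bar>)" by (rule integral_abs_bound)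
  also have "\<dots> \<le> expectation (\<lambda>x. e + C * indicator B x)"
  proof (rule integral_mono)
    show "integrable M (\<lambda>x. \<bar>f x - g x\<bar>)" using int by simp
    show "integrable M (\<lambda>x. e + C * indicator B x)" using B by (intro Bochner_Integration.integrable_add integrable_mult_right integrable_real_indicator) (auto simp: less_top[symmetric])
    fix x assume "x \<in> space M"
    thus "\<bar>f x - g x\<bar> \<le> e + C * indicator B x" using off[of x] all[of x] \<open>e \<ge> 0\<close> by (cases "x \<in> B") auto
  qed
  also have "\<dots> = e + C * prob B"
    using B by (subst Bochner_Integration.integral_add) (auto simp: less_top[symmetric] prob_space intro!: integrable_mult_right integrable_real_indicator)
  finally show ?thesis .
qed

lemma (in prob_space) tail_small:
  assumes [measurable]: "X \<in> borel_measurable M" and "\<epsilon> > 0"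
  shows "\<exists>L::real. prob {x \<in> space M. \<bar>X x\<bar> > L} \<le> \<epsilon>"
proof -
  define A where "A n = {x \<in> space M. \<bar>X x\<bar> > real n}" for n
  have "decseq A" unfolding A_def decseq_def by (auto intro: le_less_trans[rotated])
  moreover have "range A \<subseteq> sets M" unfolding A_def by auto
  ultimately have "(\<lambda>n. prob (A n)) \<longlonglongrightarrow> prob (\<Inter>n. A n)" by (intro finite_Lim_measure_decseq)
  moreover have "(\<Inter>n. A n) = {}"
  proof -
    have "x \<notin> (\<Inter>n. A n)" for x
    proof -
      obtain n where "\<bar>X x\<bar> \<le> real n" using real_arch_simple by blast
      thus ?thesis unfolding A_def by (auto simp: not_less)
    qed
    thus ?thesis by blast
  qed
  ultimately have "(\<lambda>n. prob (A n)) \<longlonglongrightarrow> 0" by simp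
  from order_tendstoD(2)[OF this assms(2)] obtain n where "prob (A n) < \<epsilon>"
    unfolding eventually_sequentially by blast
  thus ?thesis unfolding A_def by (intro exI[of _ "real n"]) simp
qed

definition unit_cube :: "(nat \<Rightarrow> real) set" where "unit_cube = (UNIV \<rightarrow>\<^sub>E {-1..1})"

text \<open>The family of trigonometric sums is not dense for uniform convergence on the whole space, and an approximation
  on a cube only may be large elsewhere. The remedy is to approximate \<open>F (sin (b * x))\<close>, where
  \<open>F z = f (arcsin z / b)\<close> is defined on the unit cube: it agrees with \<open>f\<close> for
  \<open>\<bar>x k\<bar> \<le> L\<close>, and an approximation of \<open>F\<close> on the compact unit cube is an approximation for all \<open>x\<close>.\<close>
lemma trig_approximation:
  fixes f :: "(nat \<Rightarrow> real) \<Rightarrow> real"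
  assumes f: "continuous_on UNIV f" and dep: "\<And>x y. (\<And>k. k < n \<Longrightarrow> x k = y k) \<Longrightarrow> f x = f y"
    and L: "L > 0" and e: "e > 0" and bd: "\<And>x. \<bar>f x\<bar> \<le> C"
  obtains g where "g \<in> trig_sums" "\<And>x. (\<And>k. k < n \<Longrightarrow> \<bar>x k\<bar> \<le> L) \<Longrightarrow> \<bar>f x - g x\<bar> < e" "\<And>x. \<bar>g x\<bar> \<le> C + e"
proof -
  \<comment> \<open>With this frequency \<open>arcsin (sin (b * v)) = b * v\<close> exactly for \<open>\<bar>v\<bar> \<le> L\<close>.\<close>
  define b where "b = pi / (2 * L)"
  have b: "b > 0" using L by (simp add: b_def)
  define s where "s x = (\<lambda>k::nat. sin (b * x k))" for x :: "nat \<Rightarrow> real"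
  define R where "R = {F. continuous_on unit_cube F \<and> (\<lambda>x. F (s x)) \<in> trig_sums}"
  have s_cube: "s x \<in> unit_cube" for x by (auto simp: s_def unit_cube_def)
  interpret function_ring_on R unit_cube
  proof
    have "compactin (product_topology (\<lambda>_::nat. euclideanreal) UNIV) (UNIV \<rightarrow>\<^sub>E {-1..1})"
      unfolding compactin_PiE by (auto simp: compactin_euclidean_iff)
    thus "compact unit_cube" unfolding unit_cube_def euclidean_product_topology compactin_euclidean_iff .
    show "continuous_on unit_cube f" if "f \<in> R" for f using that by (simp add: R_def)
    show "(\<lambda>x. f x + g x) \<in> R" if "f \<in> R" "g \<in> R" for f g
      using that by (auto simp: R_def intro: continuous_on_add trig_sums.add)
    show "(\<lambda>x. f x * g x) \<in> R" if "f \<in> R" "g \<in> R" for f g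
      using that by (auto simp: R_def intro: continuous_on_mult trig_sums_mult)
    show "(\<lambda>_. c) \<in> R" for c by (auto simp: R_def trig_sums_const)
    show "\<exists>f\<in>R. f x \<noteq> f y" if "x \<noteq> y" for x y
    proof -
      obtain k where k: "x k \<noteq> y k" using \<open>x \<noteq> y\<close> by (auto simp: fun_eq_iff)
      have "continuous_on unit_cube (\<lambda>z::nat \<Rightarrow> real. z k)"
        by (rule continuous_on_subset[OF continuous_on_product_coordinates]) auto
      hence "(\<lambda>z. z k) \<in> R" by (auto simp: R_def s_def trig_sums_sin)
      from bexI[where P = "\<lambda>f. f x \<noteq> f y", OF k this] show ?thesis .
    qed
  qed
  define F where "F = (\<lambda>z::nat \<Rightarrow> real. f (\<lambda>k. arcsin (z k) / b))"
  have "continuous_on unit_cube F" unfolding F_def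
  proof (rule continuous_on_compose2[OF f])
    show "continuous_on unit_cube (\<lambda>z k. arcsin (z k) / b)"
    proof (intro continuous_on_coordinatewise_then_product continuous_on_divide continuous_on_const)
      fix k
      show "continuous_on unit_cube (\<lambda>z. arcsin (z k))"
      proof (rule continuous_on_compose2[OF continuous_on_arcsin'])
        show "continuous_on unit_cube (\<lambda>z::nat \<Rightarrow> real. z k)"
          by (rule continuous_on_subset[OF continuous_on_product_coordinates]) auto
      qed (auto simp: unit_cube_def PiE_iff)
    qed (use b in auto)
  qed auto
  from Stone_Weierstrass_basic[OF this e] obtain G where G: "G \<in> R" "\<And>z. z \<in> unit_cube \<Longrightarrow> \<bar>F z - G z\<bar> < e" by blast
  show ?thesis
  proof (rule that[of "\<lambda>x. G (s x)"])
    show "(\<lambda>x. G (s x)) \<in> trig_sums" using G(1) by (simp add: R_def)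
    fix x :: "nat \<Rightarrow> real"
    show "\<bar>G (s x)\<bar> \<le> C + e" using G(2)[OF s_cube, of x] bd[of "\<lambda>k. arcsin (s x k) / b"] unfolding F_def by linarith
    assume x: "\<And>k. k < n \<Longrightarrow> \<bar>x k\<bar> \<le> L"
    have "F (s x) = f x" unfolding F_def
    proof (rule dep)
      fix k assume "k < n"
      hence "\<bar>b * x k\<bar> \<le> b * L" using x[of k] b by (simp add: abs_mult)
      also have "b * L = pi / 2" using L by (simp add: b_def)
      finally have "arcsin (sin (b * x k)) = b * x k" by (intro arcsin_sin) auto
      thus "arcsin (s x k) / b = x k" using b by (simp add: s_def)
    qed
    thus "\<bar>f x - G (s x)\<bar> < e" using G(2)[OF s_cube, of x] by simp
  qed
qed

text \<open>The multivariate continuity theorem for characteristic functions, for sequences indexed by the natural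
  numbers and a functional \<open>f\<close> that depends on the first \<open>n\<close> entries only. Tightness confines all the
  variables to a cube on which \<open>f\<close> is uniformly close to a trigonometric sum, and for trigonometric
  sums the convergence is the hypothesis.\<close>
theorem char_tendsto_imp_expectation_tendsto:
  fixes M :: "nat \<Rightarrow> 'a measure" and P :: "'b measure" and f :: "(nat \<Rightarrow> real) \<Rightarrow> real"
  assumes prob: "\<And>N. N \<ge> 1 \<Longrightarrow> prob_space (M N)" "prob_space P"
    and U: "\<And>N k. N \<ge> 1 \<Longrightarrow> U N k \<in> borel_measurable (M N)" and V: "\<And>k. V k \<in> borel_measurable P"
    and char: "\<And>n a. (\<lambda>N. CLINT x|M N. iexp (\<Sum>k<n. a k * U N k x)) \<longlonglongrightarrow> (CLINT x|P. iexp (\<Sum>k<n. a k * V k x))"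
    and tight: "\<And>k \<epsilon>. \<epsilon> > 0 \<Longrightarrow> \<exists>L. \<forall>N\<ge>1. \<P>(x in M N. \<bar>U N k x\<bar> > L) \<le> \<epsilon>"
    and f: "continuous_on UNIV f" and dep: "\<And>x y. (\<And>k. k < n \<Longrightarrow> x k = y k) \<Longrightarrow> f x = f y"
    and bd: "\<And>x. \<bar>f x\<bar> \<le> C"
  shows "(\<lambda>N. (LINT x|M N. f (\<lambda>k. U N k x))) \<longlonglongrightarrow> (LINT x|P. f (\<lambda>k. V k x))"
proof (rule LIMSEQ_I)
  fix r :: real assume r: "r > 0"
  interpret P: prob_space P by fact
  have C: "C \<ge> 0" using bd[of undefined] by linarith
  define e where "e = min 1 (r / 8)"
  define \<delta> where "\<delta> = r / (8 * (2 * C + 1) * (real n + 1))"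
  have pos: "e > 0" "\<delta> > 0" "e \<le> r / 8" "e \<le> 1" using r C by (auto simp: e_def \<delta>_def)
  have "\<exists>L. (\<forall>N\<ge>1. \<P>(x in M N. \<bar>U N k x\<bar> > L) \<le> \<delta>) \<and> P.prob {x \<in> space P. \<bar>V k x\<bar> > L} \<le> \<delta>" for k
  proof -
    obtain L1 where L1: "\<And>N. N \<ge> 1 \<Longrightarrow> \<P>(x in M N. \<bar>U N k x\<bar> > L1) \<le> \<delta>" using tight[OF pos(2)] by blast
    obtain L2 where L2: "P.prob {x \<in> space P. \<bar>V k x\<bar> > L2} \<le> \<delta>" using P.tail_small[OF V pos(2)] by blast
    have "\<P>(x in M N. \<bar>U N k x\<bar> > max L1 L2) \<le> \<delta>" if N: "N \<ge> 1" for N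
    proof -
      interpret prob_space "M N" using prob N by simp
      have [measurable]: "U N k \<in> borel_measurable (M N)" using U N by simp
      have "prob {x \<in> space (M N). \<bar>U N k x\<bar> > max L1 L2} \<le> prob {x \<in> space (M N). \<bar>U N k x\<bar> > L1}"
        by (intro finite_measure_mono) auto
      thus ?thesis using L1[OF N] by linarith
    qed
    moreover note [measurable] = V
    have "P.prob {x \<in> space P. \<bar>V k x\<bar> > max L1 L2} \<le> P.prob {x \<in> space P. \<bar>V k x\<bar> > L2}"
      by (intro P.finite_measure_mono) auto
    ultimately show ?thesis using L2 by (intro exI[of _ "max L1 L2"]) auto
  qed
  then obtain Lk where Lk: "\<And>k N. N \<ge> 1 \<Longrightarrow> \<P>(x in M N. \<bar>U N k x\<bar> > Lk k) \<le> \<delta>"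
     "\<And>k. P.prob {x \<in> space P. \<bar>V k x\<bar> > Lk k} \<le> \<delta>" by metis
  define L where "L = 1 + (\<Sum>k<n. \<bar>Lk k\<bar>)"
  have L: "L > 0" "\<And>k. k < n \<Longrightarrow> Lk k \<le> L"
  proof -
    show "L > 0" unfolding L_def by (simp add: add_pos_nonneg sum_nonneg)
    fix k assume "k < n"
    hence "\<bar>Lk k\<bar> \<le> (\<Sum>k<n. \<bar>Lk k\<bar>)" by (intro member_le_sum) auto
    thus "Lk k \<le> L" unfolding L_def by linarith
  qed
  obtain g where g: "g \<in> trig_sums" "\<And>x. (\<And>k. k < n \<Longrightarrow> \<bar>x k\<bar> \<le> L) \<Longrightarrow> \<bar>f x - g x\<bar> < e" "\<And>x. \<bar>g x\<bar> \<le> C + e"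
    using trig_approximation[OF f dep L(1) pos(1) bd] by metis
  have fm: "f \<in> borel_measurable borel" using f by (rule borel_measurable_continuous_onI)
  have approx: "\<bar>(LINT x|Q. f (\<lambda>k. W k x)) - (LINT x|Q. g (\<lambda>k. W k x))\<bar> \<le> r / 4"
    if Q: "prob_space Q" and W: "\<And>k. W k \<in> borel_measurable Q"
      and tl: "\<And>k. measure Q {x \<in> space Q. \<bar>W k x\<bar> > Lk k} \<le> \<delta>" for Q :: "'z measure" and W
  proof -
    interpret prob_space Q by fact
    note [measurable] = W
    have f_meas: "(\<lambda>x. f (\<lambda>k. W k x)) \<in> borel_measurable Q"
      by (rule measurable_compose[OF _ fm]) (rule measurable_coordinatewise_then_product, measurable)
    define B where "B = (\<Union>k<n. {x \<in> space Q. \<bar>W k x\<bar> > Lk k})"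
    have B: "B \<in> sets Q" unfolding B_def by measurable
    have "prob B \<le> (\<Sum>k<n. prob {x \<in> space Q. \<bar>W k x\<bar> > Lk k})" unfolding B_def by (rule finite_measure_subadditive_finite) auto
    also have "\<dots> \<le> (\<Sum>k<n. \<delta>)" by (intro sum_mono tl)
    finally have pB: "prob B \<le> real n * \<delta>" by simp
    have "\<bar>(LINT x|Q. f (\<lambda>k. W k x)) - (LINT x|Q. g (\<lambda>k. W k x))\<bar> \<le> e + (2 * C + 1) * prob B"
    proof (rule expectation_diff_bound[OF _ _ B])
      show "integrable Q (\<lambda>x. f (\<lambda>k. W k x))" by (rule integrable_const_bound[where B = C, OF _ f_meas]) (use bd in auto)
      show "integrable Q (\<lambda>x. g (\<lambda>k. W k x))"
        by (rule integrable_const_bound[where B = "C + e", OF _ trig_sums_measurable[OF g(1) W]]) (use g(3) in auto)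
      fix x
      show "\<bar>f (\<lambda>k. W k x) - g (\<lambda>k. W k x)\<bar> \<le> 2 * C + 1"
        using bd[of "\<lambda>k. W k x"] g(3)[of "\<lambda>k. W k x"] pos(4) by linarith
      assume x: "x \<in> space Q - B"
      have "\<bar>f (\<lambda>k. W k x) - g (\<lambda>k. W k x)\<bar> < e"
      proof (rule g(2))
        fix k assume "k < n"
        thus "\<bar>W k x\<bar> \<le> L" using x L(2)[of k] unfolding B_def by force
      qed
      thus "\<bar>f (\<lambda>k. W k x) - g (\<lambda>k. W k x)\<bar> \<le> e" by simp
    qed (use pos in auto)
    also have "\<dots> \<le> r / 8 + (2 * C + 1) * (real n * \<delta>)" using pos pB C by (intro add_mono mult_left_mono) auto
    also have "(2 * C + 1) * (real n * \<delta>) \<le> (2 * C + 1) * ((real n + 1) * \<delta>)" using C pos by (intro mult_left_mono mult_right_mono) auto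
    also have "(2 * C + 1) * ((real n + 1) * \<delta>) = r / 8"
    proof -
      have cancel: "D * (r / (8 * D)) = r / 8" if "D > 0" for D using that by simp
      have "(2 * C + 1) * (real n + 1) > 0" using C by simp
      from cancel[OF this] show ?thesis by (simp only: \<delta>_def mult.assoc)
    qed
    finally show ?thesis by simp
  qed
  from LIMSEQ_D[OF trig_sums_tendsto[OF prob U V char g(1)], of "r / 4"] r
  obtain N0 where N0: "\<And>N. N \<ge> N0 \<Longrightarrow> \<bar>(LINT x|M N. g (\<lambda>k. U N k x)) - (LINT x|P. g (\<lambda>k. V k x))\<bar> < r / 4" by auto
  have "norm ((LINT x|M N. f (\<lambda>k. U N k x)) - (LINT x|P. f (\<lambda>k. V k x))) < r" if N: "N \<ge> max 1 N0" for N
  proof -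
    have N1: "N \<ge> 1" using N by simp
    have "\<bar>(LINT x|M N. f (\<lambda>k. U N k x)) - (LINT x|M N. g (\<lambda>k. U N k x))\<bar> \<le> r / 4"
      by (rule approx[OF prob(1)[OF N1] U[OF N1] Lk(1)[OF N1]])
    moreover have "\<bar>(LINT x|P. f (\<lambda>k. V k x)) - (LINT x|P. g (\<lambda>k. V k x))\<bar> \<le> r / 4"
      by (rule approx[OF prob(2) V Lk(2)])
    ultimately show ?thesis using N0[of N] N r unfolding real_norm_def by linarith
  qed
  thus "\<exists>no. \<forall>N\<ge>no. norm ((LINT x|M N. f (\<lambda>k. U N k x)) - (LINT x|P. f (\<lambda>k. V k x))) < r" by blast
qed

section \<open>Step paths and Lipschitz minorants\<close>

definition step_path :: "nat \<Rightarrow> (nat \<Rightarrow> real) \<Rightarrow> real \<Rightarrow> real" where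
  "step_path m a = restrict (\<lambda>t. a (cell m t)) {0..}"

lemma step_path_cadlag:
  assumes m: "m > 0"
  shows "step_path m a \<in> cadlag"
  unfolding cadlag_def
proof (intro CollectI conjI allI impI)
  show "step_path m a \<in> extensional {0..}" by (simp add: step_path_def)
next
  fix t :: real assume t: "0 \<le> t"
  define b where "b = (of_int \<lfloor>real m * t\<rfloor> + 1) / real m"
  have b: "t < b" unfolding b_def using m by (simp add: pos_less_divide_eq mult.commute)
  have "\<forall>\<^sub>F s in at_right t. step_path m a s = step_path m a t"
  proof (subst eventually_at_right_field, intro exI[of _ b] conjI b allI impI)
    fix s assume s: "t < s" "s < b"
    have "real m * s < of_int \<lfloor>real m * t\<rfloor> + 1" using s(2) m unfolding b_def by (simp add: pos_less_divide_eq mult.commute)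
    moreover have "of_int \<lfloor>real m * t\<rfloor> \<le> real m * s"
    proof -
      have "real m * t \<le> real m * s" using s m by simp
      thus ?thesis by linarith
    qed
    ultimately have "\<lfloor>real m * s\<rfloor> = \<lfloor>real m * t\<rfloor>" by (simp add: floor_eq_iff)
    thus "step_path m a s = step_path m a t" using s t by (simp add: step_path_def)
  qed
  thus "(step_path m a \<longlongrightarrow> step_path m a t) (at_right t)" by (rule tendsto_eventually)
next
  fix t :: real assume t: "0 < t"
  define c where "c = \<lceil>real m * t\<rceil> - 1"
  define b where "b = max 0 (of_int c / real m)"
  have "of_int c < real m * t" unfolding c_def by linarith
  hence b: "b < t" unfolding b_def using t m by (simp add: pos_divide_less_eq mult.commute)
  have "\<forall>\<^sub>F s in at_left t. step_path m a s = a (nat c)"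
  proof (subst eventually_at_left_field, intro exI[of _ b] conjI b allI impI)
    fix s assume s: "b < s" "s < t"
    have "of_int c / real m < s" using s(1) by (simp add: b_def)
    hence "of_int c < real m * s" using m by (simp add: pos_divide_less_eq mult.commute)
    moreover have "real m * s < real m * t" using s m by simp
    hence "real m * s < of_int c + 1" unfolding c_def by linarith
    ultimately have "\<lfloor>real m * s\<rfloor> = c" by (simp add: floor_eq_iff)
    thus "step_path m a s = a (nat c)" using s by (simp add: step_path_def b_def)
  qed
  thus "\<exists>l. (step_path m a \<longlongrightarrow> l) (at_left t)" by (blast intro: tendsto_eventually)
qed

lemma continuous_cadlag:
  assumes y: "continuous_on {0..} y"
  shows "restrict y {0..} \<in> cadlag"
  unfolding cadlag_def
proof (intro CollectI conjI allI impI)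
  fix t :: real assume t: "0 \<le> t"
  have "(y \<longlongrightarrow> y t) (at t within {0..})" using y t by (auto simp: continuous_on_def)
  hence "(y \<longlongrightarrow> y t) (at_right t)" by (rule tendsto_within_subset) (use t in auto)
  moreover have "\<forall>\<^sub>F s in at_right t. y s = restrict y {0..} s"
    using eventually_at_right_less[of t] by eventually_elim (use t in auto)
  ultimately have "(restrict y {0..} \<longlongrightarrow> y t) (at_right t)" by (rule Lim_transform_eventually)
  thus "(restrict y {0..} \<longlongrightarrow> restrict y {0..} t) (at_right t)" using t by simp
next
  fix t :: real assume t: "0 < t"
  have "(y \<longlongrightarrow> y t) (at t within {0..})" using y t by (auto simp: continuous_on_def)
  hence "(y \<longlongrightarrow> y t) (at t within {0..<t})" by (rule tendsto_within_subset) auto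
  also have "at t within {0..<t} = at_left t"
    by (rule at_within_nhd[of _ "{0<..}"]) (use t in auto)
  finally have "(y \<longlongrightarrow> y t) (at_left t)" .
  moreover have "\<forall>\<^sub>F s in at_left t. y s = restrict y {0..} s"
    using eventually_at_left_real[OF t] by eventually_elim auto
  ultimately show "\<exists>l. (restrict y {0..} \<longlongrightarrow> l) (at_left t)" by (blast intro: Lim_transform_eventually)
qed auto

text \<open>The minorant is the infimal convolution of \<open>\<phi>\<close> with \<open>j\<close> times the supremum distance on \<open>[0, j]\<close>. The distance
  enters through its upper bounds \<open>d\<close>.\<close>
abbreviation minorant_values :: "((real \<Rightarrow> real) \<Rightarrow> real) \<Rightarrow> nat \<Rightarrow> (real \<Rightarrow> real) \<Rightarrow> real set" where
  "minorant_values \<phi> j x \<equiv>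
     {\<phi> y + real j * d | y d. y \<in> cadlag \<and> 0 \<le> d \<and> (\<forall>s\<in>{0..real j}. \<bar>x s - y s\<bar> \<le> d)}"

definition lipschitz_minorant :: "((real \<Rightarrow> real) \<Rightarrow> real) \<Rightarrow> nat \<Rightarrow> (real \<Rightarrow> real) \<Rightarrow> real" where
  "lipschitz_minorant \<phi> j x = Inf (minorant_values \<phi> j x)"

text \<open>Lower semicontinuity for locally uniform convergence of paths, which is weaker than lower
  semicontinuity for the Skorokhod topology.\<close>
definition lower_semicont :: "((real \<Rightarrow> real) \<Rightarrow> real) \<Rightarrow> bool" where
  "lower_semicont \<phi> \<longleftrightarrow> (\<forall>x\<in>cadlag. \<forall>\<epsilon>>0. \<exists>T. \<exists>\<delta>>0. \<forall>y\<in>cadlag. (\<forall>s\<in>{0..T}. \<bar>x s - y s\<bar> \<le> \<delta>) \<longrightarrow> \<phi> x - \<epsilon> \<le> \<phi> y)"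

context
  fixes \<phi> :: "(real \<Rightarrow> real) \<Rightarrow> real" and K :: real
  assumes bd: "\<forall>x\<in>cadlag. \<bar>\<phi> x\<bar> \<le> K"
begin

lemmas bounded = bspec[OF bd]

abbreviation "env \<equiv> lipschitz_minorant \<phi>"

lemma env_set_lower: "v \<in> minorant_values \<phi> j x \<Longrightarrow> - K \<le> v"
  using bounded by (force simp: abs_le_iff intro: add_increasing2)

lemma env_upper:
  assumes "y \<in> cadlag" "0 \<le> d" "\<And>s. s \<in> {0..real j} \<Longrightarrow> \<bar>x s - y s\<bar> \<le> d"
  shows "env j x \<le> \<phi> y + real j * d"
  unfolding lipschitz_minorant_def
proof (rule cInf_lower)
  show "\<phi> y + real j * d \<in> minorant_values \<phi> j x"
    using assms by blast
  show "bdd_below (minorant_values \<phi> j x)"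
    by (rule bdd_belowI[of _ "- K"]) (rule env_set_lower)
qed

lemma env_le: "x \<in> cadlag \<Longrightarrow> env j x \<le> \<phi> x"
  using env_upper[of x 0 j x] by simp

lemma env_greatest:
  assumes "x \<in> cadlag" "\<And>y d. y \<in> cadlag \<Longrightarrow> 0 \<le> d \<Longrightarrow> (\<And>s. s \<in> {0..real j} \<Longrightarrow> \<bar>x s - y s\<bar> \<le> d) \<Longrightarrow> c \<le> \<phi> y + real j * d"
  shows "c \<le> env j x"
  unfolding lipschitz_minorant_def
proof (rule cInf_greatest)
  show "minorant_values \<phi> j x \<noteq> {}"
    using assms(1) by (auto intro!: exI[of _ x] exI[of _ 0])
qed (use assms(2) in auto)

lemma env_bounded: "x \<in> cadlag \<Longrightarrow> \<bar>env j x\<bar> \<le> K"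
proof -
  assume x: "x \<in> cadlag"
  have "- K \<le> env j x" by (rule env_greatest[OF x]) (use env_set_lower in blast)
  thus ?thesis using env_le[OF x, of j] bounded[OF x] by simp
qed

lemma env_lipschitz:
  assumes "x \<in> cadlag" "x' \<in> cadlag" "\<And>s. s \<in> {0..real j} \<Longrightarrow> \<bar>x s - x' s\<bar> \<le> r" "0 \<le> r"
  shows "\<bar>env j x - env j x'\<bar> \<le> real j * r"
proof -
  have *: "env j x - real j * r \<le> env j x'" if x: "x \<in> cadlag" "x' \<in> cadlag" "\<And>s. s \<in> {0..real j} \<Longrightarrow> \<bar>x s - x' s\<bar> \<le> r" for x x'
  proof (rule env_greatest[OF x(2)])
    fix y d assume y: "y \<in> cadlag" "0 \<le> d" "\<And>s. s \<in> {0..real j} \<Longrightarrow> \<bar>x' s - y s\<bar> \<le> d"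
    have "env j x \<le> \<phi> y + real j * (d + r)"
    proof (rule env_upper[OF y(1)])
      fix s assume s: "s \<in> {0..real j}"
      show "\<bar>x s - y s\<bar> \<le> d + r" using x(3)[OF s] y(3)[OF s] by linarith
    qed (use y assms in auto)
    thus "env j x - real j * r \<le> \<phi> y + real j * d" by (simp add: distrib_left)
  qed
  have "env j x - real j * r \<le> env j x'" by (rule *[OF assms(1-3)])
  moreover have "env j x' - real j * r \<le> env j x"
    by (rule *[OF assms(2,1)]) (use assms(3) in \<open>auto simp: abs_minus_commute\<close>)
  ultimately show ?thesis by linarith
qed

text \<open>Paths \<open>y\<close> near \<open>x\<close> have \<open>\<phi> y\<close> almost as large as \<open>\<phi> x\<close> by semicontinuity. All others are
  penalized by \<open>j * \<delta>\<close>, which exceeds the oscillation \<open>2 * K\<close> of \<open>\<phi>\<close> for large \<open>j\<close>.\<close>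
lemma env_tendsto:
  assumes lsc: "lower_semicont \<phi>" and x: "x \<in> cadlag"
  shows "(\<lambda>j. env j x) \<longlonglongrightarrow> \<phi> x"
proof (rule LIMSEQ_I)
  fix r :: real assume r: "0 < r"
  have K: "K \<ge> 0" using bounded[OF x] by linarith
  have "r / 2 > 0" using r by simp
  with bspec[OF lsc[unfolded lower_semicont_def] x]
  obtain T \<delta> where \<delta>: "\<delta> > 0" and near: "\<forall>y\<in>cadlag. (\<forall>s\<in>{0..T}. \<bar>x s - y s\<bar> \<le> \<delta>) \<longrightarrow> \<phi> x - r/2 \<le> \<phi> y" by blast
  have T: "\<phi> x - r/2 \<le> \<phi> y" if "y \<in> cadlag" "\<And>s. s \<in> {0..T} \<Longrightarrow> \<bar>x s - y s\<bar> \<le> \<delta>" for y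
    using near that by auto
  obtain j0 :: nat where j0: "real j0 \<ge> T" "real j0 * \<delta> \<ge> 2 * K"
  proof -
    obtain j0 :: nat where "real j0 \<ge> max T (2 * K / \<delta>)" using real_arch_simple by blast
    thus ?thesis using \<delta> by (intro that[of j0]) (auto simp: field_simps)
  qed
  have "norm (env j x - \<phi> x) < r" if j: "j \<ge> j0" for j
  proof -
    have jT: "T \<le> real j" "2 * K \<le> real j * \<delta>"
      using j j0 \<delta> by (auto intro: order_trans[OF _ mult_right_mono])
    have "\<phi> x - r/2 \<le> env j x"
    proof (rule env_greatest[OF x])
      fix y d assume y: "y \<in> cadlag" "0 \<le> d" "\<And>s. s \<in> {0..real j} \<Longrightarrow> \<bar>x s - y s\<bar> \<le> d"
      show "\<phi> x - r/2 \<le> \<phi> y + real j * d"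
      proof (cases "d \<le> \<delta>")
        case True
        have "\<phi> x - r/2 \<le> \<phi> y"
        proof (rule T[OF y(1)])
          fix s assume "s \<in> {0..T}"
          thus "\<bar>x s - y s\<bar> \<le> \<delta>" using y(3)[of s] True jT by simp
        qed
        thus ?thesis using y(2) by (simp add: add_increasing2)
      next
        case False
        hence "real j * \<delta> \<le> real j * d" by (intro mult_left_mono) auto
        thus ?thesis using jT(2) bounded[OF x] bounded[OF y(1)] r by linarith
      qed
    qed
    thus ?thesis using env_le[OF x, of j] r by simp
  qed
  thus "\<exists>no. \<forall>j\<ge>no. norm (env j x - \<phi> x) < r" by blast
qed

text \<open>On \<open>[0, j]\<close> a step path with steps of width \<open>1/m\<close> takes its first \<open>m * j + 1\<close> values only.\<close>
lemma env_step_lipschitz: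
  assumes m: "m > 0" and r: "\<And>k. k \<le> m * j \<Longrightarrow> \<bar>a k - a' k\<bar> \<le> r" "0 \<le> r"
  shows "\<bar>env j (step_path m a) - env j (step_path m a')\<bar> \<le> real j * r"
proof (rule env_lipschitz[OF step_path_cadlag[OF m] step_path_cadlag[OF m] _ r(2)])
  fix s assume s: "s \<in> {0..real j}"
  have "real m * s \<le> real (m * j)" using s by (auto intro: mult_left_mono)
  hence "cell m s \<le> m * j" by linarith
  thus "\<bar>step_path m a s - step_path m a' s\<bar> \<le> r" using r(1) s by (simp add: step_path_def)
qed

lemma env_step_continuous:
  assumes m: "m > 0" shows "continuous_on UNIV (\<lambda>a. env j (step_path m a))"
  unfolding continuous_on_def
proof
  fix a :: "nat \<Rightarrow> real"
  have "((\<lambda>a'. env j (step_path m a') - env j (step_path m a)) \<longlongrightarrow> 0) (at a)"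
  proof (rule Lim_null_comparison)
    show "\<forall>\<^sub>F a' in at a. norm (env j (step_path m a') - env j (step_path m a)) \<le> real j * (\<Sum>k\<le>m * j. \<bar>a' k - a k\<bar>)"
    proof (rule always_eventually, rule allI)
      fix a'
      have "\<bar>a' k - a k\<bar> \<le> (\<Sum>k\<le>m * j. \<bar>a' k - a k\<bar>)" if "k \<le> m * j" for k
        by (rule member_le_sum[of k "{..m * j}" "\<lambda>k. \<bar>a' k - a k\<bar>"]) (use that in auto)
      thus "norm (env j (step_path m a') - env j (step_path m a)) \<le> real j * (\<Sum>k\<le>m * j. \<bar>a' k - a k\<bar>)"
        unfolding real_norm_def by (intro env_step_lipschitz m sum_nonneg) auto
    qed
    have "((\<lambda>a'::nat \<Rightarrow> real. a' k) \<longlongrightarrow> a k) (at a)" for k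
      using continuous_on_product_coordinates[of k] by (auto simp: continuous_on_def)
    hence "((\<lambda>a'. real j * (\<Sum>k\<le>m * j. \<bar>a' k - a k\<bar>)) \<longlongrightarrow> real j * (\<Sum>k\<le>m * j. \<bar>a k - a k\<bar>)) (at a)"
      by (intro tendsto_intros)
    thus "((\<lambda>a'. real j * (\<Sum>k\<le>m * j. \<bar>a' k - a k\<bar>)) \<longlongrightarrow> 0) (at a)" by simp
  qed
  thus "((\<lambda>a. env j (step_path m a)) \<longlongrightarrow> env j (step_path m a)) (at a within UNIV)"
    by (simp add: LIM_zero_iff)
qed

text \<open>A continuous path is the locally uniform limit of its step interpolations.\<close>
lemma env_sampled_tendsto:
  assumes y: "continuous_on {0..} y"
  shows "(\<lambda>m. env j (step_path m (\<lambda>k. y (real k / real m)))) \<longlonglongrightarrow> env j (restrict y {0..})"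
proof (rule LIMSEQ_I)
  fix r :: real assume r: "0 < r"
  define e where "e = r / (real j + 1)"
  have e: "e > 0" "real j * e < r" using r by (auto simp: e_def field_simps)
  have "uniformly_continuous_on {0..real j} y"
    by (intro compact_uniformly_continuous continuous_on_subset[OF y]) auto
  then obtain d where d: "d > 0" "\<And>s t. s \<in> {0..real j} \<Longrightarrow> t \<in> {0..real j} \<Longrightarrow> dist t s < d \<Longrightarrow> dist (y t) (y s) < e"
    unfolding uniformly_continuous_on_def using e(1) by metis
  obtain m0 :: nat where m0: "1 / d < real m0" using reals_Archimedean2 by blast
  have m0_pos: "0 < m0" using m0 d by (intro Nat.gr0I) (auto simp: not_less dest: less_trans[of 0 "1/d" 0])
  have "norm (env j (step_path m (\<lambda>k. y (real k / real m))) - env j (restrict y {0..})) < r" if m: "m \<ge> m0" for m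
  proof -
    have mp: "m > 0" using m m0_pos by simp
    have "1 / d < real m" using m m0 by linarith
    hence md: "1 / real m < d" using d mp by (simp add: field_simps)
    have "\<bar>env j (step_path m (\<lambda>k. y (real k / real m))) - env j (restrict y {0..})\<bar> \<le> real j * e"
    proof (rule env_lipschitz[OF step_path_cadlag[OF mp] continuous_cadlag[OF y] _ less_imp_le[OF e(1)]])
      fix s assume s: "s \<in> {0..real j}"
      define q where "q = cell m s"
      have "0 \<le> real m * s" using s by simp
      hence q: "real q \<le> real m * s" "real m * s < real q + 1" unfolding q_def by linarith+
      have 1: "real q / real m \<le> s" "s < real q / real m + 1 / real m" using q mp by (auto simp: field_simps)
      have "dist (y (real q / real m)) (y s) < e"
        by (rule d(2)) (use s 1 md in \<open>auto simp: dist_real_def\<close>)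
      thus "\<bar>step_path m (\<lambda>k. y (real k / real m)) s - restrict y {0..} s\<bar> \<le> e"
        using s by (simp add: step_path_def q_def dist_real_def)
    qed
    thus ?thesis using e by simp
  qed
  thus "\<exists>no. \<forall>m\<ge>no. norm (env j (step_path m (\<lambda>k. y (real k / real m))) - env j (restrict y {0..})) < r" by blast
qed

lemma env_step_measurable:
  assumes m: "m > 0" and A: "\<And>k. A k \<in> borel_measurable Q"
  shows "(\<lambda>x. env j (step_path m (\<lambda>k. A k x))) \<in> borel_measurable Q"
proof (rule measurable_compose[where f = "\<lambda>x k. A k x" and g = "\<lambda>a. env j (step_path m a)"])
  show "(\<lambda>x k. A k x) \<in> Q \<rightarrow>\<^sub>M borel" by (rule measurable_coordinatewise_then_product[OF A])
  show "(\<lambda>a. env j (step_path m a)) \<in> borel_measurable borel" by (rule borel_measurable_continuous_onI[OF env_step_continuous[OF m]])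
qed

text \<open>Composed with step paths, each minorant is a continuous function of the values of the steps, and
  \<open>\<phi>\<close> is the pointwise limit of the minorants.\<close>
lemma step_functional_measurable:
  assumes lsc: "lower_semicont \<phi>" and m: "m > 0" and A: "\<And>k. A k \<in> borel_measurable Q"
  shows "(\<lambda>x. \<phi> (step_path m (\<lambda>k. A k x))) \<in> borel_measurable Q"
  by (rule borel_measurable_LIMSEQ_real[OF env_tendsto[OF lsc step_path_cadlag[OF m]] env_step_measurable[OF m A]])

lemma env_continuous_measurable:
  assumes Y: "\<And>t. t \<ge> 0 \<Longrightarrow> Y t \<in> borel_measurable Q" "\<And>x. x \<in> space Q \<Longrightarrow> continuous_on {0..} (\<lambda>t. Y t x)"
  shows "(\<lambda>x. env j (restrict (\<lambda>t. Y t x) {0..})) \<in> borel_measurable Q"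
proof (rule borel_measurable_LIMSEQ_real)
  fix x assume "x \<in> space Q"
  from LIMSEQ_Suc[OF env_sampled_tendsto[OF Y(2)[OF this], of j]]
  show "(\<lambda>m. env j (step_path (Suc m) (\<lambda>k. Y (real k / real (Suc m)) x))) \<longlonglongrightarrow> env j (restrict (\<lambda>t. Y t x) {0..})" .
next
  fix m show "(\<lambda>x. env j (step_path (Suc m) (\<lambda>k. Y (real k / real (Suc m)) x))) \<in> borel_measurable Q"
    by (rule env_step_measurable) (auto intro: Y(1))
qed

lemma continuous_functional_measurable:
  assumes lsc: "lower_semicont \<phi>"
    and Y: "\<And>t. t \<ge> 0 \<Longrightarrow> Y t \<in> borel_measurable Q" "\<And>x. x \<in> space Q \<Longrightarrow> continuous_on {0..} (\<lambda>t. Y t x)"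
  shows "(\<lambda>x. \<phi> (restrict (\<lambda>t. Y t x) {0..})) \<in> borel_measurable Q"
  by (rule borel_measurable_LIMSEQ_real[OF env_tendsto[OF lsc continuous_cadlag[OF Y(2)]] env_continuous_measurable[OF Y]])

end

text \<open>The identity is an admissible time change, so the Skorokhod topology is coarser than that of
  locally uniform convergence.\<close>
lemma skorokhod_open_contains_uniform_nbhd:
  assumes U: "openin skorokhod U" and x: "x \<in> U"
  shows "\<exists>T. \<exists>\<delta>>0. \<forall>y\<in>cadlag. (\<forall>s\<in>{0..T}. \<bar>x s - y s\<bar> \<le> \<delta>) \<longrightarrow> y \<in> U"
proof -
  obtain T \<epsilon> where T: "\<epsilon> > 0" "skorokhod_nbhd x T \<epsilon> \<subseteq> U" using U x unfolding openin_skorokhod by blast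
  have "y \<in> skorokhod_nbhd x T \<epsilon>" if y: "y \<in> cadlag" "\<forall>s\<in>{0..T}. \<bar>x s - y s\<bar> \<le> \<epsilon> / 2" for y
    unfolding skorokhod_nbhd_def
  proof (intro CollectI conjI bexI[of _ "\<lambda>s. s"] y(1))
    show "(\<lambda>s. s) \<in> time_changes" by (auto simp: time_changes_def strict_mono_on_def)
    show "\<forall>s\<in>{0..T}. \<bar>y s - x s\<bar> < \<epsilon>"
      using y(2) T(1) by (auto simp: abs_minus_commute intro: le_less_trans[of _ "\<epsilon> / 2"])
  qed (use T in auto)
  thus ?thesis using T by (intro exI[of _ T] exI[of _ "\<epsilon> / 2"]) auto
qed

lemma indicator_lower_semicont:
  assumes "openin skorokhod U" shows "lower_semicont (indicator U)"
  unfolding lower_semicont_def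
proof (intro ballI allI impI)
  fix x and \<epsilon> :: real assume "x \<in> cadlag" "\<epsilon> > 0"
  show "\<exists>T. \<exists>\<delta>>0. \<forall>y\<in>cadlag. (\<forall>s\<in>{0..T}. \<bar>x s - y s\<bar> \<le> \<delta>) \<longrightarrow> indicator U x - \<epsilon> \<le> (indicator U y :: real)"
  proof (cases "x \<in> U")
    case True
    from skorokhod_open_contains_uniform_nbhd[OF assms True] obtain T \<delta>
      where "\<delta> > 0" "\<And>y. y \<in> cadlag \<Longrightarrow> (\<forall>s\<in>{0..T}. \<bar>x s - y s\<bar> \<le> \<delta>) \<Longrightarrow> y \<in> U" by blast
    thus ?thesis using True \<open>\<epsilon> > 0\<close> by (intro exI[of _ T] exI[of _ \<delta>]) auto
  next
    case False
    have "indicator U x - \<epsilon> \<le> (indicator U y :: real)" for y using False \<open>\<epsilon> > 0\<close> by (simp add: indicator_def)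
    thus ?thesis by (intro exI[of _ 0] exI[of _ 1]) auto
  qed
qed

lemma continuous_lower_semicont:
  assumes "continuous_map skorokhod euclideanreal \<phi>" shows "lower_semicont \<phi>"
  unfolding lower_semicont_def
proof (intro ballI allI impI)
  fix x and \<epsilon> :: real assume x: "x \<in> cadlag" and \<epsilon>: "\<epsilon> > 0"
  have "openin skorokhod {y \<in> topspace skorokhod. \<phi> y \<in> {\<phi> x - \<epsilon><..}}"
    by (rule openin_continuous_map_preimage[OF assms]) (simp add: open_openin[symmetric])
  from skorokhod_open_contains_uniform_nbhd[OF this, of x] x \<epsilon>
  obtain T \<delta> where T: "\<delta> > 0" "\<And>y. y \<in> cadlag \<Longrightarrow> (\<forall>s\<in>{0..T}. \<bar>x s - y s\<bar> \<le> \<delta>) \<Longrightarrow> \<phi> y > \<phi> x - \<epsilon>"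
    unfolding topspace_skorokhod by auto
  thus "\<exists>T. \<exists>\<delta>>0. \<forall>y\<in>cadlag. (\<forall>s\<in>{0..T}. \<bar>x s - y s\<bar> \<le> \<delta>) \<longrightarrow> \<phi> x - \<epsilon> \<le> \<phi> y"
    by (intro exI[of _ T] exI[of _ \<delta>]) (auto intro: less_imp_le)
qed

lemma measurable_skorokhodI:
  assumes W: "\<And>x. x \<in> space Q \<Longrightarrow> W x \<in> cadlag"
    and ind: "\<And>U. openin skorokhod U \<Longrightarrow> (\<lambda>x. indicator U (W x) :: real) \<in> borel_measurable Q"
  shows "W \<in> Q \<rightarrow>\<^sub>M borel_of_top skorokhod"
  unfolding borel_of_top_def topspace_skorokhod
proof (rule measurable_measure_of)
  show "{U. openin skorokhod U} \<subseteq> Pow cadlag" using openin_subset[of skorokhod] by (auto simp: topspace_skorokhod)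
  show "W \<in> space Q \<rightarrow> cadlag" using W by auto
  fix U assume "U \<in> {U. openin skorokhod U}"
  hence [measurable]: "(\<lambda>x. indicator U (W x) :: real) \<in> borel_measurable Q" using ind by simp
  have "W -` U \<inter> space Q = {x \<in> space Q. indicator U (W x) = (1::real)}" by (auto simp: indicator_def)
  also have "\<dots> \<in> sets Q" by measurable
  finally show "W -` U \<inter> space Q \<in> sets Q" .
qed

lemma step_path_measurable:
  assumes "m > 0" "\<And>k. A k \<in> borel_measurable Q"
  shows "(\<lambda>x. step_path m (\<lambda>k. A k x)) \<in> Q \<rightarrow>\<^sub>M borel_of_top skorokhod"
  by (rule measurable_skorokhodI[OF step_path_cadlag[OF assms(1)]])
     (rule step_functional_measurable[where K = 1, OF _ indicator_lower_semicont assms], auto simp: indicator_def)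

lemma continuous_path_measurable:
  assumes Y: "\<And>t. t \<ge> 0 \<Longrightarrow> Y t \<in> borel_measurable Q" "\<And>x. x \<in> space Q \<Longrightarrow> continuous_on {0..} (\<lambda>t. Y t x)"
  shows "(\<lambda>x. restrict (\<lambda>t. Y t x) {0..}) \<in> Q \<rightarrow>\<^sub>M borel_of_top skorokhod"
  by (rule measurable_skorokhodI[OF continuous_cadlag[OF Y(2)]], assumption)
     (rule continuous_functional_measurable[where K = 1, OF _ indicator_lower_semicont Y], auto simp: indicator_def)

lemma continuous_map_measurable_skorokhod:
  assumes "continuous_map skorokhod euclideanreal \<phi>"
  shows "\<phi> \<in> borel_measurable (borel_of_top skorokhod)"
proof (rule borel_measurableI)
  fix S :: "real set" assume "open S"
  hence "openin skorokhod {y \<in> topspace skorokhod. \<phi> y \<in> S}"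
    by (intro openin_continuous_map_preimage[OF assms]) (simp add: open_openin[symmetric])
  moreover have "\<phi> -` S \<inter> space (borel_of_top skorokhod) = {y \<in> topspace skorokhod. \<phi> y \<in> S}"
    by (auto simp: borel_of_top_def space_measure_of_conv)
  ultimately show "\<phi> -` S \<inter> space (borel_of_top skorokhod) \<in> sets (borel_of_top skorokhod)"
    unfolding borel_of_top_def by (auto intro!: sigma_sets.Basic simp: sets_measure_of openin_subset Pow_def subset_eq dest: openin_subset)
qed

section \<open>A criterion for weak convergence to a continuous process\<close>

text \<open>Step processes \<open>A N\<close> on the grid of width \<open>1/N\<close> and a continuous process \<open>Y\<close>: convergence of the
  finite-dimensional characteristic functions, tightness at fixed times and uniformly small oscillation.\<close>
locale step_process_limit =
  fixes M :: "nat \<Rightarrow> 'a measure" and A :: "nat \<Rightarrow> nat \<Rightarrow> 'a \<Rightarrow> real"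
    and P :: "'b measure" and Y :: "real \<Rightarrow> 'b \<Rightarrow> real"
  assumes prob_M: "\<And>N. N \<ge> 1 \<Longrightarrow> prob_space (M N)" and prob_P: "prob_space P"
    and A_meas: "\<And>N n. N \<ge> 1 \<Longrightarrow> A N n \<in> borel_measurable (M N)"
    and Y_meas: "\<And>t. t \<ge> 0 \<Longrightarrow> Y t \<in> borel_measurable P"
    and Y_cont: "\<And>x. x \<in> space P \<Longrightarrow> continuous_on {0..} (\<lambda>t. Y t x)"
    and char: "\<And>t a (n::nat). (\<And>k. t k \<ge> 0) \<Longrightarrow>
       (\<lambda>N. CLINT x|M N. iexp (\<Sum>k<n. a k * A N (cell N (t k)) x)) \<longlonglongrightarrow> (CLINT x|P. iexp (\<Sum>k<n. a k * Y (t k) x))"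
    and tight: "\<And>t \<epsilon>. t \<ge> 0 \<Longrightarrow> \<epsilon> > 0 \<Longrightarrow>
       \<exists>L. \<forall>N\<ge>1. \<P>(x in M N. \<bar>A N (cell N t) x\<bar> > L) \<le> \<epsilon>"
    and modulus: "\<And>\<epsilon> \<eta> T. \<epsilon> > 0 \<Longrightarrow> \<eta> > 0 \<Longrightarrow>
       \<forall>\<^sub>F m in sequentially. \<forall>N\<ge>m. small_oscillation (M N) (A N) N m T \<epsilon> \<eta>"
begin

abbreviation Z :: "nat \<Rightarrow> 'a \<Rightarrow> real \<Rightarrow> real" where "Z N x \<equiv> step_path N (\<lambda>n. A N n x)"
abbreviation B :: "'b \<Rightarrow> real \<Rightarrow> real" where "B x \<equiv> restrict (\<lambda>t. Y t x) {0..}"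

text \<open>The lower half of weak convergence. The minorant is chosen first, to be nearly as large as \<open>\<phi>\<close> in the
  limit process; then the step width \<open>1/m\<close>, so fine that interpolation changes the minorant little, both
  for the limit process and, uniformly in \<open>N \<ge> m\<close>, for the step processes; the finite-dimensional
  convergence then applies with \<open>j\<close> and \<open>m\<close> fixed.\<close>
lemma expectation_lower_semicont:
  assumes bd: "\<forall>x\<in>cadlag. \<bar>\<phi> x\<bar> \<le> K" and lsc: "lower_semicont \<phi>" and r: "r > 0"
  shows "\<forall>\<^sub>F N in sequentially. (LINT x|P. \<phi> (B x)) - r \<le> (LINT x|M N. \<phi> (Z N x))"
proof -
  interpret P: prob_space P by (rule prob_P)
  have K: "K \<ge> 0" using bspec[OF bd step_path_cadlag[of 1 "\<lambda>_. 0"]] by (meson abs_ge_zero order_trans zero_less_one)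
  let ?e = "lipschitz_minorant \<phi>"
  note e_bd = env_bounded[OF bd]
  have B_cad: "x \<in> space P \<Longrightarrow> B x \<in> cadlag" for x by (rule continuous_cadlag[OF Y_cont])
  have sample_meas: "Y (real k / real m) \<in> borel_measurable P" for k m by (rule Y_meas) simp
  have "(\<lambda>j. (LINT x|P. ?e j (B x))) \<longlonglongrightarrow> (LINT x|P. \<phi> (B x))"
  proof (rule integral_dominated_convergence[where w = "\<lambda>_. K"])
    show "(\<lambda>x. \<phi> (B x)) \<in> borel_measurable P"
      by (rule continuous_functional_measurable[OF bd lsc Y_meas Y_cont])
    show "(\<lambda>x. ?e j (B x)) \<in> borel_measurable P" for j
      by (rule env_continuous_measurable[OF bd Y_meas Y_cont])
    show "AE x in P. (\<lambda>j. ?e j (B x)) \<longlonglongrightarrow> \<phi> (B x)"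
      by (rule AE_I2) (rule env_tendsto[OF bd lsc B_cad])
    show "AE x in P. norm (?e j (B x)) \<le> K" for j
      by (rule AE_I2) (simp add: e_bd[OF B_cad])
  qed simp
  from LIMSEQ_D[OF this, of "r / 4"] r
  obtain j where "norm ((LINT x|P. ?e j (B x)) - (LINT x|P. \<phi> (B x))) < r / 4" by auto
  hence 1: "(LINT x|P. \<phi> (B x)) - r / 4 \<le> (LINT x|P. ?e j (B x))" unfolding real_norm_def by linarith
  \<comment> \<open>The minorant has Lipschitz constant \<open>j\<close> and oscillation at most \<open>2 * K\<close>.\<close>
  define \<epsilon> where "\<epsilon> = r / (8 * (real j + 1))"
  define \<eta> where "\<eta> = r / (8 * (2 * K + 1))"
  have pos: "\<epsilon> > 0" "\<eta> > 0" using r K by (auto simp: \<epsilon>_def \<eta>_def)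
  have small: "real j * \<epsilon> \<le> r / 8" "2 * K * \<eta> \<le> r / 8"
  proof -
    have "real j * \<epsilon> \<le> (real j + 1) * \<epsilon>" using pos by simp
    also have "\<dots> = r / 8" unfolding \<epsilon>_def by (simp add: field_simps)
    finally show "real j * \<epsilon> \<le> r / 8" .
    have "2 * K * \<eta> \<le> (2 * K + 1) * \<eta>" using pos by simp
    also have "\<dots> = r / 8"
    proof -
      have cancel: "D * (r / (8 * D)) = r / 8" if "D > 0" for D using that by simp
      have "2 * K + 1 > 0" using K by simp
      from cancel[OF this] show ?thesis unfolding \<eta>_def .
    qed
    finally show "2 * K * \<eta> \<le> r / 8" .
  qed
  let ?sY = "\<lambda>m x. step_path m (\<lambda>k. Y (real k / real m) x)"
  have "(\<lambda>m. (LINT x|P. ?e j (?sY (Suc m) x))) \<longlonglongrightarrow> (LINT x|P. ?e j (B x))"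
  proof (rule integral_dominated_convergence[where w = "\<lambda>_. K"])
    show "(\<lambda>x. ?e j (B x)) \<in> borel_measurable P"
      by (rule env_continuous_measurable[OF bd Y_meas Y_cont])
    show "(\<lambda>x. ?e j (?sY (Suc m) x)) \<in> borel_measurable P" for m
      by (rule env_step_measurable[OF bd _ sample_meas]) simp
    show "AE x in P. (\<lambda>m. ?e j (?sY (Suc m) x)) \<longlonglongrightarrow> ?e j (B x)"
      by (rule AE_I2) (rule LIMSEQ_Suc[OF env_sampled_tendsto[OF bd Y_cont]])
    show "AE x in P. norm (?e j (?sY (Suc m) x)) \<le> K" for m
      by (rule AE_I2) (simp add: e_bd[OF step_path_cadlag])
  qed simp
  hence "(\<lambda>m. (LINT x|P. ?e j (?sY m x))) \<longlonglongrightarrow> (LINT x|P. ?e j (B x))" by (rule LIMSEQ_imp_Suc)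
  hence "\<forall>\<^sub>F m in sequentially. (LINT x|P. ?e j (?sY m x)) > (LINT x|P. ?e j (B x)) - r / 4"
    using r by (intro order_tendstoD) auto
  with modulus[OF pos, of j] eventually_gt_at_top[of 0]
  have "\<forall>\<^sub>F m in sequentially. m > 0 \<and> (LINT x|P. ?e j (?sY m x)) > (LINT x|P. ?e j (B x)) - r / 4 \<and>
     (\<forall>N\<ge>m. small_oscillation (M N) (A N) N m j \<epsilon> \<eta>)"
    by eventually_elim blast
  then obtain m where m: "m > 0" and 2: "(LINT x|P. ?e j (?sY m x)) > (LINT x|P. ?e j (B x)) - r / 4"
    and mod: "\<And>N. N \<ge> m \<Longrightarrow> small_oscillation (M N) (A N) N m j \<epsilon> \<eta>"
    unfolding eventually_sequentially by blast
  let ?U = "\<lambda>N k. A N (cell N (real k / real m))"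
  let ?sZ = "\<lambda>N x. step_path m (\<lambda>k. ?U N k x)"
  have "(\<lambda>N. (LINT x|M N. ?e j (?sZ N x))) \<longlonglongrightarrow> (LINT x|P. ?e j (?sY m x))"
  proof (rule char_tendsto_imp_expectation_tendsto[where f = "\<lambda>a. ?e j (step_path m a)" and U = ?U and V = "\<lambda>k. Y (real k / real m)"
      and n = "Suc (m * j)" and C = K, OF prob_M prob_P A_meas sample_meas])
    show "(\<lambda>N. CLINT x|M N. iexp (\<Sum>k<n. a k * ?U N k x)) \<longlonglongrightarrow> (CLINT x|P. iexp (\<Sum>k<n. a k * Y (real k / real m) x))" for n a
      by (rule char) simp
    show "\<exists>L. \<forall>N\<ge>1. \<P>(x in M N. \<bar>?U N k x\<bar> > L) \<le> \<epsilon>" if "\<epsilon> > 0" for k \<epsilon>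
      by (rule tight[OF _ that]) simp
    show "continuous_on UNIV (\<lambda>a. ?e j (step_path m a))"
      by (rule env_step_continuous[OF bd m])
    show "?e j (step_path m a) = ?e j (step_path m a')" if "\<And>k. k < Suc (m * j) \<Longrightarrow> a k = a' k" for a a'
      using env_step_lipschitz[where j = j and a = a and a' = a' and r = 0, OF bd m] that by simp
    show "\<bar>?e j (step_path m a)\<bar> \<le> K" for a by (rule e_bd[OF step_path_cadlag[OF m]])
  qed
  hence "\<forall>\<^sub>F N in sequentially. (LINT x|M N. ?e j (?sZ N x)) > (LINT x|P. ?e j (?sY m x)) - r / 4"
    using r by (intro order_tendstoD) auto
  thus ?thesis using eventually_ge_at_top[of m]
  proof eventually_elim
    case (elim N)
    have N: "N > 0" "N \<ge> 1" using elim(2) m by auto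
    interpret prob_space "M N" by (rule prob_M[OF N(2)])
    obtain E where E: "E \<in> sets (M N)" "prob E \<le> \<eta>"
      "\<And>x t. x \<in> space (M N) - E \<Longrightarrow> t \<in> {0..real j} \<Longrightarrow>
           \<bar>A N (cell N t) x - A N (cell N (real (cell m t) / real m)) x\<bar> \<le> \<epsilon>"
      using mod[OF elim(2)] by blast
    have int1: "integrable (M N) (\<lambda>x. ?e j (Z N x))"
      by (rule integrable_const_bound[where B = K, OF _ env_step_measurable[OF bd N(1) A_meas[OF N(2)]]])
         (use e_bd[OF step_path_cadlag[OF N(1)]] in auto)
    have int2: "integrable (M N) (\<lambda>x. ?e j (?sZ N x))"
      by (rule integrable_const_bound[where B = K, OF _ env_step_measurable[OF bd m A_meas[OF N(2)]]])
         (use e_bd[OF step_path_cadlag[OF m]] in auto)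
    have int3: "integrable (M N) (\<lambda>x. \<phi> (Z N x))"
      by (rule integrable_const_bound[where B = K, OF _ step_functional_measurable[OF bd lsc N(1) A_meas[OF N(2)]]])
         (use bspec[OF bd step_path_cadlag[OF N(1)]] in auto)
    have "\<bar>expectation (\<lambda>x. ?e j (Z N x)) - expectation (\<lambda>x. ?e j (?sZ N x))\<bar> \<le> real j * \<epsilon> + 2 * K * prob E"
    proof (rule expectation_diff_bound[OF int1 int2 E(1)])
      fix x assume x: "x \<in> space (M N) - E"
      show "\<bar>?e j (Z N x) - ?e j (?sZ N x)\<bar> \<le> real j * \<epsilon>"
      proof (rule env_lipschitz[OF bd step_path_cadlag[OF N(1)] step_path_cadlag[OF m]])
        fix s assume s: "s \<in> {0..real j}"
        thus "\<bar>Z N x s - ?sZ N x s\<bar> \<le> \<epsilon>" using E(3)[OF x s] by (simp add: step_path_def)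
      qed (use pos in auto)
    next
      fix x
      show "\<bar>?e j (Z N x) - ?e j (?sZ N x)\<bar> \<le> 2 * K"
        using e_bd[OF step_path_cadlag[OF N(1)], of j "\<lambda>n. A N n x"] e_bd[OF step_path_cadlag[OF m], of j "\<lambda>k. ?U N k x"] by linarith
    qed (use pos in auto)
    moreover have "2 * K * prob E \<le> 2 * K * \<eta>" using E(2) K by (intro mult_left_mono) auto
    moreover have "expectation (\<lambda>x. ?e j (Z N x)) \<le> expectation (\<lambda>x. \<phi> (Z N x))"
      by (rule integral_mono[OF int1 int3]) (rule env_le[OF bd step_path_cadlag[OF N(1)]])
    ultimately show ?case using 1 2 elim(1) small by linarith
  qed
qed

theorem weak_convergence:
  shows "weak_conv_top skorokhod (\<lambda>N. distr (M N) (borel_of_top skorokhod) (Z N)) (distr P (borel_of_top skorokhod) B)"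
  unfolding weak_conv_top_def
proof (intro allI impI)
  fix \<phi> :: "(real \<Rightarrow> real) \<Rightarrow> real"
  assume "continuous_map skorokhod euclideanreal \<phi> \<and> bounded (\<phi> ` topspace skorokhod)"
  hence cont: "continuous_map skorokhod euclideanreal \<phi>" and "bounded (\<phi> ` cadlag)" by (auto simp: topspace_skorokhod)
  then obtain K where K: "\<forall>x\<in>cadlag. \<bar>\<phi> x\<bar> \<le> K" unfolding bounded_iff by auto
  have cont': "continuous_map skorokhod euclideanreal (\<lambda>x. - \<phi> x)" using cont by (rule continuous_map_minus)
  note [measurable] = continuous_map_measurable_skorokhod[OF cont]
  have B[measurable]: "B \<in> P \<rightarrow>\<^sub>M borel_of_top skorokhod" by (rule continuous_path_measurable[OF Y_meas Y_cont])
  have lim: "(\<lambda>N. (LINT x|M N. \<phi> (Z N x))) \<longlonglongrightarrow> (LINT x|P. \<phi> (B x))"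
  proof (rule LIMSEQ_I)
    fix r :: real assume r: "r > 0"
    have "\<forall>\<^sub>F N in sequentially. (LINT x|P. \<phi> (B x)) - r / 2 \<le> (LINT x|M N. \<phi> (Z N x))"
      by (rule expectation_lower_semicont[OF K continuous_lower_semicont[OF cont]]) (use r in auto)
    moreover have "\<forall>\<^sub>F N in sequentially. (LINT x|P. - \<phi> (B x)) - r / 2 \<le> (LINT x|M N. - \<phi> (Z N x))"
      by (rule expectation_lower_semicont[OF _ continuous_lower_semicont[OF cont']]) (use r K in auto)
    ultimately have "\<forall>\<^sub>F N in sequentially. norm ((LINT x|M N. \<phi> (Z N x)) - (LINT x|P. \<phi> (B x))) < r"
      by eventually_elim (use r in \<open>simp add: abs_less_iff\<close>)
    thus "\<exists>no. \<forall>N\<ge>no. norm ((LINT x|M N. \<phi> (Z N x)) - (LINT x|P. \<phi> (B x))) < r"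
      unfolding eventually_sequentially .
  qed
  have ev: "\<forall>\<^sub>F N in sequentially. (LINT x|M N. \<phi> (Z N x)) = integral\<^sup>L (distr (M N) (borel_of_top skorokhod) (Z N)) \<phi>"
    using eventually_ge_at_top[of 1]
  proof eventually_elim
    case (elim N)
    have "Z N \<in> M N \<rightarrow>\<^sub>M borel_of_top skorokhod" by (rule step_path_measurable) (use elim A_meas in auto)
    thus ?case by (subst integral_distr) auto
  qed
  have "(LINT x|P. \<phi> (B x)) = integral\<^sup>L (distr P (borel_of_top skorokhod) B) \<phi>"
    by (subst integral_distr) auto
  with Lim_transform_eventually[OF lim ev]
  show "(\<lambda>N. integral\<^sup>L (distr (M N) (borel_of_top skorokhod) (Z N)) \<phi>) \<longlonglongrightarrow> integral\<^sup>L (distr P (borel_of_top skorokhod) B) \<phi>"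
    by (simp only:)
qed

end

section \<open>Fractional Brownian motion as the limit\<close>

lemma normal_rv_char:
  assumes P: "prob_space P" and Z: "normal_rv P Z" and mean: "integral\<^sup>L P Z = 0"
  shows "integrable P (\<lambda>x. (Z x)\<^sup>2)" "integrable P Z"
    "(CLINT x|P. iexp (Z x)) = complex_of_real (exp (- (LINT x|P. (Z x)\<^sup>2) / 2))"
proof -
  interpret prob_space P by fact
  have [measurable]: "Z \<in> borel_measurable P" using Z by (simp add: normal_rv_def)
  have "integrable P (\<lambda>x. (Z x)\<^sup>2) \<and> integrable P Z \<and>
    (CLINT x|P. iexp (Z x)) = complex_of_real (exp (- (LINT x|P. (Z x)\<^sup>2) / 2))"
  proof (cases "\<exists>m. AE x in P. Z x = m")
    case True
    then obtain m where m: "AE x in P. Z x = m" by blast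
    have "integral\<^sup>L P Z = integral\<^sup>L P (\<lambda>_. m)" by (rule integral_cong_AE) (use m in auto)
    hence "m = 0" using mean by (simp add: prob_space)
    hence AE: "AE x in P. Z x = 0" using m by simp
    have "integrable P (\<lambda>x. (Z x)\<^sup>2)" by (rule integrable_const_bound[of _ 0]) (use AE in auto)
    moreover have "integrable P Z" by (rule integrable_const_bound[of _ 0]) (use AE in auto)
    moreover have "(CLINT x|P. iexp (Z x)) = (CLINT x|P. 1)" by (rule integral_cong_AE) (use AE in auto)
    moreover have "(LINT x|P. (Z x)\<^sup>2) = integral\<^sup>L P (\<lambda>_. 0)" by (rule integral_cong_AE) (use AE in auto)
    ultimately show ?thesis by (simp add: prob_space)
  next
    case False
    then obtain m \<sigma> where \<sigma>: "\<sigma> > 0" and D: "distributed P lborel Z (normal_density m \<sigma>)" using Z unfolding normal_rv_def by blast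
    have "m = 0" using normal_distributed_expectation[OF \<sigma> D] mean by simp
    note D0 = D[unfolded \<open>m = 0\<close>]
    have std: "distributed P lborel (\<lambda>x. (Z x - 0) / \<sigma>) std_normal_density"
      using normal_standard_normal_convert[OF \<sigma>, of Z 0] D0 by simp
    have int: "integrable P Z" using integrable_normal_moment[OF \<sigma>, of 0 1] D0
      by (subst distributed_integrable[OF D0, of "\<lambda>x. x", symmetric, simplified]) (simp_all)
    have int2: "integrable P (\<lambda>x. (Z x)\<^sup>2)" using integrable_normal_moment[OF \<sigma>, of 0 2]
      by (subst distributed_integrable[OF D0, of "\<lambda>x. x\<^sup>2", symmetric, simplified]) (simp_all)
    have var: "(LINT x|P. (Z x)\<^sup>2) = \<sigma>\<^sup>2" using normal_distributed_variance[OF \<sigma> D0] mean by simp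
    have "(CLINT x|P. iexp (Z x)) = (CLINT x|P. iexp (\<sigma> * ((Z x - 0) / \<sigma>)))" using \<sigma> by simp
    also have "\<dots> = (CLINT y|distr P borel (\<lambda>x. (Z x - 0) / \<sigma>). iexp (\<sigma> * y))" by (subst integral_distr) auto
    also have "distr P borel (\<lambda>x. (Z x - 0) / \<sigma>) = std_normal_distribution"
      using distributed_distr_eq_density[OF std] by (simp cong: distr_cong)
    also have "(CLINT y|std_normal_distribution. iexp (\<sigma> * y)) = complex_of_real (exp (- \<sigma>\<^sup>2 / 2))"
      using fun_cong[OF char_std_normal_distribution, of \<sigma>] by (simp add: char_def)
    finally show ?thesis using int int2 var by simp
  qed
  thus "integrable P (\<lambda>x. (Z x)\<^sup>2)" "integrable P Z"
    "(CLINT x|P. iexp (Z x)) = complex_of_real (exp (- (LINT x|P. (Z x)\<^sup>2) / 2))" by auto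
qed

lemma fractional_BM_normal:
  assumes fbm: "fractional_BM H P Y" and t: "t \<ge> 0"
  shows "Y t \<in> borel_measurable P" "integrable P (\<lambda>x. (Y t x)\<^sup>2)" "integrable P (Y t)"
proof -
  have g: "gaussian_process P Y" and P: "prob_space P" and mean: "integral\<^sup>L P (Y t) = 0"
    using fbm t by (auto simp: fractional_BM_def)
  have n: "normal_rv P (Y t)"
    using g[unfolded gaussian_process_def, rule_format, of "{t}" "\<lambda>_. 1"] t by simp
  thus "Y t \<in> borel_measurable P" by (simp add: normal_rv_def)
  show "integrable P (\<lambda>x. (Y t x)\<^sup>2)" "integrable P (Y t)" using normal_rv_char[OF P n mean] by auto
qed

text \<open>The definition of a Gaussian process concerns sums over a set of times, whereas the times \<open>t k\<close> here may
  repeat; the coefficients of equal times are added up first.\<close>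
lemma fractional_BM_char:
  fixes t a :: "nat \<Rightarrow> real"
  assumes fbm: "fractional_BM H P Y" and t: "\<And>k. t k \<ge> 0"
  shows "(CLINT x|P. iexp (\<Sum>k<n. a k * Y (t k) x)) = complex_of_real (exp (- (\<Sum>k<n. \<Sum>l<n. a k * a l * fbm_cov H (t k) (t l)) / 2))"
proof -
  have g: "gaussian_process P Y" and P: "prob_space P" and mean: "\<And>t. t \<ge> 0 \<Longrightarrow> integral\<^sup>L P (Y t) = 0"
    and cov: "\<And>s t. s \<ge> 0 \<Longrightarrow> t \<ge> 0 \<Longrightarrow> (LINT x|P. Y s x * Y t x) = fbm_cov H s t"
    using fbm by (auto simp: fractional_BM_def fbm_cov_def)
  interpret prob_space P by fact
  define S where "S = t ` {..<n}"
  define b where "b s = (\<Sum>k\<in>{k\<in>{..<n}. t k = s}. a k)" for s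
  have eq: "(\<Sum>k<n. a k * Y (t k) x) = (\<Sum>s\<in>S. b s * Y s x)" for x
  proof -
    have "(\<Sum>k<n. a k * Y (t k) x) = (\<Sum>s\<in>S. \<Sum>k\<in>{k\<in>{..<n}. t k = s}. a k * Y (t k) x)"
      unfolding S_def by (rule sum.image_gen) simp
    also have "\<dots> = (\<Sum>s\<in>S. b s * Y s x)" unfolding b_def sum_distrib_right by (intro sum.cong) auto
    finally show ?thesis .
  qed
  let ?W = "\<lambda>x. \<Sum>k<n. a k * Y (t k) x"
  have "S \<subseteq> {0..}" "finite S" unfolding S_def using t by auto
  hence n: "normal_rv P ?W" unfolding eq using g unfolding gaussian_process_def by blast
  note [measurable] = fractional_BM_normal(1)[OF fbm t]
  have "integral\<^sup>L P ?W = 0" using fractional_BM_normal(3)[OF fbm t] mean[OF t] by simp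
  note W = normal_rv_char[OF P n this]
  have prod: "integrable P (\<lambda>x. Y (t k) x * Y (t l) x)" for k l
  proof (rule Bochner_Integration.integrable_bound)
    show "integrable P (\<lambda>x. (Y (t k) x)\<^sup>2 + (Y (t l) x)\<^sup>2)" using fractional_BM_normal(2)[OF fbm t] by simp
    show "AE x in P. norm (Y (t k) x * Y (t l) x) \<le> norm ((Y (t k) x)\<^sup>2 + (Y (t l) x)\<^sup>2)"
    proof (rule AE_I2)
      fix x
      have "\<bar>u\<bar> * \<bar>v\<bar> \<le> u\<^sup>2 + v\<^sup>2" for u v :: real
        using sum_squares_bound[of "\<bar>u\<bar>" "\<bar>v\<bar>"] mult_nonneg_nonneg[OF abs_ge_zero abs_ge_zero, of u v]
        unfolding power2_abs mult.assoc by linarith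
      from this[of "Y (t k) x" "Y (t l) x"] show "norm (Y (t k) x * Y (t l) x) \<le> norm ((Y (t k) x)\<^sup>2 + (Y (t l) x)\<^sup>2)"
        by (simp add: abs_mult)
    qed
  qed measurable
  have "(?W x)\<^sup>2 = (\<Sum>k<n. \<Sum>l<n. a k * a l * (Y (t k) x * Y (t l) x))" for x
    unfolding power2_eq_square sum_product by (intro sum.cong) (auto simp: mult_ac)
  hence "(LINT x|P. (?W x)\<^sup>2) = (\<Sum>k<n. \<Sum>l<n. a k * a l * fbm_cov H (t k) (t l))"
    using prod by (simp add: cov[OF t t])
  thus ?thesis using W(3) by simp
qed

text \<open>The process vanishes at time \<open>0\<close>, so the tail bound for increments applies to its values.\<close>
lemma grid_tight:
  fixes M :: "nat \<Rightarrow> 'a measure" and w :: "nat \<Rightarrow> int \<Rightarrow> 'a \<Rightarrow> real"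
  assumes H: "0 < H" "H < 1" and R: "\<And>N. N \<ge> 1 \<Longrightarrow> rademacher (M N) (w N)" and t: "t \<ge> 0" and \<epsilon>: "\<epsilon> > 0"
  shows "\<exists>L. \<forall>N\<ge>1. \<P>(x in M N. \<bar>grid (w N) H N (cell N t) x\<bar> > L) \<le> \<epsilon>"
proof -
  obtain C where C: "C > 0" "\<And>n. kernel_var H n \<le> C * real n powr (2 * H)" using kernel_var_bound[OF H] by metis
  define D where "D = moment_const 1 * ((cH H)\<^sup>2 * C) * t powr (2 * H)"
  have D: "D \<ge> 0" using C(1) moment_const_pos[of 1] by (simp add: D_def less_imp_le)
  define L where "L = sqrt ((D + 1) / \<epsilon>)"
  have L: "L > 0" "L\<^sup>2 = (D + 1) / \<epsilon>" using D \<epsilon> by (auto simp: L_def)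
  have "\<P>(x in M N. \<bar>grid (w N) H N (cell N t) x\<bar> > L) \<le> \<epsilon>" if N: "N \<ge> 1" for N
  proof -
    interpret rademacher "M N" "w N" by (rule R[OF N])
    define n where "n = cell N t"
    have N0: "N > 0" using N by simp
    have "prob {x \<in> space (M N). \<bar>grid (w N) H N n x\<bar> > L} \<le> moment_const 1 * ((cH H)\<^sup>2 * C) * (real n / real N) powr (2 * H) / L\<^sup>2"
      using grid_increment_tail[OF H N0 zero_less_one L(1) le0 C(2), of n] by (simp add: grid_def X_grid_def)
    also have "\<dots> \<le> D / L\<^sup>2"
    proof -
      have "real n \<le> real N * t" unfolding n_def using t by simp
      hence "real n / real N \<le> t" using N0 by (simp add: field_simps)
      hence "(real n / real N) powr (2 * H) \<le> t powr (2 * H)" using H by (intro powr_mono2) auto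
      thus ?thesis unfolding D_def using C(1) moment_const_pos[of 1] by (intro divide_right_mono mult_left_mono mult_nonneg_nonneg) (auto simp: less_imp_le)
    qed
    also have "\<dots> \<le> \<epsilon>" unfolding L(2) using D \<epsilon> by (simp add: field_simps)
    finally show ?thesis unfolding n_def .
  qed
  thus ?thesis by blast
qed

theorem theorem1:
  fixes H :: real
    and M :: "nat \<Rightarrow> 'a measure" and \<omega> :: "nat \<Rightarrow> int \<Rightarrow> 'a \<Rightarrow> real"
    and P :: "'b measure" and Y :: "real \<Rightarrow> 'b \<Rightarrow> real"
  assumes H: "0 < H" "H < 1"
    and prob: "\<And>N. N \<ge> 1 \<Longrightarrow> prob_space (M N)"
    and indep: "\<And>N. N \<ge> 1 \<Longrightarrow> prob_space.indep_vars (M N) (\<lambda>_. borel) (\<omega> N) UNIV"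
    and plus: "\<And>N k. N \<ge> 1 \<Longrightarrow> measure (M N) {x \<in> space (M N). \<omega> N k x = 1} = 1/2"
    and minus: "\<And>N k. N \<ge> 1 \<Longrightarrow> measure (M N) {x \<in> space (M N). \<omega> N k x = -1} = 1/2"
    and fbm: "fractional_BM H P Y"
  defines "Z \<equiv> \<lambda>N x. restrict (\<lambda>t. cH H * X_path H N (\<lambda>k. \<omega> N k x) t) {0..}"
    and "B \<equiv> \<lambda>x. restrict (\<lambda>t. Y t x) {0..}"
  shows "(\<forall>N\<ge>1. Z N \<in> M N \<rightarrow>\<^sub>M borel_of_top skorokhod) \<and>
    B \<in> P \<rightarrow>\<^sub>M borel_of_top skorokhod \<and>
    weak_conv_top skorokhod (\<lambda>N. distr (M N) (borel_of_top skorokhod) (Z N))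
      (distr P (borel_of_top skorokhod) B)"
proof -
  have R: "rademacher (M N) (\<omega> N)" if "N \<ge> 1" for N
    using prob[OF that] indep[OF that] plus[OF that] minus[OF that]
    by (auto simp: rademacher_def rademacher_axioms_def)
  have Z_eq: "Z N = (\<lambda>x. step_path N (\<lambda>n. grid (\<omega> N) H N n x))" for N
    by (simp add: Z_def step_path_def grid_def X_path_def fun_eq_iff)
  have grid_meas: "grid (\<omega> N) H N n \<in> borel_measurable (M N)" if "N \<ge> 1" for N n
    by (rule rademacher.grid_measurable[OF R[OF that]])
  have Y_meas: "Y t \<in> borel_measurable P" if "t \<ge> 0" for t by (rule fractional_BM_normal(1)[OF fbm that])
  have Y_cont: "continuous_on {0..} (\<lambda>t. Y t x)" if "x \<in> space P" for x using fbm that by (simp add: fractional_BM_def)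
  interpret step_process_limit M "\<lambda>N. grid (\<omega> N) H N" P Y
  proof (rule step_process_limit.intro)
    show "(\<lambda>N. CLINT x|M N. iexp (\<Sum>k<n. a k * grid (\<omega> N) H N (cell N (t k)) x)) \<longlonglongrightarrow> (CLINT x|P. iexp (\<Sum>k<n. a k * Y (t k) x))"
      if "\<And>k. t k \<ge> 0" for t a and n :: nat
      unfolding fractional_BM_char[OF fbm that] by (rule grid_fdd_char[OF H R that])
    show "\<exists>L. \<forall>N\<ge>1. measure (M N) {x \<in> space (M N). \<bar>grid (\<omega> N) H N (cell N t) x\<bar> > L} \<le> \<epsilon>"
      if "t \<ge> 0" "\<epsilon> > 0" for t \<epsilon> by (rule grid_tight[OF H R that])
    show "\<forall>\<^sub>F m in sequentially. \<forall>N\<ge>m. small_oscillation (M N) (grid (\<omega> N) H N) N m T \<epsilon> \<eta>"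
      if "\<epsilon> > 0" "\<eta> > 0" for \<epsilon> \<eta> T by (rule grid_modulus_uniform[OF H R that])
    show "prob_space P" using fbm by (simp add: fractional_BM_def)
  qed (use prob grid_meas Y_meas Y_cont in auto)
  have "Z N \<in> M N \<rightarrow>\<^sub>M borel_of_top skorokhod" if "N \<ge> 1" for N
    unfolding Z_eq by (rule step_path_measurable) (use that grid_meas in auto)
  moreover have "B \<in> P \<rightarrow>\<^sub>M borel_of_top skorokhod"
    unfolding B_def by (rule continuous_path_measurable[OF Y_meas Y_cont])
  moreover have "weak_conv_top skorokhod (\<lambda>N. distr (M N) (borel_of_top skorokhod) (Z N)) (distr P (borel_of_top skorokhod) B)"
    using weak_convergence unfolding Z_eq B_def .
  ultimately show ?thesis by blast
qed

end
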